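(* Let $\{W,\widetilde W,Z\}$ be a data set for an LTONP interpolation problem, with $W:\ell^2_+(\mathcal Y)\to\mathcal Z$, $\widetilde W:\ell^2_+(\mathcal U)\to\mathcal Z$, $Z:\mathcal Z\to\mathcal Z$, and assume that $\Lambda=WW^*-\widetilde W\widetilde W^*$ is strictly positive. Then $P=WW^*$ is strictly positive, the operator $\Lambda^{-1}-P^{-1}$ is non-negative, the operator $Z^*$ is pointwise stable and its spectral radius is less than or equal to one. Furthermore, let $C:\mathcal Z\to\mathcal E$ and $D:\mathcal Y\to\mathcal E$ form an admissible pair of complementary operators determined by the data set, put $B=WE_{\mathcal Y}$, $\widetilde B=\widetilde WE_{\mathcal U}$, let $Q_\circ$ and $R_\circ$ be the strictly positive operators $$Q_\circ=\bigl(I_{\mathcal E}+CP(\Lambda^{-1}-P^{-1})PC^*\bigr)^{-1/2}:\mathcal E\to\mathcal E,\qquad R_\circ=\bigl(I_{\mathcal U}+\widetilde B^*\Lambda^{-1}\widetilde B\bigr)^{-1/2}:\mathcal U\to\mathcal U,$$ and define analytic functions on $\mathbb D$ by \begin{align*} \Upsilon_{11}(\lambda)&=D^*Q_\circ+\lambda B^*(I-\lambda Z^* )^{-1}\Lambda^{-1}PC^*Q_\circ,\\ \Upsilon_{12}(\lambda)&=B^*(I-\lambda Z^* )^{-1}\Lambda^{-1}\widetilde BR_\circ,\\ \Upsilon_{21}(\lambda)&=\lambda\widetilde B^*(I-\lambda Z^* )^{-1}\Lambda^{-1}PC^*Q_\circ,\\ \Upsilon_{22}(\lambda)&=R_\circ+\widetilde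 B^*(I-\lambda Z^* )^{-1}\Lambda^{-1}\widetilde BR_\circ . \end{align*} Then all solutions $F$ to the LTONP interpolation problem with data set $\{W,\widetilde W,Z\}$ are given by $$F(\lambda)=\bigl(\Upsilon_{11}(\lambda)X(\lambda)+\Upsilon_{12}(\lambda)\bigr)\bigl(\Upsilon_{21}(\lambda)X(\lambda)+\Upsilon_{22}(\lambda)\bigr)^{-1},\qquad\lambda\in\mathbb D,$$ where the free parameter $X$ is an arbitrary function in $\mathcal S(\mathcal U,\mathcal E)$ (in particular, $\Upsilon_{21}(\lambda)X(\lambda)+\Upsilon_{22}(\lambda)$ is invertible for every $\lambda\in\mathbb D$ and every such $X$). This parameterization is proper, that is, the map $X\mapsto F$ is one-to-one.
   Context: All spaces are complex Hilbert spaces and "operator" means bounded linear operator. An operator is invertible if it is bijective. An operator $T$ on a Hilbert space is strictly positive if $T\ge 0$ and $T$ is invertible; $T$ is pointwise stable if $T^nh\to0$ for every vector $h$. $\mathbb D$ is the open unit disc. For a Hilbert space $\mathcal V$, $\ell^2_+(\mathcal V)$ is the space of square summable unilateral sequences in $\mathcal V$, $S_{\mathcal V}$ is the unilateral forward shift on it, and $E_{\mathcal V}:\mathcal V\to\ell^2_+(\mathcal V)$, $E_{\mathcal V}v=(v,0,0,\dots)$. The Schur class $\mathcal S(\mathcal U,\mathcal Y)$ is the set of analytic functions $F$ on $\mathbb D$ whose values are operators from $\mathcal U$ to $\mathcal Y$ with $\sup_{\lambda\in\mathbb D}\|F(\lambda)\|\le1$; $T_F:\ell^2_+(\mathcal U)\to\ell^2_+(\mathcal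 Y)$ is the (block lower triangular) Toeplitz operator defined by the Taylor coefficients of $F$. An LTONP (left tangential operator Nevanlinna-Pick) data set is a triple of operators $Z:\mathcal Z\to\mathcal Z$, $W:\ell^2_+(\mathcal Y)\to\mathcal Z$, $\widetilde W:\ell^2_+(\mathcal U)\to\mathcal Z$ with $ZW=WS_{\mathcal Y}$ and $Z\widetilde W=\widetilde WS_{\mathcal U}$. A solution of the LTONP interpolation problem with this data set is a function $F\in\mathcal S(\mathcal U,\mathcal Y)$ with $WT_F=\widetilde W$. Let $P=WW^*$ be strictly positive and $B=WE_{\mathcal Y}$. An admissible pair of complementary operators determined by the data set is a pair $C:\mathcal Z\to\mathcal E$, $D:\mathcal Y\to\mathcal E$ (with $\mathcal E$ some Hilbert space) such that $$\begin{bmatrix} D & C \\ B & Z \end{bmatrix}\begin{bmatrix} I_{\mathcal Y} & 0 \\ 0 & P \end{bmatrix}\begin{bmatrix} D^* & B^* \\ C^* & Z^* \end{bmatrix}=\begin{bmatrix} I_{\mathcal E} & 0 \\ 0 & P \end{bmatrix},\qquad \begin{bmatrix} D^* & B^* \\ C^* & Z^* \end{bmatrix}\begin{bmatrix} I_{\mathcal E} & 0 \\ 0 & P^{-1} \end{bmatrix}\begin{bmatrix} D & C \\ B & Z \end{bmatrix}=\begin{bmatrix} I_{\mathcal Y} & 0 \\ 0 & P^{-1} \end{bmatrix}.$$ Such pairs always exist. *)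

theory Defs
  imports "HOL-Analysis.Analysis" "HOL-Library.Nonpos_Ints"
begin

section \<open>Complex Hilbert spaces\<close>

class complex_vector = real_vector +
  fixes scaleC :: "complex \<Rightarrow> 'a \<Rightarrow> 'a"  (infixr "*\<^sub>C" 75)
  assumes scaleC_add_right: "a *\<^sub>C (x + y) = a *\<^sub>C x + a *\<^sub>C y"
    and scaleC_add_left: "(a + b) *\<^sub>C x = a *\<^sub>C x + b *\<^sub>C x"
    and scaleC_scaleC: "a *\<^sub>C (b *\<^sub>C x) = (a * b) *\<^sub>C x"
    and scaleC_of_real: "complex_of_real r *\<^sub>C x = r *\<^sub>R x"

class complex_normed_vector = complex_vector + real_normed_vector +
  assumes norm_scaleC: "norm (a *\<^sub>C x) = cmod a * norm x"

text \<open>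
  The complex inner product is linear in the first argument.  Its real part is the
  real inner product of the underlying class, so it induces the norm of the space.
\<close>

class complex_inner = complex_vector + real_inner +
  fixes cinner :: "'a \<Rightarrow> 'a \<Rightarrow> complex"
  assumes cinner_add_left: "cinner (x + y) z = cinner x z + cinner y z"
    and cinner_scaleC_left: "cinner (a *\<^sub>C x) y = a * cinner x y"
    and cinner_commute: "cinner x y = cnj (cinner y x)"
    and Re_cinner: "Re (cinner x y) = inner x y"
begin

lemma cinner_scaleC_right: "cinner x (a *\<^sub>C y) = cnj a * cinner x y"
  by (metis cinner_commute cinner_scaleC_left complex_cnj_mult)

lemma cinner_add_right: "cinner x (y + z) = cinner x y + cinner x z"
  by (metis cinner_commute cinner_add_left complex_cnj_add)

lemma norm_scaleC_cinner: "norm (a *\<^sub>C x) = cmod a * norm x"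
proof -
  have "cinner (a *\<^sub>C x) (a *\<^sub>C x) = (a * cnj a) * cinner x x"
    by (simp add: cinner_scaleC_left cinner_scaleC_right mult.assoc)
  also have "\<dots> = complex_of_real ((cmod a)\<^sup>2) * cinner x x"
    by (simp only: complex_norm_square)
  finally have "inner (a *\<^sub>C x) (a *\<^sub>C x) = (cmod a)\<^sup>2 * inner x x"
    using Re_cinner[of "a *\<^sub>C x" "a *\<^sub>C x"] Re_cinner[of x x] by simp
  then show ?thesis
    by (simp add: norm_eq_sqrt_inner real_sqrt_mult)
qed

subclass complex_normed_vector
  by standard (rule norm_scaleC_cinner)

end

class complex_hilbert = complex_inner + complete_space

lemma scaleC_zero_right [simp]: "a *\<^sub>C (0 :: 'a::complex_vector) = 0"
  using scaleC_add_right[of a 0 "0::'a"] by simp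

lemma scaleC_minus_right: "a *\<^sub>C (- x) = - (a *\<^sub>C (x :: 'a::complex_vector))"
  using scaleC_add_right[of a x "- x"] by (simp add: eq_neg_iff_add_eq_0 add.commute)

lemma scaleC_diff_right: "a *\<^sub>C (x - y) = a *\<^sub>C x - a *\<^sub>C (y :: 'a::complex_vector)"
  using scaleC_add_right[of a x "- y"] by (simp add: scaleC_minus_right)

lemma scaleC_scaleR: "a *\<^sub>C (r *\<^sub>R x) = r *\<^sub>R (a *\<^sub>C (x :: 'a::complex_vector))"
proof -
  have "a *\<^sub>C (r *\<^sub>R x) = a *\<^sub>C (complex_of_real r *\<^sub>C x)" by (simp only: scaleC_of_real)
  also have "\<dots> = complex_of_real r *\<^sub>C (a *\<^sub>C x)" by (simp only: scaleC_scaleC mult.commute)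
  finally show ?thesis by (simp only: scaleC_of_real)
qed

lemma bounded_linear_scaleC: "bounded_linear (\<lambda>x :: 'a::complex_normed_vector. a *\<^sub>C x)"
  by (rule bounded_linear_intro[where K = "cmod a"])
     (simp_all add: scaleC_add_right scaleC_scaleR norm_scaleC mult.commute)

lemma norm_cinner_le: "cmod (cinner x y) \<le> norm x * norm (y :: 'a::complex_inner)"
proof (cases "cinner x y = 0")
  case False
  define c where "c = cnj (sgn (cinner x y))"
  have c: "cmod c = 1" using False by (simp add: c_def norm_sgn)
  have "c * cinner x y = complex_of_real (cmod (cinner x y))"
    unfolding c_def using False
    by (simp add: sgn_eq complex_norm_square[symmetric] mult.commute power2_eq_square)
  then have "cmod (cinner x y) = Re (cinner (c *\<^sub>C x) y)"
    by (simp add: cinner_scaleC_left)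
  also have "\<dots> \<le> norm (c *\<^sub>C x) * norm y"
    unfolding Re_cinner by (rule norm_cauchy_schwarz)
  finally show ?thesis by (simp add: norm_scaleC c)
qed simp

instantiation complex :: complex_hilbert
begin

definition scaleC_complex :: "complex \<Rightarrow> complex \<Rightarrow> complex"
  where "scaleC_complex a x = a * x"

definition cinner_complex :: "complex \<Rightarrow> complex \<Rightarrow> complex"
  where "cinner_complex x y = x * cnj y"

instance
  by standard
     (simp_all add: scaleC_complex_def cinner_complex_def algebra_simps scaleR_conv_of_real
        inner_complex_def)

end

instantiation prod :: (complex_hilbert, complex_hilbert) complex_hilbert
begin

definition scaleC_prod :: "complex \<Rightarrow> 'a \<times> 'b \<Rightarrow> 'a \<times> 'b"
  where "scaleC_prod a x = (a *\<^sub>C fst x, a *\<^sub>C snd x)"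

definition cinner_prod :: "'a \<times> 'b \<Rightarrow> 'a \<times> 'b \<Rightarrow> complex"
  where "cinner_prod x y = cinner (fst x) (fst y) + cinner (snd x) (snd y)"

instance
proof
  fix x y z :: "'a \<times> 'b" and a b :: complex and r :: real
  show "a *\<^sub>C (x + y) = a *\<^sub>C x + a *\<^sub>C y" by (simp add: scaleC_prod_def scaleC_add_right)
  show "(a + b) *\<^sub>C x = a *\<^sub>C x + b *\<^sub>C x" by (simp add: scaleC_prod_def scaleC_add_left)
  show "a *\<^sub>C (b *\<^sub>C x) = (a * b) *\<^sub>C x" by (simp add: scaleC_prod_def scaleC_scaleC)
  show "complex_of_real r *\<^sub>C x = r *\<^sub>R x"
    by (simp add: scaleC_prod_def scaleC_of_real scaleR_prod_def)
  show "cinner (x + y) z = cinner x z + cinner y z"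
    by (simp add: cinner_prod_def cinner_add_left)
  show "cinner (a *\<^sub>C x) y = a * cinner x y"
    by (simp add: cinner_prod_def scaleC_prod_def cinner_scaleC_left algebra_simps)
  show "cinner x y = cnj (cinner y x)"
    by (simp add: cinner_prod_def cinner_commute[of "fst x"] cinner_commute[of "snd x"])
  show "Re (cinner x y) = inner x y"
    by (simp add: cinner_prod_def Re_cinner inner_prod_def)
qed

end


section \<open>Square summable unilateral sequences\<close>

typedef (overloaded) 'a ell2 = "{f :: nat \<Rightarrow> 'a::complex_inner. summable (\<lambda>n. (norm (f n))\<^sup>2)}"
  morphisms ell2_nth Abs_ell2
  by (rule exI[of _ "\<lambda>_. 0"]) simp

setup_lifting type_definition_ell2

lemma summable_ell2: "summable (\<lambda>n. (norm (ell2_nth x n))\<^sup>2)"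
  using ell2_nth[of x] by simp

lemma norm_add_sq_le: "(norm (a + b))\<^sup>2 \<le> 2 * (norm a)\<^sup>2 + 2 * (norm (b :: 'a::real_inner))\<^sup>2"
  using inner_ge_zero[of "a - b"]
  by (simp add: power2_norm_eq_inner inner_simps inner_commute)

lemma summable_sq_add:
  assumes "summable (\<lambda>n. (norm (f n :: 'a::real_inner))\<^sup>2)" "summable (\<lambda>n. (norm (g n))\<^sup>2)"
  shows "summable (\<lambda>n. (norm (f n + g n))\<^sup>2)"
proof (rule summable_comparison_test'[where N = 0])
  show "summable (\<lambda>n. 2 * (norm (f n))\<^sup>2 + 2 * (norm (g n))\<^sup>2)"
    by (intro summable_add summable_mult assms)
qed (simp add: norm_add_sq_le)

lemma summable_cinner_ell2: "summable (\<lambda>n. cinner (ell2_nth x n) (ell2_nth y n))"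
proof (rule summable_comparison_test'[where N = 0])
  show "summable (\<lambda>n. (norm (ell2_nth x n))\<^sup>2 + (norm (ell2_nth y n))\<^sup>2)"
    by (intro summable_add summable_ell2)
  fix n
  have "norm (cinner (ell2_nth x n) (ell2_nth y n)) \<le> norm (ell2_nth x n) * norm (ell2_nth y n)"
    by (rule norm_cinner_le)
  also have "\<dots> \<le> (norm (ell2_nth x n))\<^sup>2 + (norm (ell2_nth y n))\<^sup>2"
    using sum_squares_bound[of "norm (ell2_nth x n)" "norm (ell2_nth y n)"]
      mult_nonneg_nonneg[OF norm_ge_zero[of "ell2_nth x n"] norm_ge_zero[of "ell2_nth y n"]]
    by linarith
  finally show "norm (cinner (ell2_nth x n) (ell2_nth y n))
      \<le> (norm (ell2_nth x n))\<^sup>2 + (norm (ell2_nth y n))\<^sup>2" .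
qed

lemma summable_inner_ell2: "summable (\<lambda>n. inner (ell2_nth x n) (ell2_nth y n))"
  using summable_Re[OF summable_cinner_ell2[of x y]] by (simp add: Re_cinner)

instantiation ell2 :: (complex_inner) complex_inner
begin

lift_definition zero_ell2 :: "'a ell2" is "\<lambda>_. 0" by simp

lift_definition plus_ell2 :: "'a ell2 \<Rightarrow> 'a ell2 \<Rightarrow> 'a ell2" is "\<lambda>f g n. f n + g n"
  by (rule summable_sq_add)

lift_definition uminus_ell2 :: "'a ell2 \<Rightarrow> 'a ell2" is "\<lambda>f n. - f n" by simp

lift_definition minus_ell2 :: "'a ell2 \<Rightarrow> 'a ell2 \<Rightarrow> 'a ell2" is "\<lambda>f g n. f n - g n"
  subgoal for f g using summable_sq_add[of f "\<lambda>n. - g n"] by simp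
  done

lift_definition scaleR_ell2 :: "real \<Rightarrow> 'a ell2 \<Rightarrow> 'a ell2" is "\<lambda>r f n. r *\<^sub>R f n"
  by (simp add: power_mult_distrib summable_mult)

lift_definition scaleC_ell2 :: "complex \<Rightarrow> 'a ell2 \<Rightarrow> 'a ell2" is "\<lambda>a f n. a *\<^sub>C f n"
  by (simp add: norm_scaleC power_mult_distrib summable_mult)

definition cinner_ell2 :: "'a ell2 \<Rightarrow> 'a ell2 \<Rightarrow> complex"
  where "cinner_ell2 x y = (\<Sum>n. cinner (ell2_nth x n) (ell2_nth y n))"

definition inner_ell2 :: "'a ell2 \<Rightarrow> 'a ell2 \<Rightarrow> real"
  where "inner_ell2 x y = (\<Sum>n. inner (ell2_nth x n) (ell2_nth y n))"

definition norm_ell2 :: "'a ell2 \<Rightarrow> real"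
  where "norm_ell2 x = sqrt (inner x x)"

definition sgn_ell2 :: "'a ell2 \<Rightarrow> 'a ell2"
  where "sgn_ell2 x = inverse (norm x) *\<^sub>R x"

definition dist_ell2 :: "'a ell2 \<Rightarrow> 'a ell2 \<Rightarrow> real"
  where "dist_ell2 x y = norm (x - y)"

definition uniformity_ell2 :: "('a ell2 \<times> 'a ell2) filter"
  where "uniformity_ell2 = (INF e\<in>{0<..}. principal {(x, y). dist x y < e})"

definition open_ell2 :: "'a ell2 set \<Rightarrow> bool"
  where "open_ell2 S = (\<forall>x\<in>S. \<forall>\<^sub>F (x', y) in uniformity. x' = x \<longrightarrow> y \<in> S)"

instance
proof
  fix x y z :: "'a ell2" and a b :: complex and r s :: real
  show "x + y + z = x + (y + z)" by transfer (simp add: add.assoc)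
  show "x + y = y + x" by transfer (simp add: add.commute)
  show "0 + x = x" by transfer simp
  show "- x + x = 0" by transfer simp
  show "x - y = x + - y" by transfer simp
  show "r *\<^sub>R (x + y) = r *\<^sub>R x + r *\<^sub>R y" by transfer (simp add: scaleR_add_right)
  show "(r + s) *\<^sub>R x = r *\<^sub>R x + s *\<^sub>R x" by transfer (simp add: scaleR_add_left)
  show "r *\<^sub>R s *\<^sub>R x = (r * s) *\<^sub>R x" by transfer simp
  show "1 *\<^sub>R x = x" by transfer simp
  show "a *\<^sub>C (x + y) = a *\<^sub>C x + a *\<^sub>C y" by transfer (simp add: scaleC_add_right)
  show "(a + b) *\<^sub>C x = a *\<^sub>C x + b *\<^sub>C x" by transfer (simp add: scaleC_add_left)
  show "a *\<^sub>C b *\<^sub>C x = (a * b) *\<^sub>C x" by transfer (simp add: scaleC_scaleC)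
  show "complex_of_real r *\<^sub>C x = r *\<^sub>R x" by transfer (simp add: scaleC_of_real)
  show "sgn x = inverse (norm x) *\<^sub>R x" by (rule sgn_ell2_def)
  show "dist x y = norm (x - y)" by (rule dist_ell2_def)
  show "uniformity = (INF e\<in>{0<..}. principal {(x, y :: 'a ell2). dist x y < e})"
    by (rule uniformity_ell2_def)
  fix S :: "'a ell2 set"
  show "open S = (\<forall>x\<in>S. \<forall>\<^sub>F (x', y) in uniformity. x' = x \<longrightarrow> y \<in> S)"
    by (rule open_ell2_def)
  show "inner x y = inner y x" by (simp add: inner_ell2_def inner_commute)
  show "inner (x + y) z = inner x z + inner y z"
    unfolding inner_ell2_def plus_ell2.rep_eq inner_add_left
    by (rule suminf_add[symmetric]; rule summable_inner_ell2)
  show "inner (r *\<^sub>R x) y = r * inner x y"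
    unfolding inner_ell2_def scaleR_ell2.rep_eq inner_scaleR_left
    by (rule suminf_mult; rule summable_inner_ell2)
  show "0 \<le> inner x x"
    unfolding inner_ell2_def by (rule suminf_nonneg; simp add: summable_inner_ell2)
  show "(inner x x = 0) = (x = 0)"
    unfolding inner_ell2_def
    by (subst suminf_eq_zero_iff)
       (auto simp: summable_inner_ell2 ell2_nth_inject[symmetric] zero_ell2.rep_eq)
  show "norm x = sqrt (inner x x)" by (rule norm_ell2_def)
  show "cinner (x + y) z = cinner x z + cinner y z"
    unfolding cinner_ell2_def plus_ell2.rep_eq cinner_add_left
    by (rule suminf_add[symmetric]; rule summable_cinner_ell2)
  show "cinner (a *\<^sub>C x) y = a * cinner x y"
    unfolding cinner_ell2_def scaleC_ell2.rep_eq cinner_scaleC_left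
    by (rule suminf_mult; rule summable_cinner_ell2)
  show "cinner x y = cnj (cinner y x)"
  proof -
    have "cinner (ell2_nth x n) (ell2_nth y n) = cnj (cinner (ell2_nth y n) (ell2_nth x n))" for n
      by (rule cinner_commute)
    moreover have "(\<lambda>n. cnj (cinner (ell2_nth y n) (ell2_nth x n))) sums cnj (cinner y x)"
      unfolding cinner_ell2_def sums_cnj by (rule summable_sums[OF summable_cinner_ell2])
    ultimately show ?thesis
      by (simp only: cinner_ell2_def[of x y] sums_unique[symmetric])
  qed
  show "Re (cinner x y) = inner x y"
    unfolding cinner_ell2_def inner_ell2_def
    by (simp add: Re_suminf summable_cinner_ell2 Re_cinner)
qed

end

lemma norm_ell2_sq: "(norm x)\<^sup>2 = (\<Sum>n. (norm (ell2_nth x n))\<^sup>2)"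
  by (simp add: power2_norm_eq_inner inner_ell2_def)

lemma sum_le_norm_ell2_sq: "finite I \<Longrightarrow> (\<Sum>n\<in>I. (norm (ell2_nth x n))\<^sup>2) \<le> (norm x)\<^sup>2"
  unfolding norm_ell2_sq by (rule sum_le_suminf) (simp_all add: summable_ell2)

lemma norm_ell2_nth_le: "norm (ell2_nth x n) \<le> norm x"
  using sum_le_norm_ell2_sq[of "{n}" x] by (simp add: power2_le_iff_abs_le)

instance ell2 :: (complex_hilbert) complex_hilbert
proof
  fix X :: "nat \<Rightarrow> 'a ell2"
  assume X: "Cauchy X"
  have "Cauchy (\<lambda>m. ell2_nth (X m) k)" for k
  proof (rule metric_CauchyI)
    fix e :: real assume "0 < e"
    then obtain M where M: "\<And>m n. m \<ge> M \<Longrightarrow> n \<ge> M \<Longrightarrow> dist (X m) (X n) < e"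
      using X by (meson metric_CauchyD)
    have "dist (ell2_nth (X m) k) (ell2_nth (X n) k) \<le> dist (X m) (X n)" for m n
      using norm_ell2_nth_le[of "X m - X n" k] by (simp add: dist_norm minus_ell2.rep_eq)
    then show "\<exists>M. \<forall>m\<ge>M. \<forall>n\<ge>M. dist (ell2_nth (X m) k) (ell2_nth (X n) k) < e"
      using M by (meson le_less_trans)
  qed
  then have "\<forall>k. \<exists>l. (\<lambda>m. ell2_nth (X m) k) \<longlonglongrightarrow> l"
    using Cauchy_convergent convergent_def by blast
  then obtain l where l: "\<And>k. (\<lambda>m. ell2_nth (X m) k) \<longlonglongrightarrow> l k" by metis
  have part: "(\<Sum>k<N. (norm (ell2_nth (X m) k - l k))\<^sup>2) \<le> e\<^sup>2"
    if e: "0 < e" and M: "\<And>m n. m \<ge> M \<Longrightarrow> n \<ge> M \<Longrightarrow> dist (X m) (X n) < e" and m: "m \<ge> M"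
    for e M m N
  proof (rule tendsto_upperbound[where F = sequentially])
    show "(\<lambda>n. \<Sum>k<N. (norm (ell2_nth (X m) k - ell2_nth (X n) k))\<^sup>2)
        \<longlonglongrightarrow> (\<Sum>k<N. (norm (ell2_nth (X m) k - l k))\<^sup>2)"
      by (intro tendsto_intros l)
    show "\<forall>\<^sub>F n in sequentially. (\<Sum>k<N. (norm (ell2_nth (X m) k - ell2_nth (X n) k))\<^sup>2) \<le> e\<^sup>2"
      using eventually_ge_at_top[of M]
    proof eventually_elim
      case (elim n)
      have "(\<Sum>k<N. (norm (ell2_nth (X m) k - ell2_nth (X n) k))\<^sup>2) \<le> (norm (X m - X n))\<^sup>2"
        using sum_le_norm_ell2_sq[of "{..<N}" "X m - X n"] by (simp add: minus_ell2.rep_eq)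
      also have "\<dots> \<le> e\<^sup>2"
        using M[OF m elim] by (intro power_mono) (auto simp: dist_norm)
      finally show ?case .
    qed
  qed simp
  have summ: "summable (\<lambda>k. (norm (ell2_nth (X m) k - l k))\<^sup>2)"
    and le: "(\<Sum>k. (norm (ell2_nth (X m) k - l k))\<^sup>2) \<le> e\<^sup>2"
    if "0 < e" "\<And>m n. m \<ge> M \<Longrightarrow> n \<ge> M \<Longrightarrow> dist (X m) (X n) < e" "m \<ge> M" for e M m
  proof -
    show s: "summable (\<lambda>k. (norm (ell2_nth (X m) k - l k))\<^sup>2)"
      using part[OF that] by (intro summableI_nonneg_bounded[where x = "e\<^sup>2"]) auto
    show "(\<Sum>k. (norm (ell2_nth (X m) k - l k))\<^sup>2) \<le> e\<^sup>2"
      using part[OF that] by (intro suminf_le_const[OF s]) auto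
  qed
  obtain M1 where M1: "\<And>m n. m \<ge> M1 \<Longrightarrow> n \<ge> M1 \<Longrightarrow> dist (X m) (X n) < 1"
    using X by (meson metric_CauchyD zero_less_one)
  have "summable (\<lambda>k. (norm (ell2_nth (X M1) k - (ell2_nth (X M1) k - l k)))\<^sup>2)"
    using summable_sq_add[OF summable_ell2[of "X M1"],
        of "\<lambda>k. - (ell2_nth (X M1) k - l k)"] summ[OF _ M1, of M1]
    by (simp add: norm_minus_commute)
  then have sl: "summable (\<lambda>k. (norm (l k))\<^sup>2)" by simp
  define L where "L = Abs_ell2 l"
  have L: "ell2_nth L = l" using sl by (simp add: L_def Abs_ell2_inverse)
  have "X \<longlonglongrightarrow> L"
  proof (rule metric_LIMSEQ_I)
    fix r :: real assume r: "0 < r"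
    then obtain M where M: "\<And>m n. m \<ge> M \<Longrightarrow> n \<ge> M \<Longrightarrow> dist (X m) (X n) < r / 2"
      using X by (meson metric_CauchyD half_gt_zero)
    have "dist (X m) L < r" if "m \<ge> M" for m
    proof -
      have "(norm (X m - L))\<^sup>2 \<le> (r / 2)\<^sup>2"
        using le[OF _ M that] r by (simp add: norm_ell2_sq minus_ell2.rep_eq L)
      then have "norm (X m - L) \<le> r / 2"
        using r by (simp add: power2_le_iff_abs_le)
      then show ?thesis using r by (simp add: dist_norm)
    qed
    then show "\<exists>M. \<forall>m\<ge>M. dist (X m) L < r" by blast
  qed
  then show "convergent X" by (rule convergentI)
qed


section \<open>Operators\<close>

typedef (overloaded) ('a, 'b) cblinfun  ("(_ \<Rightarrow>\<^sub>C\<^sub>L /_)" [22, 21] 21) =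
  "{f :: 'a::complex_normed_vector \<Rightarrow>\<^sub>L 'b::complex_normed_vector.
      \<forall>c x. blinfun_apply f (c *\<^sub>C x) = c *\<^sub>C blinfun_apply f x}"
  morphisms blinfun_of_cblinfun Abs_cblinfun
  by (rule exI[of _ 0]) simp

setup_lifting type_definition_cblinfun

instantiation cblinfun :: (complex_normed_vector, complex_normed_vector) complex_normed_vector
begin

lift_definition zero_cblinfun :: "'a \<Rightarrow>\<^sub>C\<^sub>L 'b" is 0 by simp

lift_definition plus_cblinfun :: "'a \<Rightarrow>\<^sub>C\<^sub>L 'b \<Rightarrow> 'a \<Rightarrow>\<^sub>C\<^sub>L 'b \<Rightarrow> 'a \<Rightarrow>\<^sub>C\<^sub>L 'b" is "(+)"
  by (simp add: blinfun.add_left scaleC_add_right)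

lift_definition uminus_cblinfun :: "'a \<Rightarrow>\<^sub>C\<^sub>L 'b \<Rightarrow> 'a \<Rightarrow>\<^sub>C\<^sub>L 'b" is uminus
  by (simp add: blinfun.minus_left scaleC_minus_right)

lift_definition minus_cblinfun :: "'a \<Rightarrow>\<^sub>C\<^sub>L 'b \<Rightarrow> 'a \<Rightarrow>\<^sub>C\<^sub>L 'b \<Rightarrow> 'a \<Rightarrow>\<^sub>C\<^sub>L 'b" is "(-)"
  by (simp add: blinfun.diff_left scaleC_diff_right)

lift_definition scaleR_cblinfun :: "real \<Rightarrow> 'a \<Rightarrow>\<^sub>C\<^sub>L 'b \<Rightarrow> 'a \<Rightarrow>\<^sub>C\<^sub>L 'b" is scaleR
  by (simp add: blinfun.scaleR_left scaleC_scaleR)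

lift_definition scaleC_cblinfun :: "complex \<Rightarrow> 'a \<Rightarrow>\<^sub>C\<^sub>L 'b \<Rightarrow> 'a \<Rightarrow>\<^sub>C\<^sub>L 'b"
  is "\<lambda>a f. Blinfun (\<lambda>x. a *\<^sub>C blinfun_apply f x)"
  by (simp add: bounded_linear_Blinfun_apply bounded_linear_compose[OF bounded_linear_scaleC]
      blinfun.bounded_linear_right scaleC_scaleC mult.commute)

lift_definition norm_cblinfun :: "'a \<Rightarrow>\<^sub>C\<^sub>L 'b \<Rightarrow> real" is norm .

definition sgn_cblinfun :: "'a \<Rightarrow>\<^sub>C\<^sub>L 'b \<Rightarrow> 'a \<Rightarrow>\<^sub>C\<^sub>L 'b"
  where "sgn_cblinfun x = inverse (norm x) *\<^sub>R x"

definition dist_cblinfun :: "'a \<Rightarrow>\<^sub>C\<^sub>L 'b \<Rightarrow> 'a \<Rightarrow>\<^sub>C\<^sub>L 'b \<Rightarrow> real"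
  where "dist_cblinfun x y = norm (x - y)"

definition uniformity_cblinfun :: "(('a \<Rightarrow>\<^sub>C\<^sub>L 'b) \<times> ('a \<Rightarrow>\<^sub>C\<^sub>L 'b)) filter"
  where "uniformity_cblinfun = (INF e\<in>{0<..}. principal {(x, y). dist x y < e})"

definition open_cblinfun :: "('a \<Rightarrow>\<^sub>C\<^sub>L 'b) set \<Rightarrow> bool"
  where "open_cblinfun S = (\<forall>x\<in>S. \<forall>\<^sub>F (x', y) in uniformity. x' = x \<longrightarrow> y \<in> S)"

lemma blinfun_apply_scaleC_cblinfun:
  "blinfun_apply (blinfun_of_cblinfun (a *\<^sub>C f)) x = a *\<^sub>C blinfun_apply (blinfun_of_cblinfun f) x"
  by (simp add: scaleC_cblinfun.rep_eq bounded_linear_Blinfun_apply blinfun.bounded_linear_right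
      bounded_linear_compose[OF bounded_linear_scaleC])

instance
proof
  fix x y z :: "'a \<Rightarrow>\<^sub>C\<^sub>L 'b" and a b :: complex and r s :: real
  show "x + y + z = x + (y + z)" by transfer (simp add: add.assoc)
  show "x + y = y + x" by transfer (simp add: add.commute)
  show "0 + x = x" by transfer simp
  show "- x + x = 0" by transfer simp
  show "x - y = x + - y" by transfer simp
  show "r *\<^sub>R (x + y) = r *\<^sub>R x + r *\<^sub>R y" by transfer (simp add: scaleR_add_right)
  show "(r + s) *\<^sub>R x = r *\<^sub>R x + s *\<^sub>R x" by transfer (simp add: scaleR_add_left)
  show "r *\<^sub>R s *\<^sub>R x = (r * s) *\<^sub>R x" by transfer simp
  show "1 *\<^sub>R x = x" by transfer simp
  note ext = iffD1[OF blinfun_of_cblinfun_inject] blinfun_eqI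
  show "a *\<^sub>C (x + y) = a *\<^sub>C x + a *\<^sub>C y"
    by (intro ext) (simp add: blinfun_apply_scaleC_cblinfun plus_cblinfun.rep_eq
        blinfun.add_left scaleC_add_right)
  show "(a + b) *\<^sub>C x = a *\<^sub>C x + b *\<^sub>C x"
    by (intro ext) (simp add: blinfun_apply_scaleC_cblinfun plus_cblinfun.rep_eq
        blinfun.add_left scaleC_add_left)
  show "a *\<^sub>C b *\<^sub>C x = (a * b) *\<^sub>C x"
    by (intro ext) (simp add: blinfun_apply_scaleC_cblinfun scaleC_scaleC)
  show "complex_of_real r *\<^sub>C x = r *\<^sub>R x"
    by (intro ext) (simp add: blinfun_apply_scaleC_cblinfun scaleR_cblinfun.rep_eq
        blinfun.scaleR_left scaleC_of_real)
  show "sgn x = inverse (norm x) *\<^sub>R x" by (rule sgn_cblinfun_def)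
  show "dist x y = norm (x - y)" by (rule dist_cblinfun_def)
  show "uniformity = (INF e\<in>{0<..}. principal {(x, y :: 'a \<Rightarrow>\<^sub>C\<^sub>L 'b). dist x y < e})"
    by (rule uniformity_cblinfun_def)
  fix S :: "('a \<Rightarrow>\<^sub>C\<^sub>L 'b) set"
  show "open S = (\<forall>x\<in>S. \<forall>\<^sub>F (x', y) in uniformity. x' = x \<longrightarrow> y \<in> S)"
    by (rule open_cblinfun_def)
  show "(norm x = 0) = (x = 0)" by transfer simp
  show "norm (x + y) \<le> norm x + norm y" by transfer (rule norm_triangle_ineq)
  show "norm (r *\<^sub>R x) = \<bar>r\<bar> * norm x" by transfer simp
  show "norm (a *\<^sub>C x) = cmod a * norm x"
  proof (rule antisym)
    have le: "norm (c *\<^sub>C f) \<le> cmod c * norm f" for c and f :: "'a \<Rightarrow>\<^sub>C\<^sub>L 'b"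
      unfolding norm_cblinfun.rep_eq
    proof (rule norm_blinfun_bound)
      show "norm (blinfun_apply (blinfun_of_cblinfun (c *\<^sub>C f)) u)
          \<le> cmod c * norm (blinfun_of_cblinfun f) * norm u" for u
        by (simp add: blinfun_apply_scaleC_cblinfun norm_scaleC mult.assoc mult_left_mono
            norm_blinfun)
    qed simp
    show "norm (a *\<^sub>C x) \<le> cmod a * norm x" by (rule le)
    show "cmod a * norm x \<le> norm (a *\<^sub>C x)"
    proof (cases "a = 0")
      case False
      have "inverse a *\<^sub>C (a *\<^sub>C x) = x"
        using False by (intro ext)
          (simp add: blinfun_apply_scaleC_cblinfun scaleC_scaleC scaleC_of_real[of 1, simplified])
      then have "norm x \<le> inverse (cmod a) * norm (a *\<^sub>C x)"
        using le[of "inverse a" "a *\<^sub>C x"] by (simp add: norm_inverse)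
      then show ?thesis using False by (simp add: field_simps)
    qed (simp add: norm_cblinfun.rep_eq)
  qed
qed

end

definition cblinfun_apply :: "('a::complex_normed_vector \<Rightarrow>\<^sub>C\<^sub>L 'b::complex_normed_vector) \<Rightarrow> 'a \<Rightarrow> 'b"
  where "cblinfun_apply T = blinfun_apply (blinfun_of_cblinfun T)"

text \<open>
  Meaningful only if \<open>f\<close> is a bounded complex linear map, in the same way as the
  library's \<^const>\<open>Blinfun\<close>.
\<close>

definition CBlinfun :: "('a \<Rightarrow> 'b) \<Rightarrow> ('a::complex_normed_vector \<Rightarrow>\<^sub>C\<^sub>L 'b::complex_normed_vector)"
  where "CBlinfun f = Abs_cblinfun (Blinfun f)"

lemma CBlinfun_apply:
  assumes "bounded_linear f" "\<And>c x. f (c *\<^sub>C x) = c *\<^sub>C f x"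
  shows "cblinfun_apply (CBlinfun f) x = f x"
  using assms
  by (simp add: cblinfun_apply_def CBlinfun_def bounded_linear_Blinfun_apply Abs_cblinfun_inverse)

lift_definition id_cblinfun :: "'a::complex_normed_vector \<Rightarrow>\<^sub>C\<^sub>L 'a" is id_blinfun
  by simp

lift_definition cblinfun_compose ::
    "'b::complex_normed_vector \<Rightarrow>\<^sub>C\<^sub>L 'c::complex_normed_vector \<Rightarrow>
     'a::complex_normed_vector \<Rightarrow>\<^sub>C\<^sub>L 'b \<Rightarrow> 'a \<Rightarrow>\<^sub>C\<^sub>L 'c"  (infixl "\<circ>\<^sub>C" 67)
  is blinfun_compose
  by simp

definition adj :: "('a::complex_hilbert \<Rightarrow>\<^sub>C\<^sub>L 'b::complex_hilbert) \<Rightarrow> 'b \<Rightarrow>\<^sub>C\<^sub>L 'a"  ("_\<^sup>\<dagger>" [1000] 999)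
  where "T\<^sup>\<dagger> = (THE S. \<forall>x y. cinner (cblinfun_apply T x) y = cinner x (cblinfun_apply S y))"

definition op_invertible :: "('a::complex_normed_vector \<Rightarrow>\<^sub>C\<^sub>L 'b::complex_normed_vector) \<Rightarrow> bool"
  where "op_invertible T \<longleftrightarrow> bij (cblinfun_apply T)"

text \<open>
  For bijective \<open>T\<close> between complete spaces, \<open>inv T\<close> is bounded by the bounded inverse theorem,
  so \<^const>\<open>CBlinfun\<close> is meaningful here.
\<close>

definition op_inv :: "('a::complex_normed_vector \<Rightarrow>\<^sub>C\<^sub>L 'b::complex_normed_vector) \<Rightarrow> 'b \<Rightarrow>\<^sub>C\<^sub>L 'a"
  where "op_inv T = CBlinfun (inv (cblinfun_apply T))"

definition nonneg_op :: "('a::complex_inner \<Rightarrow>\<^sub>C\<^sub>L 'a) \<Rightarrow> bool"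
  where "nonneg_op T \<longleftrightarrow> (\<forall>h. cinner (cblinfun_apply T h) h \<in> \<real>\<^sub>\<ge>\<^sub>0)"

definition strictly_positive :: "('a::complex_inner \<Rightarrow>\<^sub>C\<^sub>L 'a) \<Rightarrow> bool"
  where "strictly_positive T \<longleftrightarrow> nonneg_op T \<and> op_invertible T"

text \<open>The unique non-negative square root of a non-negative operator.\<close>

definition op_sqrt :: "('a::complex_hilbert \<Rightarrow>\<^sub>C\<^sub>L 'a) \<Rightarrow> 'a \<Rightarrow>\<^sub>C\<^sub>L 'a"
  where "op_sqrt T = (THE S. nonneg_op S \<and> S \<circ>\<^sub>C S = T)"

definition pointwise_stable :: "('a::complex_normed_vector \<Rightarrow>\<^sub>C\<^sub>L 'a) \<Rightarrow> bool"
  where "pointwise_stable T \<longleftrightarrow> (\<forall>h. (\<lambda>n. (cblinfun_apply T ^^ n) h) \<longlonglongrightarrow> 0)"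

definition op_spectrum :: "('a::complex_normed_vector \<Rightarrow>\<^sub>C\<^sub>L 'a) \<Rightarrow> complex set"
  where "op_spectrum T = {\<mu>. \<not> op_invertible (\<mu> *\<^sub>C id_cblinfun - T)}"

text \<open>
  The spectrum is empty exactly when the space is \<open>{0}\<close>; inserting \<open>0\<close> makes the
  spectral radius \<open>0\<close> in that case and changes nothing otherwise.
\<close>

definition op_spectral_radius :: "('a::complex_normed_vector \<Rightarrow>\<^sub>C\<^sub>L 'a) \<Rightarrow> real"
  where "op_spectral_radius T = Sup (insert 0 (cmod ` op_spectrum T))"

lemma bounded_linear_block:
  "bounded_linear (\<lambda>x. (blinfun_apply A (fst x) + blinfun_apply B (snd x),
     blinfun_apply C (fst x) + blinfun_apply D (snd x)))"
  by (intro bounded_linear_Pair bounded_linear_add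
      bounded_linear_compose[OF blinfun.bounded_linear_right] bounded_linear_fst bounded_linear_snd)

text \<open>\<open>block_op A B C D\<close> is the operator matrix with rows \<open>A, B\<close> and \<open>C, D\<close>.\<close>

lift_definition block_op ::
    "'a::complex_hilbert \<Rightarrow>\<^sub>C\<^sub>L 'c::complex_hilbert \<Rightarrow> 'b::complex_hilbert \<Rightarrow>\<^sub>C\<^sub>L 'c \<Rightarrow>
     'a \<Rightarrow>\<^sub>C\<^sub>L 'd::complex_hilbert \<Rightarrow> 'b \<Rightarrow>\<^sub>C\<^sub>L 'd \<Rightarrow> ('a \<times> 'b) \<Rightarrow>\<^sub>C\<^sub>L ('c \<times> 'd)"
  is "\<lambda>A B C D. Blinfun (\<lambda>x. (blinfun_apply A (fst x) + blinfun_apply B (snd x),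
                             blinfun_apply C (fst x) + blinfun_apply D (snd x)))"
  by (simp add: bounded_linear_Blinfun_apply[OF bounded_linear_block] scaleC_prod_def
      scaleC_add_right)

lift_definition ell2_shift_seq :: "'a::complex_inner ell2 \<Rightarrow> 'a ell2"
  is "\<lambda>f n. case n of 0 \<Rightarrow> 0 | Suc m \<Rightarrow> f m"
  subgoal for f using summable_Suc_iff[of "\<lambda>n. (norm (case n of 0 \<Rightarrow> 0 | Suc m \<Rightarrow> f m))\<^sup>2"] by simp
  done

lift_definition ell2_single_zero :: "'a::complex_inner \<Rightarrow> 'a ell2"
  is "\<lambda>v n. if n = 0 then v else 0"
  subgoal for v
    by (rule summable_finite[of "{0}"]) auto
  done

definition shift_op :: "'a::complex_inner ell2 \<Rightarrow>\<^sub>C\<^sub>L 'a ell2"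
  where "shift_op = CBlinfun ell2_shift_seq"

definition embed_op :: "'a::complex_inner \<Rightarrow>\<^sub>C\<^sub>L 'a ell2"
  where "embed_op = CBlinfun ell2_single_zero"

lemma norm_ell2_shift_seq: "norm (ell2_shift_seq x) = norm x"
proof -
  have "(norm (ell2_shift_seq x))\<^sup>2 = (norm x)\<^sup>2"
    unfolding norm_ell2_sq
    by (subst suminf_split_head[OF summable_ell2, symmetric, simplified diff_eq_eq])
       (simp add: ell2_shift_seq.rep_eq)
  then show ?thesis by simp
qed

lemma norm_ell2_single_zero: "norm (ell2_single_zero v) = norm v"
proof -
  have "(norm (ell2_single_zero v))\<^sup>2 = (norm v)\<^sup>2"
    unfolding norm_ell2_sq by (subst suminf_finite[of "{0}"]) (auto simp: ell2_single_zero.rep_eq)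
  then show ?thesis by simp
qed

lemma shift_op_apply: "cblinfun_apply shift_op x = ell2_shift_seq x"
  unfolding shift_op_def
proof (rule CBlinfun_apply)
  show "bounded_linear (ell2_shift_seq :: 'a ell2 \<Rightarrow> 'a ell2)"
    by (rule bounded_linear_intro[where K = 1])
       (auto simp: norm_ell2_shift_seq ell2_nth_inject[symmetric] ell2_shift_seq.rep_eq
          plus_ell2.rep_eq scaleR_ell2.rep_eq fun_eq_iff split: nat.split)
qed (auto simp: ell2_nth_inject[symmetric] ell2_shift_seq.rep_eq scaleC_ell2.rep_eq fun_eq_iff
      split: nat.split)

lemma embed_op_apply: "cblinfun_apply embed_op v = ell2_single_zero v"
  unfolding embed_op_def
proof (rule CBlinfun_apply)
  show "bounded_linear (ell2_single_zero :: 'a \<Rightarrow> 'a ell2)"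
    by (rule bounded_linear_intro[where K = 1])
       (auto simp: norm_ell2_single_zero ell2_nth_inject[symmetric] ell2_single_zero.rep_eq
          plus_ell2.rep_eq scaleR_ell2.rep_eq fun_eq_iff)
qed (auto simp: ell2_nth_inject[symmetric] ell2_single_zero.rep_eq scaleC_ell2.rep_eq fun_eq_iff)


section \<open>Schur class functions and interpolation\<close>

abbreviation unit_disc :: "complex set"  ("\<DD>")
  where "\<DD> \<equiv> ball 0 1"

text \<open>
  Complex differentiability in the (operator) norm: the vector-valued version of
  \<^const>\<open>holomorphic_on\<close> for the open set \<open>\<DD>\<close>.
\<close>

definition analytic_on_disc :: "(complex \<Rightarrow> 'a::complex_normed_vector) \<Rightarrow> bool"
  where "analytic_on_disc F \<longleftrightarrow> (\<forall>z\<in>\<DD>. \<exists>G. (F has_derivative (\<lambda>h. h *\<^sub>C G)) (at z))"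

text \<open>
  Functions on \<open>\<DD>\<close> are represented by functions on all of \<open>\<complex>\<close>, and only their values on
  \<open>\<DD>\<close> matter.
\<close>

definition schur_class :: "(complex \<Rightarrow> ('u::complex_hilbert \<Rightarrow>\<^sub>C\<^sub>L 'y::complex_hilbert)) set"
  where "schur_class = {F. analytic_on_disc F \<and> (\<forall>z\<in>\<DD>. norm (F z) \<le> 1)}"

text \<open>The unique coefficients of the power series expansion at \<open>0\<close> on \<open>\<DD>\<close>.\<close>

definition taylor_coeffs :: "(complex \<Rightarrow> 'a::complex_normed_vector) \<Rightarrow> nat \<Rightarrow> 'a"
  where "taylor_coeffs F = (THE A. \<forall>z\<in>\<DD>. (\<lambda>n. z ^ n *\<^sub>C A n) sums F z)"

definition toeplitz_op ::
    "(complex \<Rightarrow> ('u::complex_hilbert \<Rightarrow>\<^sub>C\<^sub>L 'y::complex_hilbert)) \<Rightarrow> 'u ell2 \<Rightarrow>\<^sub>C\<^sub>L 'y ell2"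
  where "toeplitz_op F =
    CBlinfun (\<lambda>u. Abs_ell2 (\<lambda>n. \<Sum>k\<le>n. cblinfun_apply (taylor_coeffs F (n - k)) (ell2_nth u k)))"

definition ltonp_data ::
    "('z::complex_hilbert \<Rightarrow>\<^sub>C\<^sub>L 'z) \<Rightarrow> ('y::complex_hilbert ell2 \<Rightarrow>\<^sub>C\<^sub>L 'z) \<Rightarrow>
     ('u::complex_hilbert ell2 \<Rightarrow>\<^sub>C\<^sub>L 'z) \<Rightarrow> bool"
  where "ltonp_data Z W Wt \<longleftrightarrow> Z \<circ>\<^sub>C W = W \<circ>\<^sub>C shift_op \<and> Z \<circ>\<^sub>C Wt = Wt \<circ>\<^sub>C shift_op"

definition ltonp_solution ::
    "('y::complex_hilbert ell2 \<Rightarrow>\<^sub>C\<^sub>L 'z::complex_hilbert) \<Rightarrow> ('u::complex_hilbert ell2 \<Rightarrow>\<^sub>C\<^sub>L 'z) \<Rightarrow>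
     (complex \<Rightarrow> ('u \<Rightarrow>\<^sub>C\<^sub>L 'y)) \<Rightarrow> bool"
  where "ltonp_solution W Wt F \<longleftrightarrow> F \<in> schur_class \<and> W \<circ>\<^sub>C toeplitz_op F = Wt"

definition admissible_pair ::
    "('z::complex_hilbert \<Rightarrow>\<^sub>C\<^sub>L 'z) \<Rightarrow> ('y::complex_hilbert ell2 \<Rightarrow>\<^sub>C\<^sub>L 'z) \<Rightarrow>
     ('z \<Rightarrow>\<^sub>C\<^sub>L 'e::complex_hilbert) \<Rightarrow> ('y \<Rightarrow>\<^sub>C\<^sub>L 'e) \<Rightarrow> bool"
  where "admissible_pair Z W C D \<longleftrightarrow>
    (let P = W \<circ>\<^sub>C W\<^sup>\<dagger>; B = W \<circ>\<^sub>C embed_op in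
       block_op D C B Z \<circ>\<^sub>C block_op id_cblinfun 0 0 P \<circ>\<^sub>C block_op (D\<^sup>\<dagger>) (B\<^sup>\<dagger>) (C\<^sup>\<dagger>) (Z\<^sup>\<dagger>)
         = block_op id_cblinfun 0 0 P \<and>
       block_op (D\<^sup>\<dagger>) (B\<^sup>\<dagger>) (C\<^sup>\<dagger>) (Z\<^sup>\<dagger>) \<circ>\<^sub>C block_op id_cblinfun 0 0 (op_inv P) \<circ>\<^sub>C block_op D C B Z
         = block_op id_cblinfun 0 0 (op_inv P))"

end

theory Submission
  imports Defs "HOL-Complex_Analysis.Cauchy_Integral_Formula"
begin

text \<open>
  A Schur class function is identified with its sequence of Taylor coefficients, whose lower triangular
  Toeplitz operator is a contraction.  The functions \<open>\<Upsilon>\<^sub>i\<^sub>j\<close> form the transfer function of a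
  discrete time system with state space \<open>\<Z>\<close>, inputs \<open>(e, v)\<close> and outputs \<open>(y, u)\<close>.  Admissibility of
  \<open>(C, D)\<close> and the Stein equation \<open>\<Lambda> - Z \<Lambda> Z\<^sup>* = B B\<^sup>* - Bt Bt\<^sup>*\<close> make its system operator unitary
  for indefinite forms, which gives an energy balance in each step and allows to run the
  system backwards.

  Closing the loop by \<open>e = X v\<close> with a contractive \<open>X\<close>, the map \<open>u \<mapsto> y\<close> is a contraction with bounded
  states; since \<open>Z\<^sup>*\<close> is pointwise stable, summing \<open>\<Lambda> x\<^sub>n = Z \<Lambda> x\<^sub>n\<^sub>+\<^sub>1 + B y\<^sub>n - Bt u\<^sub>n\<close>
  yields the interpolation condition.  Conversely a solution \<open>F\<close> determines the states by
  \<open>\<Lambda> x\<^sub>n = W S\<^sup>*\<^sup>n F u - Wt S\<^sup>*\<^sup>n u\<close>, hence \<open>e\<close> and \<open>v\<close> by backward steps, and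
  the energy balance shows that \<open>v \<mapsto> e\<close> is a contraction.  No boundedness of the \<open>\<Upsilon>\<^sub>i\<^sub>j\<close> on the disc
  is needed.
\<close>

section \<open>Bounded operators\<close>

\<comment> \<open>With no bound for \<open>\<Upsilon>\<close> on the disc at hand, the fraction
  cannot be treated as a quotient of bounded analytic functions, yet its denominator must be
  inverted at every point and for every X. The inversion is carried out first for formal power
  series, where only the constant coefficient matters: \<open>\<Upsilon>\<^sub>2\<^sub>1\<close>
  vanishes at 0 and \<open>\<Upsilon>\<^sub>2\<^sub>2\<close> takes the value
  \<open>R\<^sup>-\<^sup>1\<close> there, whatever X is. Convergence comes afterwards from the
  energy balance: an impulse as external input keeps the states bounded because \<Lambda> is bounded
  below, and the coefficients of the inverse are expressed through these states. Q and R normalise e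
  and v so that the balance is an exact identity. Injectivity has the same source as interpolation:
  two loops with equal u and y have bounded states whose differences d satisfy
  \<open>\<Lambda> d\<^sub>0 = Z\<^sup>N \<Lambda> d\<^sub>N\<close>, and the right-hand side tends
  weakly to 0. Strict positivity is always used as a lower bound of the quadratic form, which makes
  inverses bounded and passes from \<Lambda> to P because \<Lambda> \<le> P.\<close>
subclass (in complex_hilbert) banach ..

notation cblinfun_apply (infixr "\<cdot>" 85)

lemma scaleC_zero_left [simp]: "0 *\<^sub>C (x :: 'a::complex_vector) = 0"
  using scaleC_of_real[of 0 x] by simp

lemma scaleC_one [simp]: "1 *\<^sub>C (x :: 'a::complex_vector) = x"
  using scaleC_of_real[of 1 x] by simp

lemma scaleC_sum_right: "a *\<^sub>C (\<Sum>i\<in>I. f i) = (\<Sum>i\<in>I. a *\<^sub>C (f i :: 'a::complex_vector))"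
  by (induction I rule: infinite_finite_induct) (auto simp: scaleC_add_right)

lemma cinner_zero_left [simp]: "cinner 0 (y :: 'a::complex_inner) = 0"
  using cinner_scaleC_left[of 0 "0::'a" y] by simp

lemma cinner_zero_right [simp]: "cinner (x :: 'a::complex_inner) 0 = 0"
  using cinner_scaleC_right[of x 0 "0::'a"] by simp

lemma cinner_diff_left: "cinner (x - y) (z :: 'a::complex_inner) = cinner x z - cinner y z"
  by (metis cinner_add_left diff_add_cancel add_diff_cancel)

lemma cinner_eqI:
  assumes "\<And>z. cinner x z = cinner (y :: 'a::complex_inner) z"
  shows "x = y"
proof -
  have "inner (x - y) (x - y) = 0"
    using assms[of "x - y"] by (simp add: Re_cinner[symmetric] cinner_diff_left)
  then show ?thesis by simp
qed

lemma Im_cinner: "Im (cinner x y) = - inner (\<i> *\<^sub>C x) (y :: 'a::complex_inner)"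
  by (simp add: Re_cinner[symmetric] cinner_scaleC_left)

interpretation cblinfun: bounded_bilinear "(\<cdot>)"
proof
  fix S T :: "'a \<Rightarrow>\<^sub>C\<^sub>L 'b" and x y :: 'a and r :: real
  show "(S + T) \<cdot> x = S \<cdot> x + T \<cdot> x"
    by (simp add: cblinfun_apply_def plus_cblinfun.rep_eq blinfun.add_left)
  show "S \<cdot> (x + y) = S \<cdot> x + S \<cdot> y"
    by (simp add: cblinfun_apply_def blinfun.add_right)
  show "(r *\<^sub>R S) \<cdot> x = r *\<^sub>R S \<cdot> x"
    by (simp add: cblinfun_apply_def scaleR_cblinfun.rep_eq blinfun.scaleR_left)
  show "S \<cdot> (r *\<^sub>R x) = r *\<^sub>R S \<cdot> x"
    by (simp add: cblinfun_apply_def blinfun.scaleR_right)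
  show "\<exists>K. \<forall>(T :: 'a \<Rightarrow>\<^sub>C\<^sub>L 'b) x. norm (T \<cdot> x) \<le> norm T * norm x * K"
    by (rule exI[of _ 1]) (simp add: cblinfun_apply_def norm_cblinfun.rep_eq norm_blinfun)
qed

lemmas cblinfun_simps = cblinfun.add_left cblinfun.add_right cblinfun.diff_left cblinfun.diff_right
  cblinfun.minus_left cblinfun.minus_right cblinfun.scaleR_left cblinfun.scaleR_right

declare cblinfun.zero_left [simp] cblinfun.zero_right [simp]

lemma cblinfun_scaleC_left: "(a *\<^sub>C T) \<cdot> x = a *\<^sub>C T \<cdot> x"
  by (simp add: cblinfun_apply_def blinfun_apply_scaleC_cblinfun)

lemma cblinfun_scaleC_right: "T \<cdot> (a *\<^sub>C x) = a *\<^sub>C T \<cdot> x"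
  using blinfun_of_cblinfun[of T] by (simp add: cblinfun_apply_def)

lemma cblinfun_compose_apply [simp]: "(S \<circ>\<^sub>C T) \<cdot> x = S \<cdot> T \<cdot> x"
  by (simp add: cblinfun_apply_def cblinfun_compose.rep_eq)

lemma id_cblinfun_apply [simp]: "id_cblinfun \<cdot> x = x"
  by (simp add: cblinfun_apply_def id_cblinfun.rep_eq)

lemma cblinfun_eqI:
  assumes "\<And>x. S \<cdot> x = T \<cdot> x"
  shows "S = T"
  using assms by (metis blinfun_eqI blinfun_of_cblinfun_inject cblinfun_apply_def)

lemma norm_cblinfun_apply: "norm (T \<cdot> x) \<le> norm T * norm x"
  by (simp add: cblinfun_apply_def norm_cblinfun.rep_eq norm_blinfun)

lemma norm_cblinfun_bound:
  assumes "0 \<le> b" "\<And>x. norm (T \<cdot> x) \<le> b * norm x"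
  shows "norm T \<le> b"
  unfolding norm_cblinfun.rep_eq using assms by (intro norm_blinfun_bound) (auto simp: cblinfun_apply_def)

lemma norm_cblinfun_compose: "norm (S \<circ>\<^sub>C T) \<le> norm S * norm T"
proof (rule norm_cblinfun_bound)
  fix x
  have "norm (S \<cdot> T \<cdot> x) \<le> norm S * (norm T * norm x)"
    by (meson norm_cblinfun_apply mult_left_mono norm_ge_zero order_trans)
  then show "norm ((S \<circ>\<^sub>C T) \<cdot> x) \<le> norm S * norm T * norm x"
    by (simp add: mult.assoc)
qed simp

interpretation cblinfun_compose: bounded_bilinear "(\<circ>\<^sub>C)"
  by standard
    (rule cblinfun_eqI exI[of _ 1], simp add: cblinfun_simps norm_cblinfun_compose)+

lemmas cblinfun_compose_simps = cblinfun_compose.add_left cblinfun_compose.add_right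
  cblinfun_compose.diff_left cblinfun_compose.diff_right cblinfun_compose.scaleR_left
  cblinfun_compose.scaleR_right

lemma cblinfun_compose_assoc: "S \<circ>\<^sub>C T \<circ>\<^sub>C U = S \<circ>\<^sub>C (T \<circ>\<^sub>C U)"
  by (rule cblinfun_eqI) simp

lemma cblinfun_compose_id [simp]: "S \<circ>\<^sub>C id_cblinfun = S" "id_cblinfun \<circ>\<^sub>C S = S"
  by (rule cblinfun_eqI, simp)+

lemma cblinfun_compose_scaleC: "(a *\<^sub>C S) \<circ>\<^sub>C T = a *\<^sub>C (S \<circ>\<^sub>C T)" "S \<circ>\<^sub>C (a *\<^sub>C T) = a *\<^sub>C (S \<circ>\<^sub>C T)"
  by (rule cblinfun_eqI, simp add: cblinfun_scaleC_left cblinfun_scaleC_right)+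

text \<open>Complex linearity survives limits, so the complex operators form a closed part of the
  complete space of real ones. Completeness is what allows power series with operator coefficients
  to be summed.\<close>

instance cblinfun :: (complex_normed_vector, "{complex_normed_vector, banach}") banach
proof
  fix X :: "nat \<Rightarrow> 'a \<Rightarrow>\<^sub>C\<^sub>L 'b"
  assume X: "Cauchy X"
  have "dist (blinfun_of_cblinfun S) (blinfun_of_cblinfun T) = dist S T"
    for S T :: "'a \<Rightarrow>\<^sub>C\<^sub>L 'b"
    by (simp add: dist_norm norm_cblinfun.rep_eq minus_cblinfun.rep_eq)
  then have "Cauchy (\<lambda>n. blinfun_of_cblinfun (X n))"
    using X by (simp add: Cauchy_def)
  then obtain L where L: "(\<lambda>n. blinfun_of_cblinfun (X n)) \<longlonglongrightarrow> L"
    using Cauchy_convergent convergent_def by blast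
  have pt: "(\<lambda>n. blinfun_apply (blinfun_of_cblinfun (X n)) x) \<longlonglongrightarrow> blinfun_apply L x" for x
    by (intro tendsto_intros L)
  have "blinfun_apply L (c *\<^sub>C x) = c *\<^sub>C blinfun_apply L x" for c x
  proof (rule LIMSEQ_unique[OF pt])
    have "(\<lambda>n. c *\<^sub>C blinfun_apply (blinfun_of_cblinfun (X n)) x) \<longlonglongrightarrow> c *\<^sub>C blinfun_apply L x"
      by (rule bounded_linear.tendsto[OF bounded_linear_scaleC pt])
    then show "(\<lambda>n. blinfun_apply (blinfun_of_cblinfun (X n)) (c *\<^sub>C x)) \<longlonglongrightarrow> c *\<^sub>C blinfun_apply L x"
      by (simp only: cblinfun_scaleC_right[unfolded cblinfun_apply_def])
  qed
  then have "blinfun_of_cblinfun (Abs_cblinfun L) = L"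
    by (simp add: Abs_cblinfun_inverse)
  then have "norm (X n - Abs_cblinfun L) = norm (blinfun_of_cblinfun (X n) - L)" for n
    by (simp add: norm_cblinfun.rep_eq minus_cblinfun.rep_eq)
  then have "X \<longlonglongrightarrow> Abs_cblinfun L"
    using L by (simp add: tendsto_iff dist_norm)
  then show "convergent X" by (rule convergentI)
qed

lemma CBlinfun_apply':
  assumes "\<And>x y. f (x + y) = f x + f y" "\<And>c x. f (c *\<^sub>C x) = c *\<^sub>C f x"
    "\<And>x. norm (f x) \<le> K * norm x"
  shows "CBlinfun f \<cdot> x = f x"
proof (rule CBlinfun_apply)
  show "bounded_linear f"
    by (rule bounded_linear_intro[where K = K])
      (use assms in \<open>auto simp: mult.commute scaleC_of_real[symmetric]\<close>)
qed (rule assms)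

section \<open>Riesz representation and adjoints\<close>

text \<open>The representing vector minimises \<open>\<parallel>x\<parallel>\<^sup>2 - 2 f x\<close>; by the parallelogram law every
  minimising sequence is Cauchy.\<close>

lemma riesz_real:
  fixes f :: "'a::{real_inner,complete_space} \<Rightarrow> real"
  assumes f: "bounded_linear f"
  obtains t where "\<And>x. f x = inner x t"
proof -
  interpret f: bounded_linear f by (rule f)
  obtain K where K: "\<And>x. \<bar>f x\<bar> \<le> norm x * K"
    using f.bounded by auto
  define \<phi> where "\<phi> x = (norm x)\<^sup>2 - 2 * f x" for x
  have lower: "\<phi> x \<ge> - K\<^sup>2" for x
  proof -
    have "0 \<le> (norm x - K)\<^sup>2" by simp
    then show ?thesis using K[of x] unfolding \<phi>_def by (simp add: power2_eq_square algebra_simps abs_le_iff)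
  qed
  define m where "m = Inf (range \<phi>)"
  have bdd: "bdd_below (range \<phi>)" using lower by (auto intro!: bdd_belowI[of _ "- K\<^sup>2"])
  have m: "m \<le> \<phi> x" for x unfolding m_def by (rule cInf_lower[OF _ bdd]) simp
  have "\<exists>x. \<phi> x < m + 1 / real (Suc n)" for n
    using cInf_lessD[of "range \<phi>" "m + 1 / real (Suc n)"] by (auto simp: m_def)
  then obtain X where X: "\<And>n. \<phi> (X n) < m + 1 / real (Suc n)" by metis
  have par: "(norm (x - y))\<^sup>2 \<le> 2 * (\<phi> x - m) + 2 * (\<phi> y - m)" for x y
  proof -
    have "f ((1/2) *\<^sub>R (x + y)) = (f x + f y) / 2" unfolding f.scaleR f.add by simp
    moreover have "(norm ((1/2) *\<^sub>R (x + y)))\<^sup>2 = (norm (x + y))\<^sup>2 / 4"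
      unfolding norm_scaleR by (simp add: power_divide)
    ultimately have "m \<le> (norm (x + y))\<^sup>2 / 4 - f x - f y"
      using m[of "(1/2) *\<^sub>R (x + y)"] unfolding \<phi>_def by simp
    moreover have "(norm (x - y))\<^sup>2 + (norm (x + y))\<^sup>2 = 2 * (norm x)\<^sup>2 + 2 * (norm y)\<^sup>2"
      unfolding power2_norm_eq_inner by (simp add: inner_simps inner_commute)
    ultimately show ?thesis unfolding \<phi>_def by argo
  qed
  have "Cauchy X"
  proof (rule metric_CauchyI)
    fix e :: real assume e: "0 < e"
    then obtain N where N: "1 / real (Suc N) < e\<^sup>2 / 4"
      using nat_approx_posE[of "e\<^sup>2 / 4"] by auto
    have "dist (X a) (X b) < e" if "a \<ge> N" "b \<ge> N" for a b
    proof -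
      have *: "\<phi> (X c) - m < e\<^sup>2 / 4" if "c \<ge> N" for c
      proof -
        have "1 / real (Suc c) \<le> 1 / real (Suc N)" using that by (auto simp: frac_le)
        with X[of c] N show ?thesis by linarith
      qed
      have "(norm (X a - X b))\<^sup>2 < e\<^sup>2"
        using par[of "X a" "X b"] *[OF that(1)] *[OF that(2)] by argo
      then show ?thesis using e by (simp add: dist_norm power2_less_imp_less)
    qed
    then show "\<exists>M. \<forall>a\<ge>M. \<forall>b\<ge>M. dist (X a) (X b) < e" by blast
  qed
  then obtain t where t: "X \<longlonglongrightarrow> t" using Cauchy_convergent convergent_def by blast
  have "\<phi> t \<le> m"
  proof (rule LIMSEQ_le)
    show "(\<lambda>n. \<phi> (X n)) \<longlonglongrightarrow> \<phi> t"
      unfolding \<phi>_def by (intro tendsto_intros t f.tendsto)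
    show "(\<lambda>n. m + 1 / real (Suc n)) \<longlonglongrightarrow> m"
      using tendsto_add[OF tendsto_const[of m] LIMSEQ_Suc[OF lim_1_over_n]] by (simp only: add_0_right)
  qed (intro exI[of _ 0] allI impI less_imp_le[OF X])
  have "f x = inner x t" for x
  proof (rule ccontr)
    assume ne: "f x \<noteq> inner x t"
    define d where "d = f x - inner x t"
    \<comment> \<open>Minimality of \<open>t\<close> along the line \<open>t + s x\<close>. If
      \<open>d\<close> were nonzero, \<open>s = d / |x|^2\<close>, the maximiser of
      \<open>2 s d - s^2 |x|^2\<close>, would violate it.\<close>
    have ineq: "2 * s * d \<le> s\<^sup>2 * (norm x)\<^sup>2" for s
    proof -
      have "(norm (t + s *\<^sub>R x))\<^sup>2 = (norm t)\<^sup>2 + 2 * (s * inner x t) + s\<^sup>2 * (norm x)\<^sup>2"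
        unfolding power2_norm_eq_inner
        by (simp add: inner_add_left inner_add_right inner_commute[of t x] power2_eq_square distrib_left)
      moreover have "f (t + s *\<^sub>R x) = f t + s * f x" by (simp add: f.scaleR f.add)
      ultimately have "2 * (s * f x) - 2 * (s * inner x t) \<le> s\<^sup>2 * (norm x)\<^sup>2"
        using \<open>\<phi> t \<le> m\<close> m[of "t + s *\<^sub>R x"] unfolding \<phi>_def by argo
      then show ?thesis by (simp add: d_def right_diff_distrib)
    qed
    show False
    proof (cases "x = 0")
      case True then show ?thesis using ne f.zero by simp
    next
      case False
      then have n0: "(norm x)\<^sup>2 > 0" by simp
      have "2 * (d / (norm x)\<^sup>2) * d \<le> (d / (norm x)\<^sup>2)\<^sup>2 * (norm x)\<^sup>2" by (rule ineq)
      then have "2 * (d * d / (norm x)\<^sup>2) \<le> d * d / (norm x)\<^sup>2"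
        using False by (simp add: power2_eq_square)
      moreover have "d * d / (norm x)\<^sup>2 > 0"
        using ne n0 by (auto simp: d_def zero_less_mult_iff intro!: divide_pos_pos)
      ultimately show False by linarith
    qed
  qed
  then show thesis by (rule that)
qed

text \<open>The real part of \<open>f\<close> has a representing vector by
  \<open>riesz_real\<close>; evaluating the same identity at \<open>\<i> *\<^sub>C x\<close> returns
  the imaginary part.\<close>

lemma riesz:
  fixes f :: "'a::complex_hilbert \<Rightarrow> complex"
  assumes add: "\<And>x y. f (x + y) = f x + f y" and scale: "\<And>c x. f (c *\<^sub>C x) = c * f x"
    and bound: "\<And>x. cmod (f x) \<le> K * norm x"
  obtains t where "\<And>x. f x = cinner x t"
proof -
  have "bounded_linear (\<lambda>x. Re (f x))"
  proof (rule bounded_linear_intro[where K = K])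
    show "norm (Re (f x)) \<le> norm x * K" for x
      using abs_Re_le_cmod[of "f x"] bound[of x] by (simp add: mult.commute)
  qed (simp_all add: add scale scaleC_of_real[symmetric])
  then obtain t where t: "\<And>x. Re (f x) = inner x t" by (rule riesz_real) blast
  have "f x = cinner x t" for x
    using t[of x] t[of "\<i> *\<^sub>C x"] by (simp add: complex_eq_iff Re_cinner Im_cinner scale)
  then show thesis by (rule that)
qed

text \<open>Produces an operator from its matrix entries. It serves twice: for adjoints, and for
  assembling operator Taylor coefficients from scalar power series.\<close>

lemma sesquilinear_form_op:
  fixes b :: "'a::complex_hilbert \<Rightarrow> 'b::complex_hilbert \<Rightarrow> complex"
  assumes "\<And>x x' y. b (x + x') y = b x y + b x' y" "\<And>c x y. b (c *\<^sub>C x) y = c * b x y"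
    and "\<And>x y y'. b x (y + y') = b x y + b x y'" "\<And>c x y. b x (c *\<^sub>C y) = cnj c * b x y"
    and bound: "\<And>x y. cmod (b x y) \<le> K * norm x * norm y" and K: "K \<ge> 0"
  obtains A where "norm A \<le> K" "\<And>x y. cinner (A \<cdot> x) y = b x y"
proof -
  have "\<exists>t. \<forall>y. b x y = cinner t y" for x
  proof -
    obtain t where "\<And>y. cnj (b x y) = cinner y t"
      by (rule riesz[of "\<lambda>y. cnj (b x y)" "K * norm x"]) (use assms in auto)
    then show ?thesis by (metis cinner_commute complex_cnj_cnj)
  qed
  then obtain g where g: "\<And>x y. b x y = cinner (g x) y" by metis
  have bnd: "norm (g x) \<le> K * norm x" for x
  proof (cases "norm (g x) = 0")
    case False
    have "norm (g x) * norm (g x) = Re (b x (g x))"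
      using Re_cinner[of "g x" "g x"] by (simp add: g power2_norm_eq_inner[symmetric] power2_eq_square)
    also have "\<dots> \<le> K * norm x * norm (g x)"
      using bound complex_Re_le_cmod order_trans by blast
    finally show ?thesis using False by simp
  qed (use K in simp)
  have app: "CBlinfun g \<cdot> x = g x" for x
  proof (rule CBlinfun_apply'[OF _ _ bnd])
    show "g (x + y) = g x + g y" for x y
      by (rule cinner_eqI) (simp add: cinner_add_left g[symmetric] assms)
    show "g (c *\<^sub>C x) = c *\<^sub>C g x" for c x
      by (rule cinner_eqI) (simp add: cinner_scaleC_left g[symmetric] assms)
  qed
  show thesis
  proof (rule that)
    show "norm (CBlinfun g) \<le> K"
      by (rule norm_cblinfun_bound[OF K]) (simp add: app bnd)
    show "cinner (CBlinfun g \<cdot> x) y = b x y" for x y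
      by (simp add: app g)
  qed
qed

text \<open>\<open>adj\<close> is a definite description, so it says nothing until an adjoint is
  known to exist and to be unique; both are settled here.\<close>

lemma cinner_adj_right: "cinner (T \<cdot> x) y = cinner x (T\<^sup>\<dagger> \<cdot> y)"
proof -
  have "\<exists>S. \<forall>x y. cinner (S \<cdot> x) y = cinner x (T \<cdot> y)"
  proof (rule sesquilinear_form_op[of "\<lambda>x y. cinner x (T \<cdot> y)" "norm T"])
    show "cmod (cinner x (T \<cdot> y)) \<le> norm T * norm x * norm y" for x y
    proof -
      have "cmod (cinner x (T \<cdot> y)) \<le> norm x * (norm T * norm y)"
        by (rule order_trans[OF norm_cinner_le]) (simp add: mult_left_mono norm_cblinfun_apply)
      then show ?thesis by (simp add: mult.left_commute mult.assoc)
    qed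
    show "\<exists>S. \<forall>x y. cinner (S \<cdot> x) y = cinner x (T \<cdot> y)"
      if "\<And>x y. cinner (A \<cdot> x) y = cinner x (T \<cdot> y)" for A
      using that by blast
  qed (simp_all add: cinner_add_left cinner_add_right cblinfun_simps cinner_scaleC_left
      cinner_scaleC_right cblinfun_scaleC_right)
  then obtain S where S: "\<And>x y. cinner (S \<cdot> x) y = cinner x (T \<cdot> y)" by blast
  have S': "\<forall>x y. cinner (T \<cdot> x) y = cinner x (S \<cdot> y)"
    by (metis S cinner_commute)
  have "T\<^sup>\<dagger> = S"
    unfolding adj_def
  proof (rule the_equality[of _ S])
    show "S' = S" if "\<forall>x y. cinner (T \<cdot> x) y = cinner x (S' \<cdot> y)" for S'
      by (rule cblinfun_eqI, rule cinner_eqI) (metis S' cinner_commute that)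
  qed (rule S')
  then show ?thesis using S' by simp
qed

lemma cinner_adj_left: "cinner (T\<^sup>\<dagger> \<cdot> x) y = cinner x (T \<cdot> y)"
  by (metis cinner_adj_right cinner_commute)

lemma inner_adj_right: "inner (T \<cdot> x) y = inner x (T\<^sup>\<dagger> \<cdot> y)"
  by (simp add: Re_cinner[symmetric] cinner_adj_right)

lemma inner_adj_left: "inner (T\<^sup>\<dagger> \<cdot> x) y = inner x (T \<cdot> y)"
  by (simp add: Re_cinner[symmetric] cinner_adj_left)

lemma adj_adj [simp]: "(T\<^sup>\<dagger>)\<^sup>\<dagger> = T"
proof (rule cblinfun_eqI, rule cinner_eqI)
  show "cinner ((T\<^sup>\<dagger>)\<^sup>\<dagger> \<cdot> x) z = cinner (T \<cdot> x) z" for x z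
    unfolding cinner_adj_left[of "T\<^sup>\<dagger>"] by (rule cinner_adj_right[symmetric])
qed

section \<open>Positive operators\<close>

text \<open>The real inner product alone already separates points, so adjoints can be identified
  without computing imaginary parts.\<close>

lemma adj_eqI:
  assumes "\<And>x y. inner (T \<cdot> x) y = inner x (S \<cdot> y)"
  shows "T\<^sup>\<dagger> = S"
proof (rule cblinfun_eqI)
  fix y
  have "inner (T\<^sup>\<dagger> \<cdot> y - S \<cdot> y) x = 0" for x
    using assms[of x y] unfolding inner_diff_left inner_adj_left
    by (metis diff_self inner_commute)
  then show "T\<^sup>\<dagger> \<cdot> y = S \<cdot> y" by (metis eq_iff_diff_eq_0 inner_eq_zero_iff)
qed

lemma nonneg_op_inner: "nonneg_op T \<Longrightarrow> 0 \<le> inner (T \<cdot> h) h"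
  by (simp add: nonneg_op_def complex_nonneg_Reals_iff Re_cinner)

text \<open>Polarisation over the complex scalars: the cross terms of the form at
  \<open>\<i> *\<^sub>C x + y\<close> have imaginary part 0, and this is the symmetry
  relation.\<close>

lemma nonneg_op_adj:
  fixes T :: "'a::complex_hilbert \<Rightarrow>\<^sub>C\<^sub>L 'a"
  assumes "nonneg_op T"
  shows "T\<^sup>\<dagger> = T"
proof (rule adj_eqI)
  fix x y
  have im: "Im (cinner (T \<cdot> h) h) = 0" for h
    using assms by (simp add: nonneg_op_def complex_nonneg_Reals_iff)
  have "cinner (T \<cdot> (\<i> *\<^sub>C x + y)) (\<i> *\<^sub>C x + y)
      = cinner (T \<cdot> (\<i> *\<^sub>C x)) (\<i> *\<^sub>C x) + cinner (T \<cdot> y) y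
        + (\<i> * cinner (T \<cdot> x) y - \<i> * cinner (T \<cdot> y) x)"
    by (simp add: cblinfun_simps cblinfun_scaleC_right cinner_add_left cinner_add_right
        cinner_scaleC_left cinner_scaleC_right algebra_simps)
  then have "Im (\<i> * cinner (T \<cdot> x) y - \<i> * cinner (T \<cdot> y) x) = 0"
    using im[of "\<i> *\<^sub>C x + y"] im[of "\<i> *\<^sub>C x"] im[of y] by simp
  then show "inner (T \<cdot> x) y = inner x (T \<cdot> y)"
    by (simp add: Re_cinner inner_commute)
qed

lemma nonneg_opI:
  fixes T :: "'a::complex_hilbert \<Rightarrow>\<^sub>C\<^sub>L 'a"
  assumes "T\<^sup>\<dagger> = T" "\<And>h. 0 \<le> inner (T \<cdot> h) h"
  shows "nonneg_op T"
proof -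
  have "Im (cinner (T \<cdot> h) h) = 0" for h
    using cinner_adj_right[of T h h] cinner_commute[of h "T \<cdot> h"] assms(1)
    by (metis cnj.sel(2) eq_neg_iff_add_eq_0 equal_neg_zero)
  then show ?thesis
    using assms(2) by (simp add: nonneg_op_def complex_nonneg_Reals_iff Re_cinner)
qed

lemma inner_selfadj: "T\<^sup>\<dagger> = T \<Longrightarrow> inner x (T \<cdot> y) = inner (T \<cdot> x) y"
  by (simp add: inner_adj_right)

lemma quadratic_nonneg_discriminant:
  fixes a b c :: real
  assumes "\<And>s. 0 \<le> a + 2 * s * b + s\<^sup>2 * c" and c0: "0 \<le> c"
  shows "b\<^sup>2 \<le> a * c"
proof (cases "c = 0")
  case True
  have "b = 0"
  proof (rule ccontr)
    assume b: "b \<noteq> 0"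
    \<comment> \<open>For \<open>c = 0\<close> the expression is affine in \<open>s\<close>, and
      this \<open>s\<close> gives it the value -1.\<close>
    have "0 \<le> a + 2 * (- (a + 1) / (2 * b)) * b" using assms(1)[of "- (a + 1) / (2 * b)"] True by simp
    also have "\<dots> = - 1" using b by (simp add: field_simps)
    finally show False by simp
  qed
  then show ?thesis using True by simp
next
  case False
  then have c: "c > 0" using c0 by simp
  have "0 \<le> a + 2 * (- b / c) * b + (- b / c)\<^sup>2 * c" by (rule assms(1))
  also have "\<dots> = a - b\<^sup>2 / c" using False by (simp add: power2_eq_square field_simps)
  finally show ?thesis using c by (simp add: field_simps)
qed

lemma nonneg_cauchy_schwarz:
  fixes T :: "'a::complex_hilbert \<Rightarrow>\<^sub>C\<^sub>L 'a"
  assumes "T\<^sup>\<dagger> = T" "\<And>h. 0 \<le> inner (T \<cdot> h) h"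
  shows "(inner (T \<cdot> x) y)\<^sup>2 \<le> inner (T \<cdot> x) x * inner (T \<cdot> y) y"
proof (rule quadratic_nonneg_discriminant)
  fix s
  have "inner (T \<cdot> y) x = inner (T \<cdot> x) y"
    using assms(1) by (metis inner_adj_right inner_commute)
  then have "inner (T \<cdot> (x + s *\<^sub>R y)) (x + s *\<^sub>R y)
      = inner (T \<cdot> x) x + 2 * s * inner (T \<cdot> x) y + s\<^sup>2 * inner (T \<cdot> y) y"
    by (simp add: cblinfun_simps inner_add_left inner_add_right power2_eq_square algebra_simps)
  then show "0 \<le> inner (T \<cdot> x) x + 2 * s * inner (T \<cdot> x) y + s\<^sup>2 * inner (T \<cdot> y) y"
    using assms(2)[of "x + s *\<^sub>R y"] by simp
qed (rule assms)

text \<open>Cauchy-Schwarz for the form of \<open>T\<close> at \<open>x\<close> and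
  \<open>T x\<close> bounds |T x|^4 by a^2 |x|^2 |T x|^2.\<close>

lemma norm_le_of_form_le:
  fixes T :: "'a::complex_hilbert \<Rightarrow>\<^sub>C\<^sub>L 'a"
  assumes "T\<^sup>\<dagger> = T" "\<And>h. 0 \<le> inner (T \<cdot> h) h" "\<And>h. inner (T \<cdot> h) h \<le> a * (norm h)\<^sup>2" "0 \<le> a"
  shows "norm T \<le> a"
proof (rule norm_cblinfun_bound[OF assms(4)])
  fix x
  have "((norm (T \<cdot> x))\<^sup>2)\<^sup>2 \<le> inner (T \<cdot> x) x * inner (T \<cdot> T \<cdot> x) (T \<cdot> x)"
    using nonneg_cauchy_schwarz[OF assms(1,2), of x "T \<cdot> x"] by (simp add: power2_norm_eq_inner)
  also have "\<dots> \<le> (a * (norm x)\<^sup>2) * (a * (norm (T \<cdot> x))\<^sup>2)"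
    by (intro mult_mono assms) (use assms in auto)
  finally have "(norm (T \<cdot> x))\<^sup>2 * (norm (T \<cdot> x))\<^sup>2 \<le> (a * norm x)\<^sup>2 * (norm (T \<cdot> x))\<^sup>2"
    by (simp add: power2_eq_square mult.assoc mult.left_commute mult.commute)
  then have "(norm (T \<cdot> x))\<^sup>2 \<le> (a * norm x)\<^sup>2"
    by (cases "T \<cdot> x = 0") (simp, erule mult_right_le_imp_le, simp)
  then show "norm (T \<cdot> x) \<le> a * norm x"
    using assms(4) by (simp add: power2_le_iff_abs_le)
qed

text \<open>A gliding hump argument: if the form were not bounded below, unit vectors \<open>a n\<close> with
  \<open>\<langle>T (a n), a n\<rangle> \<le> 16\<^sup>-\<^sup>n\<close> would satisfy \<open>\<bar>\<langle>z, a n\<rangle>\<bar> = O(4\<^sup>-\<^sup>n)\<close> for all \<open>z\<close> in the range of \<open>T\<close>,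
  whereas the limit of \<open>w\<close> below violates this.\<close>

lemma surj_nonneg_coercive:
  fixes T :: "'a::complex_hilbert \<Rightarrow>\<^sub>C\<^sub>L 'a"
  assumes sa: "T\<^sup>\<dagger> = T" and nn: "\<And>h. 0 \<le> inner (T \<cdot> h) h" and surj: "surj ((\<cdot>) T)"
  obtains c where "c > 0" "\<And>h. c * (norm h)\<^sup>2 \<le> inner (T \<cdot> h) h"
proof (rule ccontr)
  assume "\<not> thesis"
  then have neg: "\<And>c. c > 0 \<Longrightarrow> \<exists>h. inner (T \<cdot> h) h < c * (norm h)\<^sup>2"
    using that not_le by blast
  have "\<exists>h. norm h = 1 \<and> inner (T \<cdot> h) h \<le> (1/16) ^ n" for n :: nat
  proof -
    obtain h where h: "inner (T \<cdot> h) h < (1/16) ^ n * (norm h)\<^sup>2" using neg[of "(1/16)^n"] by auto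
    have h0: "norm h > 0" using h by (cases "h = 0") auto
    have "inner (T \<cdot> ((1 / norm h) *\<^sub>R h)) ((1 / norm h) *\<^sub>R h) = inner (T \<cdot> h) h / (norm h)\<^sup>2"
      by (simp add: cblinfun_simps power2_eq_square)
    also have "\<dots> \<le> (1/16) ^ n" using h h0 by (simp add: divide_le_eq)
    finally show ?thesis using h0 by (intro exI[of _ "(1 / norm h) *\<^sub>R h"]) simp
  qed
  then obtain a where a1: "\<And>n. norm (a n) = 1" and a2: "\<And>n. inner (T \<cdot> a n) (a n) \<le> (1/16) ^ n"
    by metis
  \<comment> \<open>The sign lets the new term reinforce the component along \<open>a n\<close>,
    which then has modulus at least (1/3)^n. With ratio 1/3 all later terms together have norm at
    most (1/3)^n / 2, so half of it survives in the limit.\<close>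
  define w where "w = rec_nat (0::'a)
    (\<lambda>n u. if inner u (a n) \<ge> 0 then u + (1/3) ^ n *\<^sub>R a n else u - (1/3) ^ n *\<^sub>R a n)"
  have w_Suc: "w (Suc n) = (if inner (w n) (a n) \<ge> 0 then w n + (1/3) ^ n *\<^sub>R a n
      else w n - (1/3) ^ n *\<^sub>R a n)" for n
    by (simp add: w_def)
  have step: "norm (w (Suc n) - w n) = (1/3) ^ n" for n by (simp add: w_Suc a1)
  have inn: "inner (a n) (a n) = 1" for n using a1[of n] by (simp add: norm_eq_sqrt_inner)
  have big: "\<bar>inner (w (Suc n)) (a n)\<bar> \<ge> (1/3) ^ n" for n
  proof (cases "inner (w n) (a n) \<ge> 0")
    case True
    then have "inner (w (Suc n)) (a n) = inner (w n) (a n) + (1/3) ^ n"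
      by (simp add: w_Suc inner_add_left inn)
    then show ?thesis using True by linarith
  next
    case False
    then have "inner (w (Suc n)) (a n) = inner (w n) (a n) - (1/3) ^ n"
      by (simp add: w_Suc inner_diff_left inn)
    then show ?thesis using False by linarith
  qed
  have dist: "norm (w (n + k) - w n) \<le> 3/2 * ((1/3) ^ n - (1/3) ^ (n + k))" for n k
  proof (induction k)
    case (Suc k)
    have "norm (w (n + Suc k) - w n) \<le> norm (w (Suc (n + k)) - w (n + k)) + norm (w (n + k) - w n)"
      using norm_triangle_ineq[of "w (Suc (n + k)) - w (n + k)" "w (n + k) - w n"] by simp
    then show ?case using Suc by (simp add: step)
  qed simp
  have "Cauchy w"
  proof (rule metric_CauchyI)
    fix e :: real assume e: "0 < e"
    obtain N where N: "(1/3) ^ N < e / 3" using real_arch_pow_inv[of "e/3" "1/3"] e by auto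
    have *: "norm (w m - w N) < e / 2" if "m \<ge> N" for m
    proof -
      have "norm (w m - w N) \<le> 3/2 * ((1/3) ^ N - (1/3) ^ m)" using dist[of N "m - N"] that by simp
      also have "\<dots> \<le> 3/2 * (1/3) ^ N" by simp
      finally show ?thesis using N by simp
    qed
    have "dist (w m) (w n) < e" if "m \<ge> N" "n \<ge> N" for m n
      using *[OF that(1)] *[OF that(2)] norm_triangle_ineq4[of "w m - w N" "w n - w N"]
      by (simp add: dist_norm)
    then show "\<exists>M. \<forall>m\<ge>M. \<forall>n\<ge>M. dist (w m) (w n) < e" by blast
  qed
  then obtain z where z: "w \<longlonglongrightarrow> z" using Cauchy_convergent convergent_def by blast
  have zdist: "norm (z - w n) \<le> 3/2 * (1/3) ^ n" for n
  proof (rule tendsto_upperbound)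
    show "(\<lambda>m. norm (w m - w n)) \<longlonglongrightarrow> norm (z - w n)" by (intro tendsto_intros z)
    show "\<forall>\<^sub>F m in sequentially. norm (w m - w n) \<le> 3/2 * (1/3) ^ n"
      using eventually_ge_at_top[of n]
    proof eventually_elim
      case (elim m)
      have "norm (w m - w n) \<le> 3/2 * ((1/3) ^ n - (1/3) ^ m)" using dist[of n "m - n"] elim by simp
      also have "\<dots> \<le> 3/2 * (1/3) ^ n" by simp
      finally show ?case .
    qed
  qed simp
  have lower: "(1/3) ^ n / 2 \<le> \<bar>inner z (a n)\<bar>" for n
  proof -
    have "\<bar>inner (z - w (Suc n)) (a n)\<bar> \<le> norm (z - w (Suc n)) * norm (a n)"
      by (rule Cauchy_Schwarz_ineq2)
    also have "\<dots> \<le> (1/3) ^ n / 2" using zdist[of "Suc n"] by (simp add: a1)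
    finally show ?thesis using big[of n] unfolding inner_diff_left by linarith
  qed
  obtain y where y: "z = T \<cdot> y" using surj by (metis surjD)
  define M where "M = inner (T \<cdot> y) y"
  have upper: "(inner z (a n))\<^sup>2 \<le> M * (1/16) ^ n" for n
  proof -
    have "(inner z (a n))\<^sup>2 \<le> M * inner (T \<cdot> a n) (a n)"
      using nonneg_cauchy_schwarz[OF sa nn, of y "a n"] by (simp add: y M_def)
    also have "\<dots> \<le> M * (1/16) ^ n"
      using nn[of y] by (intro mult_left_mono a2) (simp add: M_def)
    finally show ?thesis .
  qed
  \<comment> \<open>The squared lower bound decays like 9^-n and the upper bound like 16^-n; the
    quotient would have to stay bounded.\<close>
  have M_ge: "(16/9) ^ n \<le> 4 * M" for n :: nat
  proof -
    have "((1/3) ^ n / 2)\<^sup>2 \<le> \<bar>inner z (a n)\<bar>\<^sup>2" by (rule power_mono[OF lower]) simp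
    also have "\<dots> \<le> M * (1/16) ^ n" using upper by simp
    finally have "(1/9) ^ n / 4 \<le> M * (1/16) ^ n"
      by (simp add: power_divide power2_eq_square power_mult_distrib[symmetric])
    then have "(1/9) ^ n / 4 * 16 ^ n \<le> M * (1/16) ^ n * 16 ^ n"
      by (intro mult_right_mono) auto
    then show ?thesis by (simp add: power_divide field_simps)
  qed
  obtain n where "(16/9) ^ n > 4 * M" using real_arch_pow[of "16/9" "4 * M"] by auto
  with M_ge[of n] show False by linarith
qed

text \<open>The lower bound makes the set-theoretic inverse bounded by 1/c, and only then does the
  \<open>CBlinfun\<close> in \<open>op_inv\<close> denote this inverse.\<close>

lemma op_inv_bounded_below:
  fixes T :: "'a::complex_normed_vector \<Rightarrow>\<^sub>C\<^sub>L 'b::complex_normed_vector"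
  assumes bij: "op_invertible T" and c: "c > 0" "\<And>x. c * norm x \<le> norm (T \<cdot> x)"
  shows "op_inv T \<circ>\<^sub>C T = id_cblinfun" "T \<circ>\<^sub>C op_inv T = id_cblinfun"
proof -
  let ?g = "inv ((\<cdot>) T)"
  have b: "bij ((\<cdot>) T)" using bij by (simp add: op_invertible_def)
  have Tg: "T \<cdot> ?g y = y" for y using b by (simp add: bij_is_surj surj_f_inv_f)
  have gT: "?g (T \<cdot> x) = x" for x using b by (simp add: bij_is_inj)
  have app: "op_inv T \<cdot> y = ?g y" for y
    unfolding op_inv_def
  proof (rule CBlinfun_apply')
    show "?g (x + y) = ?g x + ?g y" for x y by (metis Tg gT cblinfun.add_right)
    show "?g (a *\<^sub>C x) = a *\<^sub>C ?g x" for a x by (metis Tg gT cblinfun_scaleC_right)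
    show "norm (?g x) \<le> (1 / c) * norm x" for x
      using c(2)[of "?g x"] c(1) by (simp add: Tg field_simps)
  qed
  show "op_inv T \<circ>\<^sub>C T = id_cblinfun" "T \<circ>\<^sub>C op_inv T = id_cblinfun"
    by (rule cblinfun_eqI, simp add: app Tg gT)+
qed

lemma op_invertibleI:
  assumes "S \<circ>\<^sub>C T = id_cblinfun" "T \<circ>\<^sub>C S = id_cblinfun"
  shows "op_invertible T"
  unfolding op_invertible_def
proof (rule o_bij)
  show "(\<cdot>) S \<circ> (\<cdot>) T = id" "(\<cdot>) T \<circ> (\<cdot>) S = id"
    by (simp_all add: fun_eq_iff cblinfun_compose_apply[symmetric] assms del: cblinfun_compose_apply)
qed

lemma op_inv_eqI:
  assumes "S \<circ>\<^sub>C T = id_cblinfun" "T \<circ>\<^sub>C S = id_cblinfun"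
  shows "op_inv T = S"
proof -
  have "inv ((\<cdot>) T) y = S \<cdot> y" for y
  proof (rule inv_f_eq)
    show "inj ((\<cdot>) T)" using op_invertibleI[OF assms] by (simp add: op_invertible_def bij_is_inj)
    show "T \<cdot> S \<cdot> y = y" by (metis assms(2) cblinfun_compose_apply id_cblinfun_apply)
  qed
  then have "op_inv T \<cdot> y = S \<cdot> y" for y
    unfolding op_inv_def
    by (subst CBlinfun_apply'[of _ "norm S"])
      (auto simp: cblinfun_simps cblinfun_scaleC_right norm_cblinfun_apply)
  then show ?thesis by (rule cblinfun_eqI)
qed

lemma coercive_norm:
  assumes "c * (norm x)\<^sup>2 \<le> inner (T \<cdot> x) x"
  shows "c * norm x \<le> norm (T \<cdot> x)"
proof (cases "x = 0")
  case False
  have "c * norm x * norm x \<le> norm (T \<cdot> x) * norm x"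
    using assms norm_cauchy_schwarz[of "T \<cdot> x" x] by (simp add: power2_eq_square mult.assoc)
  then show ?thesis using False by (simp add: mult_le_cancel_right)
qed simp

text \<open>For small \<open>r > 0\<close> the map \<open>x \<mapsto> x - r (T x - y)\<close> is a contraction.\<close>

lemma coercive_invertible:
  fixes T :: "'a::complex_hilbert \<Rightarrow>\<^sub>C\<^sub>L 'a"
  assumes c: "c > 0" "\<And>h. c * (norm h)\<^sup>2 \<le> inner (T \<cdot> h) h"
  shows "op_invertible T"
proof -
  define M where "M = norm T + c"
  have M: "M > 0" "M \<ge> c" "norm T \<le> M" using c by (auto simp: M_def add_nonneg_pos)
  \<comment> \<open>Minimises \<open>1 - 2 r c + r^2 M^2\<close>, which bounds the squared
    contraction factor; the minimum is \<open>1 - c^2 / M^2\<close>.\<close>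
  define r where "r = c / M\<^sup>2"
  define q where "q = sqrt (1 - c\<^sup>2 / M\<^sup>2)"
  have cM: "c\<^sup>2 / M\<^sup>2 \<le> 1" "c\<^sup>2 / M\<^sup>2 > 0" using M c by (auto simp: divide_le_eq power_mono)
  have q: "0 \<le> q" "q < 1" "q\<^sup>2 = 1 - c\<^sup>2 / M\<^sup>2"
    using cM by (auto simp: q_def)
  have contr: "norm (x - r *\<^sub>R T \<cdot> x) \<le> q * norm x" for x
  proof -
    have "(norm (x - r *\<^sub>R T \<cdot> x))\<^sup>2 = (norm x)\<^sup>2 - 2 * r * inner (T \<cdot> x) x + r\<^sup>2 * (norm (T \<cdot> x))\<^sup>2"
      unfolding power2_norm_eq_inner
      by (simp add: inner_diff_left inner_diff_right inner_commute[of x "T \<cdot> x"] power2_eq_square algebra_simps)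
    also have "\<dots> \<le> (norm x)\<^sup>2 - 2 * r * (c * (norm x)\<^sup>2) + r\<^sup>2 * (M * norm x)\<^sup>2"
    proof -
      have "2 * r * (c * (norm x)\<^sup>2) \<le> 2 * r * inner (T \<cdot> x) x"
        using c M by (intro mult_left_mono) (auto simp: r_def)
      moreover have "norm (T \<cdot> x) \<le> M * norm x"
        by (rule order_trans[OF norm_cblinfun_apply]) (simp add: M mult_right_mono)
      then have "r\<^sup>2 * (norm (T \<cdot> x))\<^sup>2 \<le> r\<^sup>2 * (M * norm x)\<^sup>2"
        by (intro mult_left_mono power_mono) auto
      ultimately show ?thesis by linarith
    qed
    also have "\<dots> = (q * norm x)\<^sup>2"
      unfolding power_mult_distrib q(3) r_def using M by (simp add: power2_eq_square field_simps)
    finally show ?thesis using q by (simp add: power2_le_iff_abs_le)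
  qed
  have "\<exists>!x. x - r *\<^sub>R (T \<cdot> x - y) = x" for y
  proof (rule banach_fix_type[OF q(1,2)], intro allI)
    fix x x'
    have "x - r *\<^sub>R (T \<cdot> x - y) - (x' - r *\<^sub>R (T \<cdot> x' - y)) = (x - x') - r *\<^sub>R T \<cdot> (x - x')"
      by (simp add: cblinfun_simps algebra_simps)
    then show "dist (x - r *\<^sub>R (T \<cdot> x - y)) (x' - r *\<^sub>R (T \<cdot> x' - y)) \<le> q * dist x x'"
      using contr[of "x - x'"] by (simp only: dist_norm)
  qed
  moreover have "r \<noteq> 0" using c M by (simp add: r_def)
  ultimately have "\<exists>!x. T \<cdot> x = y" for y by simp
  then show ?thesis by (simp add: op_invertible_def bij_iff)
qed

text \<open>Turns the bijectivity in the definition into a quantitative bound; together with the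
  converse \<open>strictly_positiveI\<close> it makes strict positivity a statement about quadratic
  forms.\<close>

lemma strictly_positive_coercive:
  fixes T :: "'a::complex_hilbert \<Rightarrow>\<^sub>C\<^sub>L 'a"
  assumes "strictly_positive T"
  obtains c where "c > 0" "\<And>h. c * (norm h)\<^sup>2 \<le> inner (T \<cdot> h) h"
  using assms surj_nonneg_coercive[of T]
  by (metis bij_is_surj nonneg_op_adj nonneg_op_inner op_invertible_def strictly_positive_def)

lemma strictly_positiveI:
  fixes T :: "'a::complex_hilbert \<Rightarrow>\<^sub>C\<^sub>L 'a"
  assumes "T\<^sup>\<dagger> = T" "c > 0" "\<And>h. c * (norm h)\<^sup>2 \<le> inner (T \<cdot> h) h"
  shows "strictly_positive T"
proof -
  have "0 \<le> inner (T \<cdot> h) h" for h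
    using assms(2) by (intro order_trans[OF _ assms(3)]) auto
  then show ?thesis
    unfolding strictly_positive_def
    using coercive_invertible[OF assms(2,3)] nonneg_opI[OF assms(1)] by blast
qed

lemma strictly_positive_adj: "strictly_positive T \<Longrightarrow> T\<^sup>\<dagger> = (T :: 'a::complex_hilbert \<Rightarrow>\<^sub>C\<^sub>L 'a)"
  by (simp add: strictly_positive_def nonneg_op_adj)

lemma strictly_positive_inverse:
  fixes T :: "'a::complex_hilbert \<Rightarrow>\<^sub>C\<^sub>L 'a"
  assumes T: "strictly_positive T"
  shows "op_inv T \<circ>\<^sub>C T = id_cblinfun" "T \<circ>\<^sub>C op_inv T = id_cblinfun"
    and "strictly_positive (op_inv T)"
proof -
  obtain c where c: "c > 0" "\<And>h. c * (norm h)\<^sup>2 \<le> inner (T \<cdot> h) h"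
    using strictly_positive_coercive[OF T] by blast
  show inv: "op_inv T \<circ>\<^sub>C T = id_cblinfun" "T \<circ>\<^sub>C op_inv T = id_cblinfun"
    using op_inv_bounded_below[OF _ c(1) coercive_norm[OF c(2)]] T by (auto simp: strictly_positive_def)
  have TT: "T \<cdot> op_inv T \<cdot> x = x" for x by (metis inv(2) cblinfun_compose_apply id_cblinfun_apply)
  have sa: "(op_inv T)\<^sup>\<dagger> = op_inv T"
    by (rule adj_eqI) (metis TT T strictly_positive_adj inner_adj_right)
  have "0 \<le> inner (op_inv T \<cdot> h) h" for h
    using nonneg_op_inner[of T "op_inv T \<cdot> h"] T
    by (simp add: TT strictly_positive_def inner_commute)
  then show "strictly_positive (op_inv T)"
    using nonneg_opI[OF sa] op_invertibleI[OF inv(2,1)] by (simp add: strictly_positive_def)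
qed

text \<open>With \<open>T = M (I - A)\<close>, \<open>\<parallel>A\<parallel> < 1\<close>, the root is \<open>\<surd>M (I - Y)\<close> for the fixed point \<open>Y\<close> of
  \<open>Y \<mapsto> (A + Y\<^sup>2) / 2\<close>; it commutes with everything that commutes with \<open>T\<close>.\<close>

lemma strictly_positive_sqrt_exists:
  fixes T :: "'a::complex_hilbert \<Rightarrow>\<^sub>C\<^sub>L 'a"
  assumes T: "strictly_positive T"
  obtains S where "strictly_positive S" "S \<circ>\<^sub>C S = T"
    "\<And>C. C \<circ>\<^sub>C T = T \<circ>\<^sub>C C \<Longrightarrow> C \<circ>\<^sub>C S = S \<circ>\<^sub>C C"
proof -
  obtain c where c: "c > 0" "\<And>h. c * (norm h)\<^sup>2 \<le> inner (T \<cdot> h) h"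
    using strictly_positive_coercive[OF T] by blast
  have sa: "T\<^sup>\<dagger> = T" by (rule strictly_positive_adj[OF T])
  \<comment> \<open>Adding \<open>c\<close> keeps \<open>M\<close> positive and \<open>a\<close>
    nonnegative even on the space {0}, where \<open>norm T\<close> is 0. The form of
    \<open>A\<close> then lies between 0 and \<open>a\<close>.\<close>
  define M where "M = norm T + c"
  have M: "M > 0" using c by (auto simp: M_def add_nonneg_pos)
  define a where "a = 1 - c / M"
  have a: "0 \<le> a" "a < 1" using c M by (auto simp: a_def M_def divide_le_eq)
  define A where "A = id_cblinfun - (1 / M) *\<^sub>R T"
  have TA: "T = M *\<^sub>R (id_cblinfun - A)" using M by (simp add: A_def)
  have Ah: "inner (A \<cdot> h) k = inner h k - inner (T \<cdot> h) k / M" for h k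
    by (simp add: A_def cblinfun_simps inner_diff_left)
  have A_sa: "A\<^sup>\<dagger> = A"
    by (rule adj_eqI) (simp add: A_def cblinfun_simps inner_diff_left inner_diff_right inner_selfadj[OF sa])
  have normA: "norm A \<le> a"
  proof (rule norm_le_of_form_le[OF A_sa])
    fix h
    have "inner (T \<cdot> h) h \<le> norm (T \<cdot> h) * norm h" by (rule norm_cauchy_schwarz)
    also have "\<dots> \<le> (norm T * norm h) * norm h" by (intro mult_right_mono norm_cblinfun_apply) auto
    also have "\<dots> \<le> M * (norm h)\<^sup>2"
      using c by (simp add: M_def power2_eq_square distrib_right mult.assoc)
    finally show "0 \<le> inner (A \<cdot> h) h" using M by (simp add: Ah power2_norm_eq_inner divide_le_eq mult.commute)
    have "c * (norm h)\<^sup>2 / M \<le> inner (T \<cdot> h) h / M" using c(2)[of h] M by (simp add: divide_right_mono)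
    then show "inner (A \<cdot> h) h \<le> a * (norm h)\<^sup>2"
      by (simp add: Ah power2_norm_eq_inner a_def left_diff_distrib)
  qed (rule a)
  define \<phi> where "\<phi> Y = (1/2) *\<^sub>R (A + Y \<circ>\<^sub>C Y)" for Y
  \<comment> \<open>Self-adjointness and commutation are built into the complete set on which the
    map contracts, so that the fixed point inherits them. The commutation clause is what makes the
    root unique later.\<close>
  define \<K> where "\<K> = {Y. norm Y \<le> a \<and> (\<forall>x y. inner (Y \<cdot> x) y = inner x (Y \<cdot> y)) \<and>
    (\<forall>C. C \<circ>\<^sub>C A = A \<circ>\<^sub>C C \<longrightarrow> C \<circ>\<^sub>C Y = Y \<circ>\<^sub>C C)}"
  have \<K>_norm: "norm Y \<le> a" and \<K>_sa: "inner (Y \<cdot> x) y = inner x (Y \<cdot> y)"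
    and \<K>_comm: "C \<circ>\<^sub>C A = A \<circ>\<^sub>C C \<Longrightarrow> C \<circ>\<^sub>C Y = Y \<circ>\<^sub>C C" if "Y \<in> \<K>" for Y C x y
    using that by (auto simp only: \<K>_def)
  have \<K>I: "Y \<in> \<K>" if "norm Y \<le> a" "\<And>x y. inner (Y \<cdot> x) y = inner x (Y \<cdot> y)"
    "\<And>C. C \<circ>\<^sub>C A = A \<circ>\<^sub>C C \<Longrightarrow> C \<circ>\<^sub>C Y = Y \<circ>\<^sub>C C" for Y
    unfolding \<K>_def using that by blast
  have "closed \<K>"
  proof -
    have app: "continuous_on UNIV (\<lambda>Y :: 'a \<Rightarrow>\<^sub>C\<^sub>L 'a. Y \<cdot> x)" for x
      by (intro bounded_linear.continuous_on[OF cblinfun.bounded_linear_left] continuous_on_id)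
    have "closed {Y :: 'a \<Rightarrow>\<^sub>C\<^sub>L 'a. inner (Y \<cdot> x) y = inner x (Y \<cdot> y)}" for x y
      by (intro closed_Collect_eq continuous_on_inner app continuous_on_const)
    moreover have "closed {Y. C \<circ>\<^sub>C Y = Y \<circ>\<^sub>C C}" for C :: "'a \<Rightarrow>\<^sub>C\<^sub>L 'a"
      by (intro closed_Collect_eq bounded_linear.continuous_on[OF cblinfun_compose.bounded_linear_left]
          bounded_linear.continuous_on[OF cblinfun_compose.bounded_linear_right] continuous_on_id)
    moreover have "closed {Y :: 'a \<Rightarrow>\<^sub>C\<^sub>L 'a. norm Y \<le> a}"
      by (intro closed_Collect_le continuous_intros)
    moreover have "\<K> = {Y. norm Y \<le> a} \<inter> (\<Inter>x y. {Y. inner (Y \<cdot> x) y = inner x (Y \<cdot> y)}) \<inter>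
        (\<Inter>C\<in>{C. C \<circ>\<^sub>C A = A \<circ>\<^sub>C C}. {Y. C \<circ>\<^sub>C Y = Y \<circ>\<^sub>C C})"
      unfolding \<K>_def by blast
    ultimately show ?thesis by (auto intro!: closed_Int closed_INT)
  qed
  then have comp: "complete \<K>" by (simp add: complete_eq_closed)
  have "\<exists>!Y\<in>\<K>. \<phi> Y = Y"
  proof (rule Banach_fix[OF comp _ a])
    have "0 \<in> \<K>"
      by (rule \<K>I) (simp_all add: a cblinfun_compose.zero_left cblinfun_compose.zero_right)
    then show "\<K> \<noteq> {}" by blast
    show "\<phi> ` \<K> \<subseteq> \<K>"
    proof (rule image_subsetI)
      fix Y assume Y: "Y \<in> \<K>"
      have "norm (Y \<circ>\<^sub>C Y) \<le> a * a"
        using \<K>_norm[OF Y] a by (intro order_trans[OF norm_cblinfun_compose] mult_mono) auto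
      also have "\<dots> \<le> a" using a by (simp add: mult_left_le)
      finally have "norm (A + Y \<circ>\<^sub>C Y) \<le> a + a"
        using normA norm_triangle_ineq[of A "Y \<circ>\<^sub>C Y"] by linarith
      then have "norm (\<phi> Y) \<le> a" by (simp add: \<phi>_def)
      moreover have "inner (\<phi> Y \<cdot> x) y = inner x (\<phi> Y \<cdot> y)" for x y
        by (simp add: \<phi>_def \<K>_sa[OF Y] cblinfun_simps inner_add_left inner_add_right
            inner_selfadj[OF A_sa])
      moreover have "C \<circ>\<^sub>C \<phi> Y = \<phi> Y \<circ>\<^sub>C C" if "C \<circ>\<^sub>C A = A \<circ>\<^sub>C C" for C
      proof -
        have "C \<circ>\<^sub>C Y = Y \<circ>\<^sub>C C" by (rule \<K>_comm[OF Y that])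
        then have "C \<circ>\<^sub>C (Y \<circ>\<^sub>C Y) = Y \<circ>\<^sub>C Y \<circ>\<^sub>C C" by (metis cblinfun_compose_assoc)
        then show ?thesis
          using that by (simp add: \<phi>_def cblinfun_compose_simps)
      qed
      ultimately show "\<phi> Y \<in> \<K>" by (rule \<K>I)
    qed
    fix Y Y' assume Y: "Y \<in> \<K>" "Y' \<in> \<K>"
    have eq: "\<phi> Y - \<phi> Y' = (1/2) *\<^sub>R (Y \<circ>\<^sub>C (Y - Y') + (Y - Y') \<circ>\<^sub>C Y')"
      by (simp add: \<phi>_def cblinfun_compose_simps
          scaleR_diff_right[symmetric])
    have "norm (Y \<circ>\<^sub>C (Y - Y')) \<le> a * norm (Y - Y')"
      using \<K>_norm[OF Y(1)] by (intro order_trans[OF norm_cblinfun_compose] mult_right_mono) auto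
    moreover have "norm ((Y - Y') \<circ>\<^sub>C Y') \<le> norm (Y - Y') * a"
      using \<K>_norm[OF Y(2)] by (intro order_trans[OF norm_cblinfun_compose] mult_left_mono) auto
    moreover note norm_triangle_ineq[of "Y \<circ>\<^sub>C (Y - Y')" "(Y - Y') \<circ>\<^sub>C Y'"]
    ultimately have "norm (Y \<circ>\<^sub>C (Y - Y') + (Y - Y') \<circ>\<^sub>C Y') \<le> a * norm (Y - Y') + norm (Y - Y') * a"
      by (meson add_mono order_trans)
    moreover have "norm (\<phi> Y - \<phi> Y') = norm (Y \<circ>\<^sub>C (Y - Y') + (Y - Y') \<circ>\<^sub>C Y') / 2"
      unfolding eq by simp
    ultimately have "norm (\<phi> Y - \<phi> Y') \<le> (a * norm (Y - Y') + norm (Y - Y') * a) / 2"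
      by (simp only: divide_right_mono zero_le_numeral)
    then show "dist (\<phi> Y) (\<phi> Y') \<le> a * dist Y Y'" by (simp add: dist_norm mult.commute)
  qed
  then obtain Y where Y: "Y \<in> \<K>" and fixY: "\<phi> Y = Y" by blast
  define S where "S = sqrt M *\<^sub>R (id_cblinfun - Y)"
  have YY: "Y \<circ>\<^sub>C Y = Y + Y - A"
    using arg_cong[OF fixY, of "\<lambda>x. 2 *\<^sub>R x"] by (simp add: \<phi>_def scaleR_2 algebra_simps)
  have "S \<circ>\<^sub>C S = (sqrt M * sqrt M) *\<^sub>R (id_cblinfun - Y - Y + Y \<circ>\<^sub>C Y)"
    by (simp add: S_def cblinfun_compose_simps algebra_simps)
  then have SS: "S \<circ>\<^sub>C S = T" using M by (simp add: YY TA)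
  have S_comm: "C \<circ>\<^sub>C S = S \<circ>\<^sub>C C" if "C \<circ>\<^sub>C T = T \<circ>\<^sub>C C" for C
  proof -
    have "C \<circ>\<^sub>C A = A \<circ>\<^sub>C C"
      using that by (simp add: A_def cblinfun_compose_simps)
    then have "C \<circ>\<^sub>C Y = Y \<circ>\<^sub>C C" by (rule \<K>_comm[OF Y])
    then show ?thesis
      by (simp add: S_def cblinfun_compose_simps)
  qed
  have "strictly_positive S"
  proof (rule strictly_positiveI)
    show "S\<^sup>\<dagger> = S"
      by (rule adj_eqI) (simp add: S_def \<K>_sa[OF Y] cblinfun_simps inner_diff_left inner_diff_right)
    show "sqrt M * (1 - a) > 0" using M a by simp
    fix h
    have "inner (Y \<cdot> h) h \<le> norm (Y \<cdot> h) * norm h" by (rule norm_cauchy_schwarz)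
    also have "\<dots> \<le> (a * norm h) * norm h"
      using \<K>_norm[OF Y] by (intro mult_right_mono order_trans[OF norm_cblinfun_apply]) auto
    finally have "(1 - a) * (norm h)\<^sup>2 \<le> inner h h - inner (Y \<cdot> h) h"
      by (simp add: power2_norm_eq_inner[symmetric] power2_eq_square left_diff_distrib)
    then have "sqrt M * ((1 - a) * (norm h)\<^sup>2) \<le> sqrt M * (inner h h - inner (Y \<cdot> h) h)"
      using M by (intro mult_left_mono) auto
    then show "sqrt M * (1 - a) * (norm h)\<^sup>2 \<le> inner (S \<cdot> h) h"
      by (simp add: S_def cblinfun_simps inner_diff_left mult.assoc)
  qed
  then show thesis using SS S_comm by (rule that)
qed

text \<open>Another nonnegative root \<open>S'\<close> commutes with \<open>T = S' S'\<close>, hence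
  with the constructed root \<open>S\<close>. Then \<open>S + S'\<close> annihilates every
  \<open>S' x - S x\<close>, and the lower bound of \<open>S\<close> forces this vector to be
  0.\<close>

lemma op_sqrt_strictly_positive:
  fixes T :: "'a::complex_hilbert \<Rightarrow>\<^sub>C\<^sub>L 'a"
  assumes T: "strictly_positive T"
  shows "strictly_positive (op_sqrt T)" "op_sqrt T \<circ>\<^sub>C op_sqrt T = T"
proof -
  obtain S where S: "strictly_positive S" "S \<circ>\<^sub>C S = T"
    and comm: "\<And>C. C \<circ>\<^sub>C T = T \<circ>\<^sub>C C \<Longrightarrow> C \<circ>\<^sub>C S = S \<circ>\<^sub>C C"
    using strictly_positive_sqrt_exists[OF T] by blast
  obtain c where c: "c > 0" "\<And>h. c * (norm h)\<^sup>2 \<le> inner (S \<cdot> h) h"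
    using strictly_positive_coercive[OF S(1)] by blast
  have "op_sqrt T = S"
    unfolding op_sqrt_def
  proof (rule the_equality)
    show "nonneg_op S \<and> S \<circ>\<^sub>C S = T" using S by (simp add: strictly_positive_def)
    fix S' assume S': "nonneg_op S' \<and> S' \<circ>\<^sub>C S' = T"
    then have S'S: "S' \<circ>\<^sub>C S = S \<circ>\<^sub>C S'" by (intro comm) (metis cblinfun_compose_assoc)
    show "S' = S"
    proof (rule cblinfun_eqI)
      fix x
      define d where "d = S' \<cdot> x - S \<cdot> x"
      have "S' \<cdot> S' \<cdot> x = S \<cdot> S \<cdot> x" "S' \<cdot> S \<cdot> x = S \<cdot> S' \<cdot> x"
        using S S' S'S by (metis cblinfun_compose_apply)+
      then have "S \<cdot> d + S' \<cdot> d = 0" by (simp add: d_def cblinfun_simps)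
      then have "inner (S \<cdot> d) d + inner (S' \<cdot> d) d = 0"
        by (metis inner_add_left inner_zero_left)
      then have "inner (S \<cdot> d) d \<le> 0"
        using nonneg_op_inner[of S' d] S' by linarith
      then have "c * (norm d)\<^sup>2 \<le> 0" using c(2)[of d] by linarith
      then have "d = 0" using c(1) by (simp add: mult_le_0_iff)
      then show "S' \<cdot> x = S \<cdot> x" by (simp add: d_def)
    qed
  qed
  then show "strictly_positive (op_sqrt T)" "op_sqrt T \<circ>\<^sub>C op_sqrt T = T" using S by simp_all
qed

lemma op_inv_sqrt_strictly_positive:
  fixes T :: "'a::complex_hilbert \<Rightarrow>\<^sub>C\<^sub>L 'a"
  assumes T: "strictly_positive T"
  defines "Q \<equiv> op_inv (op_sqrt T)"
  shows "strictly_positive Q" "Q \<circ>\<^sub>C Q \<circ>\<^sub>C T = id_cblinfun" "Q \<circ>\<^sub>C T \<circ>\<^sub>C Q = id_cblinfun"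
    "T \<circ>\<^sub>C Q \<circ>\<^sub>C Q = id_cblinfun"
proof -
  note S = op_sqrt_strictly_positive[OF T]
  note Q = strictly_positive_inverse[OF S(1), folded Q_def]
  show "strictly_positive Q" by (rule Q(3))
  have a: "Q \<cdot> op_sqrt T \<cdot> x = x" "op_sqrt T \<cdot> Q \<cdot> x = x" "op_sqrt T \<cdot> op_sqrt T \<cdot> x = T \<cdot> x" for x
    using Q S(2) by (metis cblinfun_compose_apply id_cblinfun_apply)+
  show "Q \<circ>\<^sub>C Q \<circ>\<^sub>C T = id_cblinfun" "Q \<circ>\<^sub>C T \<circ>\<^sub>C Q = id_cblinfun"
    "T \<circ>\<^sub>C Q \<circ>\<^sub>C Q = id_cblinfun"
    by (rule cblinfun_eqI, simp add: a(1,2) a(3)[symmetric])+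
qed

section \<open>Convolution of operator sequences\<close>

text \<open>Multiplication of formal power series. All sums are finite, so inverses and feedback
  loops make sense before anything is known about convergence on the disc.\<close>

definition conv :: "(nat \<Rightarrow> 'a::complex_normed_vector \<Rightarrow>\<^sub>C\<^sub>L 'b::complex_normed_vector) \<Rightarrow> (nat \<Rightarrow> 'a) \<Rightarrow> nat \<Rightarrow> 'b"
  where "conv A u n = (\<Sum>k\<le>n. A (n - k) \<cdot> u k)"

definition oconv :: "(nat \<Rightarrow> 'b::complex_normed_vector \<Rightarrow>\<^sub>C\<^sub>L 'c::complex_normed_vector) \<Rightarrow>
    (nat \<Rightarrow> 'a::complex_normed_vector \<Rightarrow>\<^sub>C\<^sub>L 'b) \<Rightarrow> nat \<Rightarrow> 'a \<Rightarrow>\<^sub>C\<^sub>L 'c"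
  where "oconv A B n = (\<Sum>k\<le>n. A (n - k) \<circ>\<^sub>C B k)"

text \<open>Plays two roles: a constant formal power series, in particular the unit of
  \<open>oconv\<close>, and an input signal at time 0 from which coefficients are read off.\<close>

definition impulse :: "'a::zero \<Rightarrow> nat \<Rightarrow> 'a"
  where "impulse x n = (if n = 0 then x else 0)"

lemma sum_triangle:
  fixes f :: "nat \<Rightarrow> nat \<Rightarrow> 'a::comm_monoid_add"
  shows "(\<Sum>m\<le>n. \<Sum>k\<le>m. f m k) = (\<Sum>k\<le>n. \<Sum>j\<le>n - k. f (k + j) k)"
  unfolding sum.Sigma[OF finite_atMost ballI[OF finite_atMost]]
  by (rule sum.reindex_bij_witness[where i = "\<lambda>(k, j). (k + j, k)" and j = "\<lambda>(m, k). (k, m - k)"])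
    auto

lemma conv_oconv: "conv (oconv A B) u = conv A (conv B u)"
proof
  fix n
  have "conv A (conv B u) n = (\<Sum>m\<le>n. \<Sum>k\<le>m. A (n - m) \<cdot> B (m - k) \<cdot> u k)"
    by (simp add: conv_def cblinfun.sum_right)
  also have "\<dots> = (\<Sum>k\<le>n. \<Sum>j\<le>n - k. A (n - (k + j)) \<cdot> B (k + j - k) \<cdot> u k)"
    by (rule sum_triangle)
  also have "\<dots> = conv (oconv A B) u n"
    by (simp add: conv_def oconv_def cblinfun.sum_left)
  finally show "conv (oconv A B) u n = conv A (conv B u) n" by simp
qed

lemma oconv_apply: "oconv A B n \<cdot> x = conv A (\<lambda>k. B k \<cdot> x) n"
  by (simp add: conv_def oconv_def cblinfun.sum_left)

lemma conv_impulse [simp]: "conv A (impulse x) n = A n \<cdot> x"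
proof -
  have "conv A (impulse x) n = (\<Sum>k\<le>n. if k = 0 then A n \<cdot> x else 0)"
    unfolding conv_def by (rule sum.cong) (auto simp: impulse_def)
  then show ?thesis by simp
qed

lemma impulse_conv [simp]: "conv (impulse T) u n = T \<cdot> u n"
proof -
  have "conv (impulse T) u n = (\<Sum>k\<le>n. if k = n then T \<cdot> u n else 0)"
    unfolding conv_def by (rule sum.cong) (auto simp: impulse_def)
  then show ?thesis by simp
qed

lemma sum_impulse_le: "(\<Sum>n<N. (norm (impulse w n))\<^sup>2) \<le> (norm (w :: 'a::real_normed_vector))\<^sup>2"
proof -
  have "(\<Sum>n<N. (norm (impulse w n))\<^sup>2) = (\<Sum>n<N. if n = 0 then (norm w)\<^sup>2 else 0)"
    by (rule sum.cong) (auto simp: impulse_def)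
  then show ?thesis by simp
qed

lemma oconv_assoc: "oconv (oconv A B) C = oconv A (oconv B C)"
  by (intro ext cblinfun_eqI) (simp add: oconv_apply conv_oconv fun_eq_iff)

lemma oconv_impulse_left [simp]: "oconv (impulse T) A = (\<lambda>n. T \<circ>\<^sub>C A n)"
  by (intro ext cblinfun_eqI) (simp add: oconv_apply)

lemma oconv_impulse_right [simp]: "oconv A (impulse T) n = A n \<circ>\<^sub>C T"
proof (rule cblinfun_eqI)
  have "(\<lambda>k. impulse T k \<cdot> x) = impulse (T \<cdot> x)" for x by (auto simp: impulse_def)
  then show "oconv A (impulse T) n \<cdot> x = (A n \<circ>\<^sub>C T) \<cdot> x" for x
    by (simp add: oconv_apply)
qed

lemma conv_add_left: "conv (\<lambda>n. A n + B n) u n = conv A u n + conv B u n"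
  by (simp add: conv_def cblinfun.add_left sum.distrib)

lemma oconv_add_left: "oconv (\<lambda>n. A n + B n) C n = oconv A C n + oconv B C n"
  by (simp add: oconv_def cblinfun_compose.add_left sum.distrib)

lemma conv_compose_left: "conv (\<lambda>n. T \<circ>\<^sub>C A n) u n = T \<cdot> conv A u n"
  by (simp add: conv_def cblinfun.sum_right)

lemma conv_add_right: "conv A (\<lambda>n. u n + v n) n = conv A u n + conv A v n"
  by (simp add: conv_def cblinfun.add_right sum.distrib)

lemma conv_scaleC_right: "conv A (\<lambda>n. c *\<^sub>C u n) n = c *\<^sub>C conv A u n"
  by (simp add: conv_def cblinfun_scaleC_right scaleC_sum_right)

lemma conv_cong: "(\<And>k. k \<le> n \<Longrightarrow> u k = v k) \<Longrightarrow> conv A u n = conv A v n"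
  by (simp add: conv_def)

lemma conv_Suc: "conv A u (Suc n) = conv (\<lambda>k. A (Suc k)) u n + A 0 \<cdot> u (Suc n)"
  by (simp add: conv_def Suc_diff_le)

text \<open>Lets the termination proof of \<open>inv_seq\<close> see that the summation index stays
  below \<open>n\<close>.\<close>

declare sum.cong [fundef_cong]

text \<open>Solves the equation for a formal right inverse of \<open>A\<close> one coefficient at a
  time; \<open>R\<close> stands for an inverse of the constant coefficient
  \<open>A 0\<close>.\<close>

fun inv_seq :: "('b \<Rightarrow>\<^sub>C\<^sub>L 'a) \<Rightarrow> (nat \<Rightarrow> 'a::complex_normed_vector \<Rightarrow>\<^sub>C\<^sub>L 'b::complex_normed_vector) \<Rightarrow>
    nat \<Rightarrow> 'b \<Rightarrow>\<^sub>C\<^sub>L 'a"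
  where "inv_seq R A n = (if n = 0 then R else - (R \<circ>\<^sub>C (\<Sum>k<n. A (n - k) \<circ>\<^sub>C inv_seq R A k)))"

declare inv_seq.simps [simp del]

lemma oconv_inv_seq:
  assumes R: "A 0 \<circ>\<^sub>C R = id_cblinfun"
  shows "oconv A (inv_seq R A) = impulse id_cblinfun"
proof
  fix n
  show "oconv A (inv_seq R A) n = impulse id_cblinfun n"
  proof (cases n)
    case 0
    then show ?thesis by (simp add: oconv_def impulse_def R inv_seq.simps)
  next
    case (Suc m)
    have "oconv A (inv_seq R A) n = (\<Sum>k<n. A (n - k) \<circ>\<^sub>C inv_seq R A k) + A 0 \<circ>\<^sub>C inv_seq R A n"
      by (simp add: oconv_def lessThan_Suc_atMost[symmetric])
    also have "A 0 \<circ>\<^sub>C inv_seq R A n = - (\<Sum>k<n. A (n - k) \<circ>\<^sub>C inv_seq R A k)"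
    proof -
      have "inv_seq R A n = - (R \<circ>\<^sub>C (\<Sum>k<n. A (n - k) \<circ>\<^sub>C inv_seq R A k))"
        by (subst inv_seq.simps) (simp add: Suc)
      then show ?thesis
        by (simp add: cblinfun_compose.minus_right cblinfun_compose_assoc[symmetric] R)
    qed
    finally show ?thesis using Suc by (simp add: impulse_def)
  qed
qed

text \<open>The right inverse \<open>V\<close> of \<open>A\<close> starts with the invertible
  \<open>R\<close> and so has a right inverse itself; associativity identifies the latter with
  \<open>A\<close>.\<close>

lemma oconv_inverse_exists:
  assumes "A 0 \<circ>\<^sub>C R = id_cblinfun" "R \<circ>\<^sub>C A 0 = id_cblinfun"
  obtains V where "oconv A V = impulse id_cblinfun" "oconv V A = impulse id_cblinfun"
proof -
  define V where "V = inv_seq R A"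
  have AV: "oconv A V = impulse id_cblinfun"
    unfolding V_def using assms(1) by (rule oconv_inv_seq)
  have "V 0 = R" by (simp add: V_def inv_seq.simps)
  then have VA': "oconv V (inv_seq (A 0) V) = impulse id_cblinfun"
    by (intro oconv_inv_seq) (simp add: assms)
  have "A = oconv A (oconv V (inv_seq (A 0) V))"
    unfolding VA' by (simp add: fun_eq_iff)
  also have "\<dots> = inv_seq (A 0) V" by (simp add: oconv_assoc[symmetric] AV)
  finally have "oconv V A = impulse id_cblinfun" using VA' by simp
  with AV show thesis by (rule that)
qed

section \<open>Power series on the disc\<close>

definition disc_summable :: "(nat \<Rightarrow> 'a::complex_normed_vector) \<Rightarrow> bool"
  where "disc_summable A \<longleftrightarrow> (\<forall>r. 0 \<le> r \<and> r < 1 \<longrightarrow> summable (\<lambda>n. r ^ n * norm (A n)))"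

definition disc_sum :: "(nat \<Rightarrow> 'a::complex_normed_vector) \<Rightarrow> complex \<Rightarrow> 'a"
  where "disc_sum A z = (\<Sum>n. z ^ n *\<^sub>C A n)"

lemma disc_summable_bounded:
  assumes "\<And>n. norm (A n) \<le> K"
  shows "disc_summable A"
  unfolding disc_summable_def
proof (intro allI impI)
  fix r :: real assume r: "0 \<le> r \<and> r < 1"
  show "summable (\<lambda>n. r ^ n * norm (A n))"
  proof (rule summable_comparison_test'[where N = 0])
    show "summable (\<lambda>n. r ^ n * K)" using r by (intro summable_mult2 summable_geometric) auto
    show "norm (r ^ n * norm (A n)) \<le> r ^ n * K" for n
      using r assms[of n] by (simp add: abs_mult mult_left_mono)
  qed
qed

lemma disc_summable_norm: "disc_summable A \<Longrightarrow> z \<in> \<DD> \<Longrightarrow> summable (\<lambda>n. norm (z ^ n *\<^sub>C A n))"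
  by (simp add: disc_summable_def norm_scaleC norm_power)

lemma disc_sum_sums:
  fixes A :: "nat \<Rightarrow> 'a::{complex_normed_vector, banach}"
  shows "disc_summable A \<Longrightarrow> z \<in> \<DD> \<Longrightarrow> (\<lambda>n. z ^ n *\<^sub>C A n) sums disc_sum A z"
  unfolding disc_sum_def by (rule summable_sums[OF summable_norm_cancel[OF disc_summable_norm]])

lemma disc_summable_add: "disc_summable A \<Longrightarrow> disc_summable B \<Longrightarrow> disc_summable (\<lambda>n. A n + B n)"
  unfolding disc_summable_def
proof (intro allI impI)
  fix r :: real
  assume *: "\<forall>r. 0 \<le> r \<and> r < 1 \<longrightarrow> summable (\<lambda>n. r ^ n * norm (A n))"
    "\<forall>r. 0 \<le> r \<and> r < 1 \<longrightarrow> summable (\<lambda>n. r ^ n * norm (B n))" and r: "0 \<le> r \<and> r < 1"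
  show "summable (\<lambda>n. r ^ n * norm (A n + B n))"
  proof (rule summable_comparison_test'[where N = 0])
    show "summable (\<lambda>n. r ^ n * norm (A n) + r ^ n * norm (B n))" by (intro summable_add *[rule_format, OF r])
    show "norm (r ^ n * norm (A n + B n)) \<le> r ^ n * norm (A n) + r ^ n * norm (B n)" for n
      using r by (simp add: abs_mult mult_left_mono norm_triangle_ineq distrib_left[symmetric])
  qed
qed

lemma disc_sum_add:
  fixes A :: "nat \<Rightarrow> 'a::{complex_normed_vector, banach}"
  assumes "disc_summable A" "disc_summable B" "z \<in> \<DD>"
  shows "disc_sum (\<lambda>n. A n + B n) z = disc_sum A z + disc_sum B z"
  using sums_unique[OF sums_add[OF disc_sum_sums[OF assms(1,3)] disc_sum_sums[OF assms(2,3)]]]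
  by (simp add: disc_sum_def scaleC_add_right)

lemma disc_sum_Suc:
  fixes A :: "nat \<Rightarrow> 'a::{complex_normed_vector, banach}"
  assumes "disc_summable (\<lambda>n. A (Suc n))" "z \<in> \<DD>"
  shows "disc_sum A z = A 0 + z *\<^sub>C disc_sum (\<lambda>n. A (Suc n)) z"
proof -
  have "(\<lambda>n. z *\<^sub>C (z ^ n *\<^sub>C A (Suc n))) sums (z *\<^sub>C disc_sum (\<lambda>n. A (Suc n)) z)"
    by (rule bounded_linear.sums[OF bounded_linear_scaleC disc_sum_sums[OF assms]])
  then have "(\<lambda>n. z ^ n *\<^sub>C A n) sums (z *\<^sub>C disc_sum (\<lambda>n. A (Suc n)) z + z ^ 0 *\<^sub>C A 0)"
    by (intro iffD1[OF sums_Suc_iff] ) (simp add: scaleC_scaleC)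
  then show ?thesis by (simp add: disc_sum_def sums_unique[symmetric] add.commute)
qed

text \<open>Square and triangular partial sums differ by terms that are dominated, up to the bound
  of \<open>prod\<close>, by the same difference \<open>D\<close> for the scalar series of norms,
  which tends to 0. Stated for a bilinear map so as to cover both application and
  composition.\<close>

lemma bilinear_Cauchy_product:
  fixes prod :: "'a::banach \<Rightarrow> 'b::banach \<Rightarrow> 'c::banach"
  assumes prod: "bounded_bilinear prod"
    and a: "summable (\<lambda>n. norm (a n))" and b: "summable (\<lambda>n. norm (b n))"
  shows "(\<lambda>n. \<Sum>k\<le>n. prod (a (n - k)) (b k)) sums prod (suminf a) (suminf b)"
proof -
  interpret bounded_bilinear prod by (rule prod)
  obtain K where K: "0 \<le> K" "\<And>x y. norm (prod x y) \<le> norm x * norm y * K"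
    using nonneg_bounded by blast
  define S1 where "S1 N = {..<N} \<times> {..<N :: nat}" for N
  define S2 where "S2 N = {(i, j). i + j < (N :: nat)}" for N
  have S2_sub: "S2 N \<subseteq> S1 N" and fin: "finite (S1 N)" for N by (auto simp: S1_def S2_def)
  have tri: "(\<Sum>n<N. \<Sum>k\<le>n. f (n - k) k) = (\<Sum>(i, j)\<in>S2 N. f i j)"
    for f :: "nat \<Rightarrow> nat \<Rightarrow> 'd::comm_monoid_add" and N
    unfolding sum.Sigma[OF finite_lessThan ballI[OF finite_atMost]]
    by (rule sum.reindex_bij_witness[where i = "\<lambda>(i, j). (i + j, j)" and j = "\<lambda>(n, k). (n - k, k)"])
      (auto simp: S2_def)
  have diff: "(\<Sum>i<N. \<Sum>j<N. f i j) - (\<Sum>n<N. \<Sum>k\<le>n. f (n - k) k) = (\<Sum>(i, j)\<in>S1 N - S2 N. f i j)"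
    for f :: "nat \<Rightarrow> nat \<Rightarrow> 'd::ab_group_add" and N
    unfolding tri sum.cartesian_product S1_def[symmetric]
    by (rule sum_diff[OF fin S2_sub, symmetric])
  define D where "D N = (\<Sum>i<N. \<Sum>j<N. norm (a i) * norm (b j)) -
    (\<Sum>n<N. \<Sum>k\<le>n. norm (a (n - k)) * norm (b k))" for N
  have D0: "D \<longlonglongrightarrow> 0"
  proof -
    have "(\<lambda>k. \<Sum>i\<le>k. norm (b i) * norm (a (k - i))) sums ((\<Sum>k. norm (b k)) * (\<Sum>k. norm (a k)))"
      using a b by (intro Cauchy_product_sums) auto
    then have "(\<lambda>N. \<Sum>n<N. \<Sum>k\<le>n. norm (a (n - k)) * norm (b k)) \<longlonglongrightarrow> (\<Sum>k. norm (a k)) * (\<Sum>k. norm (b k))"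
      by (simp add: sums_def mult.commute)
    moreover have "(\<lambda>N. \<Sum>i<N. \<Sum>j<N. norm (a i) * norm (b j)) \<longlonglongrightarrow> (\<Sum>k. norm (a k)) * (\<Sum>k. norm (b k))"
      unfolding sum_product[symmetric] by (intro tendsto_mult summable_LIMSEQ a b)
    ultimately show ?thesis unfolding D_def using tendsto_diff by fastforce
  qed
  have "(\<lambda>N. (\<Sum>i<N. \<Sum>j<N. prod (a i) (b j)) - (\<Sum>n<N. \<Sum>k\<le>n. prod (a (n - k)) (b k))) \<longlonglongrightarrow> 0"
  proof (rule Lim_null_comparison)
    show "(\<lambda>N. D N * K) \<longlonglongrightarrow> 0" using tendsto_mult_right[OF D0, of K] by simp
    have "norm (\<Sum>(i, j)\<in>S1 N - S2 N. prod (a i) (b j)) \<le> (\<Sum>(i, j)\<in>S1 N - S2 N. norm (a i) * norm (b j)) * K" for N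
      unfolding sum_distrib_right
      by (rule sum_norm_le) (auto simp: K)
    then show "\<forall>\<^sub>F N in sequentially. norm ((\<Sum>i<N. \<Sum>j<N. prod (a i) (b j)) -
        (\<Sum>n<N. \<Sum>k\<le>n. prod (a (n - k)) (b k))) \<le> D N * K"
      using diff[of "\<lambda>i j. prod (a i) (b j)"] diff[of "\<lambda>i j. norm (a i) * norm (b j)"]
      unfolding D_def by simp
  qed
  moreover have "(\<lambda>N. \<Sum>i<N. \<Sum>j<N. prod (a i) (b j)) \<longlonglongrightarrow> prod (suminf a) (suminf b)"
  proof -
    have "(\<Sum>i<N. \<Sum>j<N. prod (a i) (b j)) = prod (\<Sum>i<N. a i) (\<Sum>j<N. b j)" for N
      by (simp only: sum_left) (simp only: sum_right)
    then show ?thesis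
      by (simp add: tendsto summable_LIMSEQ summable_norm_cancel a b)
  qed
  ultimately show ?thesis unfolding sums_def using tendsto_diff by fastforce
qed

lemma disc_summable_product:
  assumes A: "disc_summable A" and B: "disc_summable B"
    and C: "\<And>n. norm (C n) \<le> (\<Sum>k\<le>n. norm (A (n - k)) * norm (B k))"
  shows "disc_summable C"
  unfolding disc_summable_def
proof (intro allI impI)
  fix r :: real assume r: "0 \<le> r \<and> r < 1"
  show "summable (\<lambda>n. r ^ n * norm (C n))"
  proof (rule summable_comparison_test'[where N = 0])
    show "summable (\<lambda>n. \<Sum>k\<le>n. (r ^ k * norm (B k)) * (r ^ (n - k) * norm (A (n - k))))"
      using A B r by (intro summable_Cauchy_product) (auto simp: disc_summable_def abs_mult)
    fix n
    have "r ^ n * norm (C n) \<le> r ^ n * (\<Sum>k\<le>n. norm (A (n - k)) * norm (B k))"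
      using r C by (intro mult_left_mono) auto
    also have "\<dots> = (\<Sum>k\<le>n. (r ^ k * norm (B k)) * (r ^ (n - k) * norm (A (n - k))))"
      unfolding sum_distrib_left
    proof (rule sum.cong)
      fix k assume "k \<in> {..n}"
      then have "r ^ n = r ^ k * r ^ (n - k)" by (simp add: power_add[symmetric])
      then show "r ^ n * (norm (A (n - k)) * norm (B k)) = r ^ k * norm (B k) * (r ^ (n - k) * norm (A (n - k)))"
        by simp
    qed simp
    finally show "norm (r ^ n * norm (C n)) \<le> (\<Sum>k\<le>n. (r ^ k * norm (B k)) * (r ^ (n - k) * norm (A (n - k))))"
      using r by simp
  qed
qed

lemma disc_summable_oconv: "disc_summable A \<Longrightarrow> disc_summable B \<Longrightarrow> disc_summable (oconv A B)"
  by (rule disc_summable_product[of A B]) (auto simp: oconv_def intro!: sum_norm_le norm_cblinfun_compose)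

lemma power_diff_mult: "k \<le> n \<Longrightarrow> z ^ k * z ^ (n - k) = (z ^ n :: 'a::monoid_mult)"
  by (simp add: power_add[symmetric])

lemma disc_sum_conv:
  fixes A :: "nat \<Rightarrow> 'a::{complex_normed_vector, banach} \<Rightarrow>\<^sub>C\<^sub>L 'b::{complex_normed_vector, banach}"
  assumes A: "disc_summable A" and u: "disc_summable u" and z: "z \<in> \<DD>"
  shows "disc_sum (conv A u) z = disc_sum A z \<cdot> disc_sum u z"
proof -
  have "(\<lambda>n. \<Sum>k\<le>n. (z ^ (n - k) *\<^sub>C A (n - k)) \<cdot> (z ^ k *\<^sub>C u k)) sums (disc_sum A z \<cdot> disc_sum u z)"
    unfolding disc_sum_def
    by (rule bilinear_Cauchy_product[OF cblinfun.bounded_bilinear_axioms disc_summable_norm[OF A z]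
          disc_summable_norm[OF u z]])
  moreover have "(\<Sum>k\<le>n. (z ^ (n - k) *\<^sub>C A (n - k)) \<cdot> (z ^ k *\<^sub>C u k)) = z ^ n *\<^sub>C conv A u n" for n
    unfolding conv_def scaleC_sum_right
    by (rule sum.cong) (auto simp: cblinfun_scaleC_left cblinfun_scaleC_right scaleC_scaleC power_diff_mult)
  ultimately show ?thesis by (simp add: disc_sum_def sums_unique[symmetric])
qed

lemma disc_sum_oconv:
  fixes A :: "nat \<Rightarrow> 'b::{complex_normed_vector, banach} \<Rightarrow>\<^sub>C\<^sub>L 'c::{complex_normed_vector, banach}"
    and B :: "nat \<Rightarrow> 'a::{complex_normed_vector, banach} \<Rightarrow>\<^sub>C\<^sub>L 'b"
  assumes A: "disc_summable A" and B: "disc_summable B" and z: "z \<in> \<DD>"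
  shows "disc_sum (oconv A B) z = disc_sum A z \<circ>\<^sub>C disc_sum B z"
proof -
  have "(\<lambda>n. \<Sum>k\<le>n. (z ^ (n - k) *\<^sub>C A (n - k)) \<circ>\<^sub>C (z ^ k *\<^sub>C B k)) sums (disc_sum A z \<circ>\<^sub>C disc_sum B z)"
    unfolding disc_sum_def
    by (rule bilinear_Cauchy_product[OF cblinfun_compose.bounded_bilinear_axioms disc_summable_norm[OF A z]
          disc_summable_norm[OF B z]])
  moreover have "(\<Sum>k\<le>n. (z ^ (n - k) *\<^sub>C A (n - k)) \<circ>\<^sub>C (z ^ k *\<^sub>C B k)) = z ^ n *\<^sub>C oconv A B n" for n
    unfolding oconv_def scaleC_sum_right
    by (rule sum.cong) (auto simp: cblinfun_compose_scaleC scaleC_scaleC power_diff_mult)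
  ultimately show ?thesis by (simp add: disc_sum_def sums_unique[symmetric])
qed

lemma disc_sum_impulse [simp]: "disc_sum (impulse T) z = T"
  unfolding disc_sum_def by (subst suminf_finite[of "{0}"]) (auto simp: impulse_def)

lemma disc_summable_impulse [simp]: "disc_summable (impulse T)"
  by (rule disc_summable_bounded[where K = "norm T"]) (simp add: impulse_def)

lemma disc_summable_compose_left: "disc_summable A \<Longrightarrow> disc_summable (\<lambda>n. T \<circ>\<^sub>C A n)"
  using disc_summable_oconv[of "impulse T" A] by simp

lemma disc_sum_compose_left:
  fixes A :: "nat \<Rightarrow> 'a::complex_hilbert \<Rightarrow>\<^sub>C\<^sub>L 'b::complex_hilbert" and T :: "'b \<Rightarrow>\<^sub>C\<^sub>L 'c::complex_hilbert"
  shows "disc_summable A \<Longrightarrow> z \<in> \<DD> \<Longrightarrow> disc_sum (\<lambda>n. T \<circ>\<^sub>C A n) z = T \<circ>\<^sub>C disc_sum A z"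
  using disc_sum_oconv[OF disc_summable_impulse[of T], of A z] by simp

lemma oconv_impulse_right_fun: "oconv A (impulse T) = (\<lambda>n. A n \<circ>\<^sub>C T)"
  by (simp add: fun_eq_iff)

lemma disc_summable_compose_right: "disc_summable A \<Longrightarrow> disc_summable (\<lambda>n. A n \<circ>\<^sub>C T)"
  using disc_summable_oconv[of A "impulse T"] unfolding oconv_impulse_right_fun by simp

lemma disc_sum_compose_right:
  fixes A :: "nat \<Rightarrow> 'b::complex_hilbert \<Rightarrow>\<^sub>C\<^sub>L 'c::complex_hilbert" and T :: "'a::complex_hilbert \<Rightarrow>\<^sub>C\<^sub>L 'b"
  shows "disc_summable A \<Longrightarrow> z \<in> \<DD> \<Longrightarrow> disc_sum (\<lambda>n. A n \<circ>\<^sub>C T) z = disc_sum A z \<circ>\<^sub>C T"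
  using disc_sum_oconv[of A "impulse T" z] unfolding oconv_impulse_right_fun by simp

lemma analytic_on_disc_cong:
  assumes "\<And>z. z \<in> \<DD> \<Longrightarrow> F z = G z" and "analytic_on_disc F"
  shows "analytic_on_disc G"
  using assms unfolding analytic_on_disc_def
  by (metis has_derivative_transform_within_open open_ball)

text \<open>Termwise differentiation on a disc of radius \<open>r\<close> with |z| < r < 1, where
  the summable numbers \<open>c n\<close> dominate the derivative terms uniformly.\<close>

lemma analytic_disc_sum:
  fixes A :: "nat \<Rightarrow> 'a::{complex_normed_vector, banach}"
  assumes A: "disc_summable A"
  shows "analytic_on_disc (disc_sum A)"
  unfolding analytic_on_disc_def
proof
  fix z :: complex assume z: "z \<in> \<DD>"
  obtain r where r: "cmod z < r" "r < 1" using z dense[of "cmod z" 1] by auto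
  have r0: "0 \<le> r" using r norm_ge_zero[of z] by linarith
  define c where "c n = real n * r ^ (n - 1) * norm (A n)" for n
  define G where "G x = (\<Sum>n. (of_nat n * x ^ (n - 1)) *\<^sub>C A n)" for x
  \<comment> \<open>The scalar series of the norms converges for every radius below 1, so its formal
    derivative does too.\<close>
  have "summable (\<lambda>n. diffs (\<lambda>n. norm (A n)) n * r ^ n)"
  proof (rule termdiff_converges[where K = 1])
    fix x :: real assume "norm x < 1"
    then have "summable (\<lambda>n. norm (norm (A n) * x ^ n))"
      using A[unfolded disc_summable_def, rule_format, of "\<bar>x\<bar>"]
      by (simp add: abs_mult power_abs mult.commute)
    then show "summable (\<lambda>n. norm (A n) * x ^ n)" by (rule summable_norm_cancel)
  qed (use r r0 in auto)
  then have "summable (\<lambda>n. c (Suc n))" by (simp add: c_def diffs_def mult_ac)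
  then have c: "summable c" by (simp add: summable_Suc_iff)
  have cb: "norm ((of_nat n * x ^ (n - 1)) *\<^sub>C A n) \<le> c n" if "x \<in> ball 0 r" for n x
    using that by (auto simp: norm_scaleC norm_mult norm_power c_def intro!: mult_right_mono mult_left_mono power_mono)
  have G: "(\<lambda>n. (of_nat n * x ^ (n - 1)) *\<^sub>C A n) sums G x" if "x \<in> ball 0 r" for x
    unfolding G_def using cb[OF that] by (intro summable_sums summable_comparison_test'[OF c]) auto
  have "\<exists>g. \<forall>x\<in>ball 0 r. (\<lambda>n. x ^ n *\<^sub>C A n) sums g x \<and>
      (g has_derivative (\<lambda>h. h *\<^sub>C G x)) (at x within ball 0 r)"
  proof (rule has_derivative_series[where f' = "\<lambda>n x h. (of_nat n * x ^ (n - 1) * h) *\<^sub>C A n"])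
    fix n and x :: complex
    have "bounded_linear (\<lambda>c. c *\<^sub>C A n)"
      by (rule bounded_linear_intro[where K = "norm (A n)"])
        (simp_all add: scaleC_add_left norm_scaleC scaleR_conv_of_real scaleC_scaleC[symmetric] scaleC_of_real)
    moreover have "((\<lambda>x. x ^ n) has_derivative (\<lambda>h. of_nat n * x ^ (n - 1) * h)) (at x within ball 0 r)"
      using DERIV_power[OF DERIV_ident, where n = n and x = x and s = "ball 0 r"] by (simp add: has_field_derivative_def)
    ultimately show "((\<lambda>x. x ^ n *\<^sub>C A n) has_derivative (\<lambda>h. (of_nat n * x ^ (n - 1) * h) *\<^sub>C A n)) (at x within ball 0 r)"
      by (rule bounded_linear.has_derivative)
  next
    fix e :: real assume e: "0 < e"
    then obtain N where N: "\<And>n. n \<ge> N \<Longrightarrow> norm (\<Sum>i. c (i + n)) < e"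
      using suminf_exist_split[OF e c] by auto
    have "norm ((\<Sum>i<n. (of_nat i * x ^ (i - 1) * h) *\<^sub>C A i) - h *\<^sub>C G x) \<le> e * norm h"
      if n: "n \<ge> N" and x: "x \<in> ball 0 r" for n x h
    proof -
      let ?f = "\<lambda>n. (of_nat n * x ^ (n - 1)) *\<^sub>C A n"
      have sf: "summable (\<lambda>i. norm (?f (i + n)))"
        by (rule summable_comparison_test'[OF summable_ignore_initial_segment[OF c, of n], of 0])
          (simp only: real_norm_def abs_norm_cancel cb[OF x])
      have "G x - (\<Sum>i<n. ?f i) = (\<Sum>i. ?f (i + n))"
        using suminf_minus_initial_segment[OF sums_summable[OF G[OF x]], of n] by (simp add: G_def)
      then have "norm (G x - (\<Sum>i<n. ?f i)) \<le> (\<Sum>i. norm (?f (i + n)))"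
        using summable_norm[OF sf] by simp
      also have "\<dots> \<le> (\<Sum>i. c (i + n))"
        by (rule suminf_le[OF cb[OF x] sf summable_ignore_initial_segment[OF c]])
      also have "\<dots> \<le> e" using N[OF n] by simp
      finally have "norm (h *\<^sub>C (G x - (\<Sum>i<n. ?f i))) \<le> e * norm h"
        by (simp add: norm_scaleC mult.commute[of e] mult_left_mono)
      moreover have "(\<Sum>i<n. (of_nat i * x ^ (i - 1) * h) *\<^sub>C A i) - h *\<^sub>C G x = - (h *\<^sub>C (G x - (\<Sum>i<n. ?f i)))"
        by (simp add: scaleC_diff_right scaleC_sum_right scaleC_scaleC mult_ac)
      ultimately show ?thesis by (simp only: norm_minus_cancel)
    qed
    then show "\<forall>\<^sub>F n in sequentially. \<forall>x\<in>ball 0 r. \<forall>h.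
        norm ((\<Sum>i<n. (of_nat i * x ^ (i - 1) * h) *\<^sub>C A i) - h *\<^sub>C G x) \<le> e * norm h"
      unfolding eventually_sequentially by blast
  next
    show "(\<lambda>n. z ^ n *\<^sub>C A n) sums disc_sum A z" by (rule disc_sum_sums[OF A z])
  qed (use r in auto)
  then obtain g where g: "\<And>x. x \<in> ball 0 r \<Longrightarrow> (\<lambda>n. x ^ n *\<^sub>C A n) sums g x"
    "\<And>x. x \<in> ball 0 r \<Longrightarrow> (g has_derivative (\<lambda>h. h *\<^sub>C G x)) (at x within ball 0 r)" by blast
  have zr: "z \<in> ball 0 r" using r by simp
  have "(g has_derivative (\<lambda>h. h *\<^sub>C G z)) (at z)"
    using g(2)[OF zr] at_within_open[OF zr open_ball] by simp
  then have "(disc_sum A has_derivative (\<lambda>h. h *\<^sub>C G z)) (at z)"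
    by (rule has_derivative_transform_within_open[OF _ open_ball zr])
      (simp add: disc_sum_def sums_unique[OF g(1)])
  then show "\<exists>G. (disc_sum A has_derivative (\<lambda>h. h *\<^sub>C G)) (at z)" by blast
qed

section \<open>Square summable sequences and the shift\<close>

lemma ell2_eqI: "(\<And>n. ell2_nth x n = ell2_nth y n) \<Longrightarrow> x = y"
  by (simp add: ell2_nth_inject[symmetric] fun_eq_iff)

lemmas ell2_nth_simps [simp] = zero_ell2.rep_eq plus_ell2.rep_eq minus_ell2.rep_eq uminus_ell2.rep_eq
  scaleR_ell2.rep_eq scaleC_ell2.rep_eq

lemma ell2_nth_shift: "ell2_nth (shift_op \<cdot> x) n = (case n of 0 \<Rightarrow> 0 | Suc m \<Rightarrow> ell2_nth x m)"
  by (simp add: shift_op_apply ell2_shift_seq.rep_eq)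

lemma ell2_nth_embed: "ell2_nth (embed_op \<cdot> v) n = (if n = 0 then v else 0)"
  by (simp add: embed_op_apply ell2_single_zero.rep_eq)

lemma ell2_nth_shift_pow:
  "ell2_nth (((\<cdot>) shift_op ^^ n) x) k = (if k < n then 0 else ell2_nth x (k - n))"
  by (induction n arbitrary: k) (auto simp: ell2_nth_shift split: nat.split)

lemma ell2_nth_single:
  "ell2_nth (((\<cdot>) shift_op ^^ n) (embed_op \<cdot> v)) k = (if k = n then v else 0)"
  by (auto simp: ell2_nth_shift_pow ell2_nth_embed)

lemma ell2_nth_sum: "ell2_nth (\<Sum>i\<in>I. f i) n = (\<Sum>i\<in>I. ell2_nth (f i) n)"
  by (induction I rule: infinite_finite_induct) auto

text \<open>The squared error after N terms is the tail of the square sum. A bounded operator may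
  therefore be applied term by term, which turns \<open>W x\<close> into a series in powers of
  \<open>Z\<close>.\<close>

lemma ell2_expansion: "(\<lambda>n. ((\<cdot>) shift_op ^^ n) (embed_op \<cdot> ell2_nth x n)) sums x"
proof -
  let ?s = "\<lambda>N. \<Sum>n<N. ((\<cdot>) shift_op ^^ n) (embed_op \<cdot> ell2_nth x n)"
  have nth: "ell2_nth (?s N) k = (if k < N then ell2_nth x k else 0)" for N k
    by (simp add: ell2_nth_sum ell2_nth_single)
  have eq: "(norm (?s N - x))\<^sup>2 = (norm x)\<^sup>2 - (\<Sum>n<N. (norm (ell2_nth x n))\<^sup>2)" for N
  proof -
    have "(\<lambda>n. (norm (ell2_nth x n))\<^sup>2 - (if n \<in> {..<N} then (norm (ell2_nth x n))\<^sup>2 else 0)) sums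
        ((norm x)\<^sup>2 - (\<Sum>n<N. (norm (ell2_nth x n))\<^sup>2))"
      unfolding norm_ell2_sq[of x]
      by (intro sums_diff summable_sums summable_ell2 sums_If_finite_set) simp
    moreover have "(norm (ell2_nth x n))\<^sup>2 - (if n \<in> {..<N} then (norm (ell2_nth x n))\<^sup>2 else 0)
        = (norm (ell2_nth (?s N - x) n))\<^sup>2" for n
      by (simp add: nth)
    ultimately have "(\<lambda>n. (norm (ell2_nth (?s N - x) n))\<^sup>2) sums
        ((norm x)\<^sup>2 - (\<Sum>n<N. (norm (ell2_nth x n))\<^sup>2))" by (simp only:)
    then show ?thesis by (rule norm_ell2_sq[THEN trans, OF sums_unique[symmetric]])
  qed
  have "(\<lambda>N. (norm x)\<^sup>2 - (\<Sum>n<N. (norm (ell2_nth x n))\<^sup>2)) \<longlonglongrightarrow> (norm x)\<^sup>2 - (norm x)\<^sup>2"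
    unfolding norm_ell2_sq by (intro tendsto_diff tendsto_const summable_LIMSEQ summable_ell2)
  then have "(\<lambda>N. (norm (?s N - x))\<^sup>2) \<longlonglongrightarrow> 0" unfolding eq by simp
  then have "(\<lambda>N. sqrt ((norm (?s N - x))\<^sup>2)) \<longlonglongrightarrow> sqrt 0" by (rule tendsto_real_sqrt)
  then have "(\<lambda>N. norm (?s N - x)) \<longlonglongrightarrow> 0" by simp
  then show ?thesis unfolding sums_def using LIM_zero_cancel tendsto_norm_zero_iff by blast
qed

lemma cinner_ell2_single: "cinner x (((\<cdot>) shift_op ^^ n) (embed_op \<cdot> v)) = cinner (ell2_nth x n) v"
  unfolding cinner_ell2_def by (subst suminf_finite[of "{n}"]) (auto simp: ell2_nth_single)

lemma ell2_nth_adj_shift: "ell2_nth (shift_op\<^sup>\<dagger> \<cdot> x) n = ell2_nth x (Suc n)"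
proof (rule cinner_eqI)
  show "cinner (ell2_nth (shift_op\<^sup>\<dagger> \<cdot> x) n) v = cinner (ell2_nth x (Suc n)) v" for v
    using cinner_ell2_single[of x "Suc n" v]
    by (simp add: cinner_ell2_single[symmetric] cinner_adj_left)
qed

lemma ell2_nth_adj_shift_pow: "ell2_nth (((\<cdot>) (shift_op\<^sup>\<dagger>) ^^ n) x) k = ell2_nth x (n + k)"
  by (induction n arbitrary: k) (auto simp: ell2_nth_adj_shift)

primrec op_pow :: "('a::complex_normed_vector \<Rightarrow>\<^sub>C\<^sub>L 'a) \<Rightarrow> nat \<Rightarrow> 'a \<Rightarrow>\<^sub>C\<^sub>L 'a" where
  "op_pow T 0 = id_cblinfun"
| "op_pow T (Suc n) = T \<circ>\<^sub>C op_pow T n"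

lemma op_pow_apply: "op_pow T n \<cdot> x = ((\<cdot>) T ^^ n) x"
  by (induction n) auto

lemma norm_ell2_split:
  "(norm x)\<^sup>2 = (\<Sum>n<N. (norm (ell2_nth x n))\<^sup>2) + (norm (op_pow (shift_op\<^sup>\<dagger>) N \<cdot> x))\<^sup>2"
  unfolding norm_ell2_sq op_pow_apply ell2_nth_adj_shift_pow
  using suminf_minus_initial_segment[OF summable_ell2[of x], of N] by (simp add: add.commute)

lemma op_pow_Suc_right: "op_pow T (Suc n) = op_pow T n \<circ>\<^sub>C T"
  by (rule cblinfun_eqI) (simp add: op_pow_apply funpow_swap1)

lemma cinner_op_pow: "cinner (op_pow T n \<cdot> x) y = cinner x (op_pow (T\<^sup>\<dagger>) n \<cdot> y)"
proof (induction n arbitrary: y)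
  case (Suc n)
  then show ?case
    unfolding op_pow_Suc_right[of "T\<^sup>\<dagger>"] by (simp add: cinner_adj_right)
qed simp

lemma intertwine_shift_pow:
  assumes "Z \<circ>\<^sub>C W = W \<circ>\<^sub>C shift_op"
  shows "W \<cdot> ((\<cdot>) shift_op ^^ n) x = op_pow Z n \<cdot> W \<cdot> x"
proof (induction n)
  case (Suc n)
  have "W \<cdot> shift_op \<cdot> y = Z \<cdot> W \<cdot> y" for y using assms by (metis cblinfun_compose_apply)
  then show ?case using Suc by simp
qed simp

lemma intertwine_sums:
  assumes "Z \<circ>\<^sub>C W = W \<circ>\<^sub>C shift_op"
  shows "(\<lambda>n. op_pow Z n \<cdot> W \<cdot> embed_op \<cdot> ell2_nth x n) sums (W \<cdot> x)"
  using bounded_linear.sums[OF cblinfun.bounded_linear_right[of W] ell2_expansion[of x]]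
  by (simp add: intertwine_shift_pow[OF assms])

text \<open>\<open>W\<^sup>\<dagger>\<close> is an observability operator: it lists the outputs of
  the free system with state operator \<open>Z\<^sup>\<dagger>\<close> and output operator
  \<open>B\<^sup>\<dagger>\<close>, started at \<open>h\<close>.\<close>

lemma ell2_nth_intertwine_adj:
  assumes "Z \<circ>\<^sub>C W = W \<circ>\<^sub>C shift_op"
  shows "ell2_nth (W\<^sup>\<dagger> \<cdot> h) n = (W \<circ>\<^sub>C embed_op)\<^sup>\<dagger> \<cdot> op_pow (Z\<^sup>\<dagger>) n \<cdot> h"
proof (rule cinner_eqI)
  fix v
  have "cinner (ell2_nth (W\<^sup>\<dagger> \<cdot> h) n) v = cinner h (op_pow Z n \<cdot> W \<cdot> embed_op \<cdot> v)"
    by (simp add: cinner_ell2_single[symmetric] cinner_adj_left intertwine_shift_pow[OF assms])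
  also have "\<dots> = cinner (op_pow (Z\<^sup>\<dagger>) n \<cdot> h) ((W \<circ>\<^sub>C embed_op) \<cdot> v)"
    using cinner_op_pow[of "Z\<^sup>\<dagger>" n h] by simp
  finally show "cinner (ell2_nth (W\<^sup>\<dagger> \<cdot> h) n) v = cinner ((W \<circ>\<^sub>C embed_op)\<^sup>\<dagger> \<cdot> op_pow (Z\<^sup>\<dagger>) n \<cdot> h) v"
    by (simp only: cinner_adj_left)
qed

section \<open>Contractive lower triangular Toeplitz operators\<close>

text \<open>Contractivity is imposed on all truncations and for arbitrary inputs, because the
  signals in the feedback loop are not known to be square summable.\<close>

definition contr_seq :: "(nat \<Rightarrow> 'a::complex_normed_vector \<Rightarrow>\<^sub>C\<^sub>L 'b::complex_normed_vector) \<Rightarrow> bool"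
  where "contr_seq A \<longleftrightarrow> (\<forall>u N. (\<Sum>n<N. (norm (conv A u n))\<^sup>2) \<le> (\<Sum>n<N. (norm (u n))\<^sup>2))"

text \<open>\<open>Abs_ell2\<close> is meaningful only for square summable outputs, hence the
  assumption \<open>contr_seq\<close> in the lemmas about \<open>toep\<close>.\<close>

definition toep :: "(nat \<Rightarrow> 'u::complex_hilbert \<Rightarrow>\<^sub>C\<^sub>L 'y::complex_hilbert) \<Rightarrow> 'u ell2 \<Rightarrow>\<^sub>C\<^sub>L 'y ell2"
  where "toep A = CBlinfun (\<lambda>u. Abs_ell2 (conv A (ell2_nth u)))"

lemma toeplitz_op_eq_toep: "toeplitz_op F = toep (taylor_coeffs F)"
  by (simp add: toeplitz_op_def toep_def conv_def[abs_def])

lemma contr_seq_norm_le: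
  assumes "contr_seq A"
  shows "norm (A n) \<le> 1"
proof (rule norm_cblinfun_bound)
  fix x
  have "(norm (A n \<cdot> x))\<^sup>2 \<le> (\<Sum>k<Suc n. (norm (conv A (impulse x) k))\<^sup>2)"
    unfolding conv_impulse by (rule member_le_sum) auto
  also have "\<dots> \<le> (\<Sum>k<Suc n. (norm (impulse x k))\<^sup>2)"
    by (rule assms[unfolded contr_seq_def, rule_format])
  also have "\<dots> = (norm x)\<^sup>2"
    unfolding sum.lessThan_Suc_shift by (simp add: impulse_def)
  finally show "norm (A n \<cdot> x) \<le> 1 * norm x" by (simp add: power2_le_iff_abs_le)
qed simp

lemma contr_seq_disc_summable: "contr_seq A \<Longrightarrow> disc_summable A"
  by (rule disc_summable_bounded[OF contr_seq_norm_le])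

lemma sum_norm_conv_le:
  assumes "contr_seq A"
  shows "(\<Sum>n<N. (norm (conv A (ell2_nth u) n))\<^sup>2) \<le> (norm u)\<^sup>2"
  by (rule order_trans[OF assms[unfolded contr_seq_def, rule_format] sum_le_norm_ell2_sq]) simp

lemma ell2_nth_toep:
  assumes A: "contr_seq A"
  shows "ell2_nth (toep A \<cdot> u) n = conv A (ell2_nth u) n"
proof -
  have sm: "summable (\<lambda>n. (norm (conv A (ell2_nth u) n))\<^sup>2)" for u
    by (rule summableI_nonneg_bounded[where x = "(norm u)\<^sup>2"]) (simp_all add: sum_norm_conv_le[OF A])
  have nth: "ell2_nth (Abs_ell2 (conv A (ell2_nth u))) = conv A (ell2_nth u)" for u
    using sm[of u] by (simp add: Abs_ell2_inverse)
  have "toep A \<cdot> u = Abs_ell2 (conv A (ell2_nth u))"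
    unfolding toep_def
  proof (rule CBlinfun_apply')
    show "norm (Abs_ell2 (conv A (ell2_nth x))) \<le> 1 * norm x" for x
    proof -
      have "(norm (Abs_ell2 (conv A (ell2_nth x))))\<^sup>2 \<le> (norm x)\<^sup>2"
        unfolding norm_ell2_sq[of "Abs_ell2 _"] nth
        by (rule suminf_le_const[OF sm sum_norm_conv_le[OF A]])
      then show ?thesis by (simp add: power2_le_iff_abs_le)
    qed
    show "Abs_ell2 (conv A (ell2_nth (x + y))) = Abs_ell2 (conv A (ell2_nth x)) + Abs_ell2 (conv A (ell2_nth y))"
      for x y
      by (rule ell2_eqI, unfold nth plus_ell2.rep_eq[of "Abs_ell2 _"]) (simp add: conv_add_right)
    show "Abs_ell2 (conv A (ell2_nth (c *\<^sub>C x))) = c *\<^sub>C Abs_ell2 (conv A (ell2_nth x))" for c x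
      by (rule ell2_eqI, unfold nth scaleC_ell2.rep_eq[of _ "Abs_ell2 _"]) (simp add: conv_scaleC_right)
  qed
  then show ?thesis by (simp add: nth)
qed

lemma norm_toep_le:
  assumes A: "contr_seq A"
  shows "norm (toep A \<cdot> u) \<le> norm u"
proof -
  have "(norm (toep A \<cdot> u))\<^sup>2 \<le> (norm u)\<^sup>2"
    unfolding norm_ell2_sq[of "toep A \<cdot> u"]
    by (rule suminf_le_const[OF summable_ell2]) (simp add: ell2_nth_toep[OF A] sum_norm_conv_le[OF A])
  then show ?thesis by (simp add: power2_le_iff_abs_le)
qed

lemma toep_shift:
  assumes A: "contr_seq A"
  shows "toep A \<cdot> shift_op \<cdot> u = shift_op \<cdot> toep A \<cdot> u"
proof (rule ell2_eqI)
  fix n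
  show "ell2_nth (toep A \<cdot> shift_op \<cdot> u) n = ell2_nth (shift_op \<cdot> toep A \<cdot> u) n"
  proof (cases n)
    case 0
    then show ?thesis by (simp add: ell2_nth_toep[OF A] ell2_nth_shift conv_def)
  next
    case (Suc m)
    then show ?thesis
      by (simp add: ell2_nth_toep[OF A] ell2_nth_shift conv_def sum.atMost_Suc_shift del: sum.atMost_Suc)
  qed
qed

lemma toep_shift_pow:
  assumes "contr_seq A"
  shows "toep A \<cdot> ((\<cdot>) shift_op ^^ n) u = ((\<cdot>) shift_op ^^ n) (toep A \<cdot> u)"
  by (induction n) (simp_all add: toep_shift[OF assms])

lemma ell2_nth_toep_embed:
  assumes "contr_seq A"
  shows "ell2_nth (toep A \<cdot> embed_op \<cdot> v) n = A n \<cdot> v"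
proof -
  have "ell2_nth (embed_op \<cdot> v) = impulse v" by (auto simp: ell2_nth_embed impulse_def)
  then show ?thesis by (simp add: ell2_nth_toep[OF assms])
qed

text \<open>The weights favour the latest indices. If the limit exceeded \<open>C\<close>, the late
  terms would contribute at least \<open>d\<close>, while the share of the first \<open>M\<close>
  terms fades like \<open>r ^ k\<close>.\<close>

lemma weighted_average_limit_le:
  fixes a :: "nat \<Rightarrow> real"
  assumes r: "0 \<le> r" "r < 1" and a: "a \<longlonglongrightarrow> l"
    and le: "\<And>N. (\<Sum>n<N. r ^ (N - 1 - n) * a n) \<le> (\<Sum>n<N. r ^ (N - 1 - n) * C)"
  shows "l \<le> C"
proof (rule ccontr)
  assume "\<not> l \<le> C"
  define d where "d = (l - C) / 2"
  have d: "d > 0" using \<open>\<not> l \<le> C\<close> by (simp add: d_def)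
  have "\<forall>\<^sub>F n in sequentially. a n > C + d"
    by (rule order_tendstoD(1)[OF a]) (use \<open>\<not> l \<le> C\<close> in \<open>simp add: d_def field_simps\<close>)
  then obtain M where M: "\<And>n. n \<ge> M \<Longrightarrow> a n > C + d" by (auto simp: eventually_sequentially)
  define S where "S = (\<Sum>n<M. r ^ (M - n) * (a n - C))"
  have split: "r ^ k * S + d \<le> 0" for k
  proof -
    \<comment> \<open>With this length the last index \<open>M + k\<close> has weight 1 and alone
      contributes more than \<open>d\<close>; the first \<open>M\<close> terms carry the common
      factor \<open>r ^ k\<close>.\<close>
    let ?N = "Suc (M + k)"
    have "(\<Sum>n<?N. r ^ (?N - 1 - n) * (a n - C)) \<le> 0"
      using le[of ?N] by (simp add: right_diff_distrib sum_subtractf)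
    moreover have "(\<Sum>n<?N. r ^ (?N - 1 - n) * (a n - C)) =
        (\<Sum>n<M. r ^ (?N - 1 - n) * (a n - C)) + (\<Sum>n\<in>{M..<?N}. r ^ (?N - 1 - n) * (a n - C))"
    proof -
      have "{..<?N} = {..<M} \<union> {M..<?N}" by auto
      then show ?thesis by (simp only: sum.union_disjoint finite_lessThan finite_atLeastLessThan ivl_disj_int)
    qed
    moreover have "(\<Sum>n<M. r ^ (?N - 1 - n) * (a n - C)) = r ^ k * S"
      unfolding S_def sum_distrib_left
      by (rule sum.cong) (auto simp: power_add[symmetric] mult.assoc[symmetric] add.commute)
    moreover have "d \<le> (\<Sum>n\<in>{M..<?N}. r ^ (?N - 1 - n) * (a n - C))"
    proof -
      have "r ^ (?N - 1 - (M + k)) * (a (M + k) - C) \<le> (\<Sum>n\<in>{M..<?N}. r ^ (?N - 1 - n) * (a n - C))"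
      proof (rule member_le_sum)
        show "0 \<le> r ^ (?N - 1 - n) * (a n - C)" if "n \<in> {M..<?N} - {M + k}" for n
          using r(1) M[of n] d that by (intro mult_nonneg_nonneg) auto
      qed auto
      then show ?thesis using M[of "M + k"] by simp
    qed
    ultimately show ?thesis by linarith
  qed
  have "(\<lambda>k. r ^ k * S + d) \<longlonglongrightarrow> 0 * S + d"
    by (intro tendsto_intros LIMSEQ_realpow_zero) (use r in auto)
  then have "0 * S + d \<le> 0" by (rule LIMSEQ_le_const2) (use split in auto)
  then show False using d by simp
qed

text \<open>The estimate is obtained by applying the contraction to the inputs
  \<open>z\<^sup>N\<^sup>-\<^sup>1 u, \<dots>, z u, u\<close>.\<close>

lemma contr_seq_disc_sum_norm:
  fixes A :: "nat \<Rightarrow> 'a::complex_hilbert \<Rightarrow>\<^sub>C\<^sub>L 'b::complex_hilbert"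
  assumes A: "contr_seq A" and z: "z \<in> \<DD>"
  shows "norm (disc_sum A z) \<le> 1"
proof (rule norm_cblinfun_bound)
  fix u
  define s where "s n = (\<Sum>k<n. z ^ k *\<^sub>C A k \<cdot> u)" for n
  have "(\<lambda>n. (z ^ n *\<^sub>C A n) \<cdot> u) sums (disc_sum A z \<cdot> u)"
    by (rule bounded_linear.sums[OF cblinfun.bounded_linear_left, OF disc_sum_sums[OF contr_seq_disc_summable[OF A] z]])
  then have "s \<longlonglongrightarrow> disc_sum A z \<cdot> u"
    by (simp add: sums_def s_def[abs_def] cblinfun_scaleC_left)
  then have lim: "(\<lambda>n. (norm (s (Suc n)))\<^sup>2) \<longlonglongrightarrow> (norm (disc_sum A z \<cdot> u))\<^sup>2"
    by (intro tendsto_power tendsto_norm LIMSEQ_Suc)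
  have "(norm (disc_sum A z \<cdot> u))\<^sup>2 \<le> (norm u)\<^sup>2"
  proof (rule weighted_average_limit_le[OF _ _ lim])
    show "0 \<le> (cmod z)\<^sup>2" "(cmod z)\<^sup>2 < 1" using z by (auto simp: power_less_one_iff abs_square_less_1)
    fix N
    define v where "v n = z ^ (N - 1 - n) *\<^sub>C u" for n
    \<comment> \<open>Up to powers of z the outputs are partial sums of the series at
      \<open>u\<close>, so the contraction estimate compares two weighted averages with ratio
      |z|^2.\<close>
    have "conv A v n = z ^ (N - 1 - n) *\<^sub>C s (Suc n)" if n: "n < N" for n
    proof -
      have "conv A v n = (\<Sum>k\<le>n. A k \<cdot> v (n - k))"
        unfolding conv_def by (rule sum.reindex_bij_witness[where i = "\<lambda>k. n - k" and j = "\<lambda>k. n - k"]) auto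
      also have "\<dots> = (\<Sum>k\<le>n. z ^ (N - 1 - n) *\<^sub>C (z ^ k *\<^sub>C A k \<cdot> u))"
      proof (rule sum.cong)
        fix k assume "k \<in> {..n}"
        then have "N - 1 - (n - k) = (N - 1 - n) + k" using n by auto
        then show "A k \<cdot> v (n - k) = z ^ (N - 1 - n) *\<^sub>C (z ^ k *\<^sub>C A k \<cdot> u)"
          by (simp add: v_def cblinfun_scaleC_right scaleC_scaleC power_add)
      qed simp
      finally show ?thesis by (simp add: s_def scaleC_sum_right lessThan_Suc_atMost)
    qed
    then have "(\<Sum>n<N. (norm (conv A v n))\<^sup>2) = (\<Sum>n<N. ((cmod z)\<^sup>2) ^ (N - 1 - n) * (norm (s (Suc n)))\<^sup>2)"
      by (intro sum.cong) (auto simp: norm_scaleC norm_power power_mult_distrib power_mult[symmetric] mult.commute)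
    moreover have "(\<Sum>n<N. (norm (v n))\<^sup>2) = (\<Sum>n<N. ((cmod z)\<^sup>2) ^ (N - 1 - n) * (norm u)\<^sup>2)"
      by (intro sum.cong) (auto simp: v_def norm_scaleC norm_power power_mult_distrib power_mult[symmetric] mult.commute)
    ultimately show "(\<Sum>n<N. ((cmod z)\<^sup>2) ^ (N - 1 - n) * (norm (s (Suc n)))\<^sup>2) \<le>
        (\<Sum>n<N. ((cmod z)\<^sup>2) ^ (N - 1 - n) * (norm u)\<^sup>2)"
      using A[unfolded contr_seq_def, rule_format, of v N] by (simp only:)
  qed
  then show "norm (disc_sum A z \<cdot> u) \<le> 1 * norm u" by (simp add: power2_le_iff_abs_le)
qed simp

lemma contr_seq_schur:
  fixes A :: "nat \<Rightarrow> 'a::complex_hilbert \<Rightarrow>\<^sub>C\<^sub>L 'b::complex_hilbert"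
  assumes "contr_seq A"
  shows "disc_sum A \<in> schur_class"
  using assms by (simp add: schur_class_def analytic_disc_sum contr_seq_disc_summable contr_seq_disc_sum_norm)

lemma schur_class_cong:
  assumes "\<And>z. z \<in> \<DD> \<Longrightarrow> F z = G z" and "F \<in> schur_class"
  shows "G \<in> schur_class"
  using assms analytic_on_disc_cong[of F G] by (auto simp: schur_class_def)

section \<open>Taylor coefficients of Schur class functions\<close>

lemma bounded_linear_cinner_left: "bounded_linear (\<lambda>x. cinner x (y :: 'a::complex_inner))"
proof (rule bounded_linear_intro[where K = "norm y"])
  show "cinner (r *\<^sub>R x) y = r *\<^sub>R cinner x y" for r x
    by (simp add: scaleC_of_real[symmetric] cinner_scaleC_left scaleC_complex_def)
qed (simp_all add: cinner_add_left norm_cinner_le)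

text \<open>The difference of the two series vanishes on the whole disc, whereas a power series with
  a nonzero coefficient has no zeros in some punctured neighbourhood of 0.\<close>

lemma power_series_coeff_unique:
  fixes a b :: "nat \<Rightarrow> complex"
  assumes a: "\<And>z. z \<in> \<DD> \<Longrightarrow> (\<lambda>n. a n * z ^ n) sums f z"
    and b: "\<And>z. z \<in> \<DD> \<Longrightarrow> (\<lambda>n. b n * z ^ n) sums f z"
  shows "a = b"
proof (rule ccontr)
  define c where "c n = a n - b n" for n
  assume "a \<noteq> b"
  then obtain m where m: "c m \<noteq> 0" by (auto simp: c_def fun_eq_iff)
  have c: "(\<lambda>n. c n * z ^ n) sums 0" if "z \<in> \<DD>" for z
    using sums_diff[OF a[OF that] b[OF that]] by (simp add: c_def left_diff_distrib)
  have "(\<lambda>n. c n * 0 ^ n) sums c 0" by (rule powser_sums_zero)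
  then have "c 0 = 0" using c[of 0] by (auto intro: sums_unique2)
  then have "m > 0" using m by (cases m) auto
  then obtain s where s: "0 < s" "\<And>z::complex. z \<in> cball 0 s - {0} \<Longrightarrow> (\<lambda>_. 0::complex) z \<noteq> 0"
    using powser_0_nonzero[of 1 0 c "\<lambda>_. 0" m] c m by auto
  have "complex_of_real s \<in> cball 0 s - {0}" using s(1) by simp
  then show False using s(2) by blast
qed

text \<open>\<open>taylor_coeffs\<close> is a definite description, so a rival sequence has to be
  excluded; this is done on the scalar entries, and pointwise convergence of the rival series is
  enough.\<close>

lemma taylor_coeffs_eqI:
  fixes F :: "complex \<Rightarrow> ('a::complex_hilbert \<Rightarrow>\<^sub>C\<^sub>L 'b::complex_hilbert)"
  assumes A: "disc_summable A" and F: "\<And>z. z \<in> \<DD> \<Longrightarrow> F z = disc_sum A z"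
  shows "taylor_coeffs F = A"
  unfolding taylor_coeffs_def
proof (rule the_equality)
  show A_sums: "\<forall>z\<in>\<DD>. (\<lambda>n. z ^ n *\<^sub>C A n) sums F z" using F disc_sum_sums[OF A] by simp
  fix B assume B_sums: "\<forall>z\<in>\<DD>. (\<lambda>n. z ^ n *\<^sub>C B n) sums F z"
  have entry: "(\<lambda>n. cinner (A n \<cdot> x) y * z ^ n) sums cinner (F z \<cdot> x) y"
    if "\<forall>z\<in>\<DD>. (\<lambda>n. z ^ n *\<^sub>C A n) sums F z" "z \<in> \<DD>" for A x y z
    using bounded_linear.sums[OF bounded_linear_cinner_left[of y]
        bounded_linear.sums[OF cblinfun.bounded_linear_left[of x] bspec[OF that]]]
    by (simp add: cblinfun_scaleC_left cinner_scaleC_left mult.commute)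
  show "B = A"
  proof (rule ext, rule cblinfun_eqI, rule cinner_eqI)
    fix n x y
    have "(\<lambda>n. cinner (B n \<cdot> x) y) = (\<lambda>n. cinner (A n \<cdot> x) y)"
    proof (rule power_series_coeff_unique)
      fix z assume z: "z \<in> \<DD>"
      show "(\<lambda>n. cinner (B n \<cdot> x) y * z ^ n) sums cinner (F z \<cdot> x) y" by (rule entry[OF B_sums z])
      show "(\<lambda>n. cinner (A n \<cdot> x) y * z ^ n) sums cinner (F z \<cdot> x) y" by (rule entry[OF A_sums z])
    qed
    then show "cinner (B n \<cdot> x) y = cinner (A n \<cdot> x) y" by (rule fun_cong)
  qed
qed

text \<open>Scalar Cauchy theory gives the expansion of each entry of \<open>F\<close>. Uniqueness
  of coefficients makes \<open>a n\<close> sesquilinear, Cauchy's inequality makes it bounded, and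
  so it is the form of an operator.\<close>

lemma schur_taylor_exists:
  fixes F :: "complex \<Rightarrow> ('a::complex_hilbert \<Rightarrow>\<^sub>C\<^sub>L 'b::complex_hilbert)"
  assumes F: "F \<in> schur_class"
  obtains A where "\<And>n. norm (A n) \<le> 1" "\<And>z. z \<in> \<DD> \<Longrightarrow> F z = disc_sum A z"
proof -
  define f where "f x y = (\<lambda>z. cinner (F z \<cdot> x) y)" for x y
  define a where "a n x y = (deriv ^^ n) (f x y) 0 / fact n" for n x y
  have bound: "cmod (f x y z) \<le> norm x * norm y" if "z \<in> \<DD>" for x y z
  proof -
    have "norm (F z) \<le> 1" using F that by (simp add: schur_class_def)
    then have "norm (F z \<cdot> x) \<le> 1 * norm x"
      by (intro order_trans[OF norm_cblinfun_apply] mult_right_mono) auto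
    then show ?thesis unfolding f_def
      by (intro order_trans[OF norm_cinner_le] mult_right_mono) auto
  qed
  have hol: "f x y holomorphic_on \<DD>" for x y
  proof (rule holomorphic_onI)
    fix z assume "z \<in> \<DD>"
    then obtain G where "(F has_derivative (\<lambda>h. h *\<^sub>C G)) (at z)"
      using F unfolding schur_class_def analytic_on_disc_def by blast
    then have "(f x y has_derivative (\<lambda>h. cinner ((h *\<^sub>C G) \<cdot> x) y)) (at z)"
      unfolding f_def
      by (intro bounded_linear.has_derivative[OF bounded_linear_cinner_left]
          bounded_linear.has_derivative[OF cblinfun.bounded_linear_left])
    then have "(f x y has_field_derivative cinner (G \<cdot> x) y) (at z)"
      by (simp add: has_field_derivative_def cblinfun_scaleC_left cinner_scaleC_left mult.commute[of _ "cinner (G \<cdot> x) y"])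
    then show "f x y field_differentiable at z within \<DD>"
      using field_differentiable_at_within field_differentiable_def by blast
  qed
  have sums: "(\<lambda>n. a n x y * z ^ n) sums f x y z" if "z \<in> \<DD>" for x y z
    using holomorphic_power_series[OF hol that] by (simp add: a_def)
  \<comment> \<open>Cauchy's inequality on the circle of radius \<open>r\<close> loses the factor
    r^-n, which disappears as \<open>r\<close> tends to 1.\<close>
  have a_le: "cmod (a n x y) \<le> 1 * norm x * norm y" for n x y
  proof (rule tendsto_upperbound)
    show "((\<lambda>r. cmod (a n x y) * r ^ n) \<longlongrightarrow> cmod (a n x y)) (at_left 1)"
      by (rule tendsto_eq_intros refl | simp)+
    have "cmod (a n x y) * r ^ n \<le> 1 * norm x * norm y" if r: "r \<in> {0<..<1}" for r
    proof -
      have sub: "cball 0 r \<subseteq> \<DD>" using r by auto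
      have "norm ((deriv ^^ n) (f x y) 0) \<le> fact n * (norm x * norm y) / r ^ n"
      proof (rule Cauchy_inequality)
        show "f x y holomorphic_on ball 0 r" by (rule holomorphic_on_subset[OF hol]) (use r in auto)
        show "continuous_on (cball 0 r) (f x y)"
          by (rule continuous_on_subset[OF holomorphic_on_imp_continuous_on[OF hol] sub])
        show "norm (f x y z) \<le> norm x * norm y" if "norm (0 - z) = r" for z
          by (rule bound) (use that r in auto)
      qed (use r in auto)
      then show ?thesis using r by (simp add: a_def norm_divide field_simps)
    qed
    then show "\<forall>\<^sub>F r in at_left 1. cmod (a n x y) * r ^ n \<le> 1 * norm x * norm y"
      using eventually_at_left_real[of 0 1] by (auto elim: eventually_mono)
  qed simp
  have "\<exists>A. norm A \<le> 1 \<and> (\<forall>x y. cinner (A \<cdot> x) y = a n x y)" for n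
  proof (rule sesquilinear_form_op[of "a n" 1])
    have uniq: "a n x y = g n" if "\<And>z. z \<in> \<DD> \<Longrightarrow> (\<lambda>n. g n * z ^ n) sums f x y z" for g x y
      by (rule power_series_coeff_unique[OF sums that, THEN fun_cong])
    have f_lin: "f (x + x') y z = f x y z + f x' y z" "f (c *\<^sub>C x) y z = c * f x y z"
      "f x (y + y') z = f x y z + f x y' z" "f x (c *\<^sub>C y) z = cnj c * f x y z" for x x' y y' c z
      by (simp_all add: f_def cblinfun_simps cblinfun_scaleC_right cinner_add_left cinner_add_right
          cinner_scaleC_left cinner_scaleC_right)
    show "a n (x + x') y = a n x y + a n x' y" "a n (c *\<^sub>C x) y = c * a n x y"
      "a n x (y + y') = a n x y + a n x y'" "a n x (c *\<^sub>C y) = cnj c * a n x y" for x x' y y' c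
      by (rule uniq, simp only: f_lin distrib_right mult.assoc, intro sums_add sums_mult sums, assumption+)+
    show "\<exists>A. norm A \<le> 1 \<and> (\<forall>x y. cinner (A \<cdot> x) y = a n x y)"
      if "norm A \<le> 1" "\<And>x y. cinner (A \<cdot> x) y = a n x y" for A
      using that by blast
  qed (simp_all only: a_le zero_le_one)
  then obtain A where A: "\<And>n. norm (A n) \<le> 1" "\<And>n x y. cinner (A n \<cdot> x) y = a n x y"
    using choice[of "\<lambda>n A. norm A \<le> 1 \<and> (\<forall>x y. cinner (A \<cdot> x) y = a n x y)"] by blast
  have "F z = disc_sum A z" if z: "z \<in> \<DD>" for z
  proof (rule cblinfun_eqI, rule cinner_eqI)
    fix x y
    have "(\<lambda>n. z ^ n *\<^sub>C A n) sums disc_sum A z"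
      by (rule disc_sum_sums[OF disc_summable_bounded[OF A(1)] z])
    then have "(\<lambda>n. cinner ((z ^ n *\<^sub>C A n) \<cdot> x) y) sums cinner (disc_sum A z \<cdot> x) y"
      by (intro bounded_linear.sums[OF bounded_linear_cinner_left]
          bounded_linear.sums[OF cblinfun.bounded_linear_left])
    then have "(\<lambda>n. a n x y * z ^ n) sums cinner (disc_sum A z \<cdot> x) y"
      by (simp add: cblinfun_scaleC_left cinner_scaleC_left A(2) mult.commute)
    from sums_unique2[OF this sums[OF z]]
    show "cinner (F z \<cdot> x) y = cinner (disc_sum A z \<cdot> x) y" by (simp add: f_def)
  qed
  with A(1) show thesis by (rule that)
qed

section \<open>A discrete Parseval identity and the contractivity of the coefficients\<close>

lemma cinner_sum_left: "cinner (\<Sum>i\<in>I. f i) (y :: 'a::complex_inner) = (\<Sum>i\<in>I. cinner (f i) y)"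
  by (induction I rule: infinite_finite_induct) (auto simp: cinner_add_left)

lemma cinner_sum_right: "cinner (y :: 'a::complex_inner) (\<Sum>i\<in>I. f i) = (\<Sum>i\<in>I. cinner y (f i))"
  by (induction I rule: infinite_finite_induct) (auto simp: cinner_add_right)

lemma cinner_self: "cinner x x = complex_of_real ((norm (x :: 'a::complex_inner))\<^sup>2)"
proof -
  have "Im (cinner x x) = 0"
    using cinner_commute[of x x] by (simp add: complex_eq_iff)
  then show ?thesis by (simp add: complex_eq_iff Re_cinner power2_norm_eq_inner)
qed

text \<open>A geometric sum with ratio \<open>c\<close>, an m-th root of unity. Since |n - k| < m,
  the ratio is 1 only for \<open>n = k\<close>.\<close>

lemma roots_of_unity_orthogonal:
  fixes m :: nat
  defines "\<omega> \<equiv> exp (2 * of_real pi * \<i> / of_nat m)"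
  assumes "n < m" "k < m"
  shows "(\<Sum>j<m. (\<omega> ^ j) ^ n * cnj ((\<omega> ^ j) ^ k)) = (if n = k then of_nat m else 0)"
proof -
  have m: "m \<ge> 1" using assms by simp
  have \<omega>m: "\<omega> ^ m = 1" using complex_root_unity[of m 1] m by (simp add: \<omega>_def)
  have \<omega>1: "\<omega> ^ j = 1 \<longleftrightarrow> m dvd j" for j
    using complex_root_unity_eq_1[OF m, of j]
    by (simp add: \<omega>_def exp_of_nat_mult[symmetric] mult_ac)
  have "cmod \<omega> = 1" by (simp add: \<omega>_def norm_exp_eq_Re)
  then have \<omega>c: "\<omega> * cnj \<omega> = 1" by (simp add: complex_norm_square[symmetric])
  define c where "c = \<omega> ^ n * cnj \<omega> ^ k"
  have "(\<omega> ^ j) ^ n * cnj ((\<omega> ^ j) ^ k) = c ^ j" for j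
    by (simp add: c_def power_mult_distrib power_mult[symmetric] mult.commute)
  then have eq: "(\<Sum>j<m. (\<omega> ^ j) ^ n * cnj ((\<omega> ^ j) ^ k)) = (\<Sum>j<m. c ^ j)" by simp
  show ?thesis
  proof (cases "n = k")
    case True
    then have "c = 1" by (simp add: c_def power_mult_distrib[symmetric] \<omega>c)
    then show ?thesis unfolding eq using True by simp
  next
    case False
    have "c ^ m = (\<omega> ^ m) ^ n * cnj (\<omega> ^ m) ^ k"
      by (simp add: c_def power_mult_distrib power_mult[symmetric] mult.commute)
    then have "c ^ m = 1" by (simp add: \<omega>m)
    moreover have "c \<noteq> 1"
    proof (cases "n < k")
      case True
      then have "c = (\<omega> * cnj \<omega>) ^ n * cnj \<omega> ^ (k - n)"
        by (simp add: c_def power_mult_distrib mult.assoc power_add[symmetric])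
      then have "c = cnj (\<omega> ^ (k - n))" by (simp add: \<omega>c)
      moreover have "\<not> m dvd (k - n)" using assms True by (auto dest: dvd_imp_le)
      ultimately show ?thesis using \<omega>1[of "k - n"] complex_cnj_cancel_iff[of "\<omega> ^ (k - n)" 1] by (metis complex_cnj_one)
    next
      case nk: False
      then have "c = (\<omega> * cnj \<omega>) ^ k * \<omega> ^ (n - k)"
        by (simp add: c_def power_mult_distrib mult_ac power_add[symmetric])
      moreover have "\<not> m dvd (n - k)" using assms False nk by (auto dest: dvd_imp_le)
      ultimately show ?thesis using \<omega>1[of "n - k"] by (simp add: \<omega>c)
    qed
    ultimately show ?thesis unfolding eq using False by (simp add: geometric_sum)
  qed
qed

lemma roots_of_unity_parseval:
  fixes y :: "nat \<Rightarrow> 'a::complex_inner" and m :: nat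
  defines "\<omega> \<equiv> exp (2 * of_real pi * \<i> / of_nat m)"
  shows "(\<Sum>j<m. (norm (\<Sum>n<m. (\<omega> ^ j) ^ n *\<^sub>C y n))\<^sup>2) = real m * (\<Sum>n<m. (norm (y n))\<^sup>2)"
proof -
  have "complex_of_real (\<Sum>j<m. (norm (\<Sum>n<m. (\<omega> ^ j) ^ n *\<^sub>C y n))\<^sup>2)
      = (\<Sum>j<m. \<Sum>n<m. \<Sum>k<m. (\<omega> ^ j) ^ n * cnj ((\<omega> ^ j) ^ k) * cinner (y n) (y k))"
    unfolding of_real_sum cinner_self[symmetric] cinner_sum_left
    unfolding cinner_sum_right cinner_scaleC_left cinner_scaleC_right by (simp only: mult_ac)
  also have "\<dots> = (\<Sum>n<m. \<Sum>k<m. \<Sum>j<m. (\<omega> ^ j) ^ n * cnj ((\<omega> ^ j) ^ k) * cinner (y n) (y k))"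
    by (subst sum.swap, rule sum.cong[OF refl], rule sum.swap)
  also have "\<dots> = (\<Sum>n<m. \<Sum>k<m. if k = n then of_nat m * cinner (y n) (y n) else 0)"
    unfolding sum_distrib_right[symmetric] \<omega>_def
    by (intro sum.cong refl, subst roots_of_unity_orthogonal) auto
  also have "\<dots> = complex_of_real (real m * (\<Sum>n<m. (norm (y n))\<^sup>2))"
    by (simp add: cinner_self sum_distrib_left)
  finally show ?thesis by (simp only: of_real_eq_iff)
qed

lemma disc_sum_finite_support:
  assumes "\<And>n. n \<ge> N \<Longrightarrow> A n = 0"
  shows "disc_sum A z = (\<Sum>n<N. z ^ n *\<^sub>C A n)"
  unfolding disc_sum_def by (rule suminf_finite) (use assms in auto)

text \<open>Averaging \<open>\<parallel>F(z) \<hat>u(z)\<parallel>\<^sup>2 \<le> \<parallel>\<hat>u(z)\<parallel>\<^sup>2\<close> over \<open>m\<close> equidistant points of the circle of radius \<open>r\<close>, for a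
  polynomial \<open>\<hat>u\<close>, replaces the integral form of Parseval's identity; \<open>m \<rightarrow> \<infinity>\<close> and then \<open>r \<rightarrow> 1\<close>.\<close>

lemma schur_contr_seq:
  fixes A :: "nat \<Rightarrow> 'a::complex_hilbert \<Rightarrow>\<^sub>C\<^sub>L 'b::complex_hilbert"
  assumes A1: "\<And>n. norm (A n) \<le> 1" and contr: "\<And>z. z \<in> \<DD> \<Longrightarrow> norm (disc_sum A z) \<le> 1"
  shows "contr_seq A"
  unfolding contr_seq_def
proof (intro allI)
  fix u0 :: "nat \<Rightarrow> 'a" and N :: nat
  \<comment> \<open>By causality the outputs before \<open>N\<close> do not see the later inputs, so
    nothing is lost and the transform of \<open>u\<close> becomes a polynomial.\<close>
  define u where "u n = (if n < N then u0 n else 0)" for n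
  define y where "y = conv A u"
  define K where "K = (\<Sum>n<N. norm (u n))"
  have K0: "0 \<le> K" by (simp add: K_def sum_nonneg)
  have y_le: "norm (y n) \<le> K" for n
  proof -
    have "norm (y n) \<le> (\<Sum>k\<le>n. norm (u k))"
      unfolding y_def conv_def
    proof (rule sum_norm_le)
      show "norm (A (n - k) \<cdot> u k) \<le> norm (u k)" for k
        using norm_cblinfun_apply[of "A (n - k)" "u k"] mult_right_mono[OF A1[of "n - k"] norm_ge_zero[of "u k"]]
        by simp
    qed
    also have "\<dots> = (\<Sum>k\<in>{..n} \<inter> {..<N}. norm (u k))"
      by (rule sum.mono_neutral_right) (auto simp: u_def)
    also have "\<dots> \<le> K" unfolding K_def by (rule sum_mono2) auto
    finally show ?thesis .
  qed
  have A: "disc_summable A" by (rule disc_summable_bounded[OF A1])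
  have u: "disc_summable u"
  proof (rule disc_summable_bounded[where K = K])
    show "norm (u n) \<le> K" for n
    proof (cases "n < N")
      case True
      then show ?thesis unfolding K_def by (intro member_le_sum) auto
    qed (simp add: u_def K0)
  qed
  have y: "disc_summable y" by (rule disc_summable_bounded[OF y_le])
  have fixed_r: "(\<Sum>n<N. (r ^ n * norm (y n))\<^sup>2) \<le> (\<Sum>n<N. (norm (u n))\<^sup>2)" if r: "0 < r" "r < 1" for r
  proof -
    \<comment> \<open>Bounds the remainder after \<open>m\<close> terms of the series of
      \<open>y\<close> on the circle of radius \<open>r\<close>: the coefficients are at most
      \<open>K\<close>, and the rest is a geometric tail.\<close>
    define \<tau> where "\<tau> m = K * r ^ m / (1 - r)" for m
    have fixed_m: "(\<Sum>n<N. (r ^ n * norm (y n))\<^sup>2) \<le> (\<Sum>n<N. (norm (u n))\<^sup>2) + (2 * K * \<tau> m + (\<tau> m)\<^sup>2)"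
      if m: "m \<ge> N" "m > 0" for m
    proof -
      define \<omega> where "\<omega> = exp (2 * of_real pi * \<i> / of_nat m)"
      have \<omega>1: "cmod \<omega> = 1" by (simp add: \<omega>_def norm_exp_eq_Re)
      define z where "z j = of_real r * \<omega> ^ j" for j
      have cz: "cmod (z j) = r" for j using r by (simp add: z_def norm_mult norm_power \<omega>1)
      then have zD: "z j \<in> \<DD>" for j using r by simp
      have \<tau>0: "0 \<le> \<tau> m" using r K0 by (simp add: \<tau>_def)
      define p where "p j = (\<Sum>n<m. z j ^ n *\<^sub>C y n)" for j
      define q where "q j = (\<Sum>n<m. z j ^ n *\<^sub>C u n)" for j
      have q: "disc_sum u (z j) = q j" for j
        unfolding q_def by (rule disc_sum_finite_support) (use m in \<open>auto simp: u_def\<close>)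
      have q_le: "norm (q j) \<le> K" for j
      proof -
        have "q j = (\<Sum>n<N. z j ^ n *\<^sub>C u n)"
          unfolding q_def by (rule sum.mono_neutral_right) (use m in \<open>auto simp: u_def\<close>)
        also have "norm \<dots> \<le> K"
          unfolding K_def
        proof (rule sum_norm_le)
          show "norm (z j ^ n *\<^sub>C u n) \<le> norm (u n)" for n
            using r by (simp add: norm_scaleC norm_power cz mult_left_le_one_le power_le_one)
        qed
        finally show ?thesis .
      qed
      have g_le: "norm (disc_sum y (z j)) \<le> norm (q j)" for j
      proof -
        have "disc_sum y (z j) = disc_sum A (z j) \<cdot> q j"
          unfolding y_def q[symmetric] by (rule disc_sum_conv[OF A u zD])
        then show ?thesis
          using norm_cblinfun_apply[of "disc_sum A (z j)" "q j"]
            mult_right_mono[OF contr[OF zD[of j]] norm_ge_zero[of "q j"]] by simp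
      qed
      have tail: "norm (disc_sum y (z j) - p j) \<le> \<tau> m" for j
      proof -
        have sm: "summable (\<lambda>n. norm (z j ^ (n + m) *\<^sub>C y (n + m)))"
          by (rule summable_ignore_initial_segment[OF disc_summable_norm[OF y zD]])
        have gm: "(\<lambda>n. r ^ n * (r ^ m * K)) sums (1 / (1 - r) * (r ^ m * K))"
          by (intro sums_mult2 geometric_sums) (use r in auto)
        have "disc_sum y (z j) - p j = (\<Sum>n. z j ^ (n + m) *\<^sub>C y (n + m))"
          unfolding disc_sum_def p_def
          by (rule suminf_minus_initial_segment[symmetric, OF sums_summable[OF disc_sum_sums[OF y zD]]])
        then have "norm (disc_sum y (z j) - p j) \<le> (\<Sum>n. norm (z j ^ (n + m) *\<^sub>C y (n + m)))"
          using summable_norm[OF sm] by simp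
        also have "\<dots> \<le> (\<Sum>n. r ^ n * (r ^ m * K))"
        proof (rule suminf_le[OF _ sm sums_summable[OF gm]])
          show "norm (z j ^ (n + m) *\<^sub>C y (n + m)) \<le> r ^ n * (r ^ m * K)" for n
            using r y_le by (simp add: norm_scaleC norm_mult norm_power cz power_add mult.assoc mult_left_mono)
        qed
        also have "\<dots> = \<tau> m" using sums_unique[OF gm] by (simp add: \<tau>_def mult.commute)
        finally show ?thesis .
      qed
      have p_le: "(norm (p j))\<^sup>2 \<le> (norm (q j))\<^sup>2 + (2 * K * \<tau> m + (\<tau> m)\<^sup>2)" for j
      proof -
        have "norm (p j) \<le> norm (q j) + \<tau> m"
          using norm_triangle_sub[of "p j" "disc_sum y (z j)"] tail[of j] g_le[of j]
          by (simp add: norm_minus_commute)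
        then have "(norm (p j))\<^sup>2 \<le> (norm (q j) + \<tau> m)\<^sup>2" by (rule power_mono) simp
        also have "\<dots> = (norm (q j))\<^sup>2 + (2 * norm (q j) * \<tau> m + (\<tau> m)\<^sup>2)"
          by (simp add: power2_sum)
        also have "\<dots> \<le> (norm (q j))\<^sup>2 + (2 * K * \<tau> m + (\<tau> m)\<^sup>2)"
          using mult_right_mono[OF q_le[of j] \<tau>0] by simp
        finally show ?thesis .
      qed
      have pars: "(\<Sum>j<m. (norm (\<Sum>n<m. z j ^ n *\<^sub>C x n))\<^sup>2) = real m * (\<Sum>n<m. (r ^ n * norm (x n))\<^sup>2)"
        for x :: "nat \<Rightarrow> 'c::complex_inner"
        using roots_of_unity_parseval[where m = m and y = "\<lambda>n. of_real (r ^ n) *\<^sub>C x n"] r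
        unfolding \<omega>_def[symmetric]
        by (simp add: z_def power_mult_distrib scaleC_scaleC norm_scaleC norm_power mult.commute)
      have "real m * (\<Sum>n<m. (r ^ n * norm (y n))\<^sup>2) = (\<Sum>j<m. (norm (p j))\<^sup>2)"
        unfolding p_def by (rule pars[symmetric])
      also have "\<dots> \<le> (\<Sum>j<m. (norm (q j))\<^sup>2 + (2 * K * \<tau> m + (\<tau> m)\<^sup>2))"
        by (rule sum_mono[OF p_le])
      also have "\<dots> = real m * ((\<Sum>n<m. (r ^ n * norm (u n))\<^sup>2) + (2 * K * \<tau> m + (\<tau> m)\<^sup>2))"
        unfolding sum.distrib q_def pars by (simp add: distrib_left)
      finally have "(\<Sum>n<m. (r ^ n * norm (y n))\<^sup>2) \<le> (\<Sum>n<m. (r ^ n * norm (u n))\<^sup>2) + (2 * K * \<tau> m + (\<tau> m)\<^sup>2)"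
        using m(2) by (simp only: mult_le_cancel_left_pos of_nat_0_less_iff)
      moreover have "(\<Sum>n<N. (r ^ n * norm (y n))\<^sup>2) \<le> (\<Sum>n<m. (r ^ n * norm (y n))\<^sup>2)"
        using m by (intro sum_mono2) auto
      moreover have "(\<Sum>n<m. (r ^ n * norm (u n))\<^sup>2) = (\<Sum>n<N. (r ^ n * norm (u n))\<^sup>2)"
        by (rule sum.mono_neutral_right) (use m in \<open>auto simp: u_def\<close>)
      moreover have "(\<Sum>n<N. (r ^ n * norm (u n))\<^sup>2) \<le> (\<Sum>n<N. (norm (u n))\<^sup>2)"
        using r by (intro sum_mono power_mono) (auto simp: mult_left_le_one_le power_le_one)
      ultimately show ?thesis by linarith
    qed
    have "\<tau> \<longlonglongrightarrow> K * 0 / (1 - r)"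
      unfolding \<tau>_def by (intro tendsto_intros LIMSEQ_realpow_zero) (use r in auto)
    then have \<tau>0: "\<tau> \<longlonglongrightarrow> 0" by simp
    have "(\<lambda>m. (\<Sum>n<N. (norm (u n))\<^sup>2) + (2 * K * \<tau> m + (\<tau> m)\<^sup>2)) \<longlonglongrightarrow>
        (\<Sum>n<N. (norm (u n))\<^sup>2) + (2 * K * 0 + 0\<^sup>2)"
      by (intro tendsto_intros \<tau>0)
    then have "(\<Sum>n<N. (r ^ n * norm (y n))\<^sup>2) \<le> (\<Sum>n<N. (norm (u n))\<^sup>2) + (2 * K * 0 + 0\<^sup>2)"
      by (rule LIMSEQ_le_const) (use fixed_m in \<open>auto intro!: exI[of _ "Suc N"]\<close>)
    then show ?thesis by simp
  qed
  have "(\<Sum>n<N. (norm (y n))\<^sup>2) \<le> (\<Sum>n<N. (norm (u n))\<^sup>2)"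
  proof (rule tendsto_upperbound)
    have "((\<lambda>r. \<Sum>n<N. (r ^ n * norm (y n))\<^sup>2) \<longlongrightarrow> (\<Sum>n<N. (1 ^ n * norm (y n))\<^sup>2)) (at_left (1::real))"
      by (intro tendsto_intros)
    then show "((\<lambda>r. \<Sum>n<N. (r ^ n * norm (y n))\<^sup>2) \<longlongrightarrow> (\<Sum>n<N. (norm (y n))\<^sup>2)) (at_left (1::real))"
      by simp
    show "\<forall>\<^sub>F r in at_left 1. (\<Sum>n<N. (r ^ n * norm (y n))\<^sup>2) \<le> (\<Sum>n<N. (norm (u n))\<^sup>2)"
      using eventually_at_left_real[of 0 1] fixed_r by (auto elim: eventually_mono)
  qed simp
  moreover have "conv A u0 n = y n" if "n < N" for n
    unfolding y_def using that by (intro conv_cong) (simp add: u_def)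
  ultimately show "(\<Sum>n<N. (norm (conv A u0 n))\<^sup>2) \<le> (\<Sum>n<N. (norm (u0 n))\<^sup>2)"
    by (simp add: u_def)
qed

text \<open>The passage between functions and coefficients: averages over circles give one
  direction, geometric inputs the other. The interpolation problem is then treated on the
  coefficient side.\<close>

lemma schur_class_iff_contr_seq:
  fixes F :: "complex \<Rightarrow> ('a::complex_hilbert \<Rightarrow>\<^sub>C\<^sub>L 'b::complex_hilbert)"
  shows "F \<in> schur_class \<longleftrightarrow> (\<exists>A. contr_seq A \<and> (\<forall>z\<in>\<DD>. F z = disc_sum A z))"
proof
  assume F: "F \<in> schur_class"
  obtain A where A: "\<And>n. norm (A n) \<le> 1" "\<And>z. z \<in> \<DD> \<Longrightarrow> F z = disc_sum A z"
    using schur_taylor_exists[OF F] by blast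
  have "contr_seq A"
    using A F by (intro schur_contr_seq) (auto simp: schur_class_def)
  then show "\<exists>A. contr_seq A \<and> (\<forall>z\<in>\<DD>. F z = disc_sum A z)" using A by blast
next
  assume "\<exists>A. contr_seq A \<and> (\<forall>z\<in>\<DD>. F z = disc_sum A z)"
  then obtain A where "contr_seq A" "\<And>z. z \<in> \<DD> \<Longrightarrow> disc_sum A z = F z" by auto
  then show "F \<in> schur_class" using schur_class_cong[OF _ contr_seq_schur] by blast
qed

section \<open>The data operators\<close>

text \<open>A sequence is its zeroth entry plus the forward shift of its backward shift, and
  \<open>W\<close> turns the forward shift into \<open>Z\<close>.\<close>

lemma intertwine_split:
  assumes "Z \<circ>\<^sub>C W = W \<circ>\<^sub>C shift_op"
  shows "W \<cdot> x = W \<cdot> embed_op \<cdot> ell2_nth x 0 + Z \<cdot> W \<cdot> shift_op\<^sup>\<dagger> \<cdot> x"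
proof -
  have "x = embed_op \<cdot> ell2_nth x 0 + shift_op \<cdot> shift_op\<^sup>\<dagger> \<cdot> x"
    by (rule ell2_eqI) (simp add: ell2_nth_embed ell2_nth_shift ell2_nth_adj_shift split: nat.split)
  then have "W \<cdot> x = W \<cdot> embed_op \<cdot> ell2_nth x 0 + W \<cdot> shift_op \<cdot> shift_op\<^sup>\<dagger> \<cdot> x"
    by (metis cblinfun.add_right)
  then show ?thesis using assms by (metis cblinfun_compose_apply)
qed

lemma intertwine_adj:
  assumes "Z \<circ>\<^sub>C W = W \<circ>\<^sub>C shift_op"
  shows "shift_op\<^sup>\<dagger> \<cdot> W\<^sup>\<dagger> \<cdot> h = W\<^sup>\<dagger> \<cdot> Z\<^sup>\<dagger> \<cdot> h"
  by (rule ell2_eqI)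
    (simp add: ell2_nth_adj_shift ell2_nth_intertwine_adj[OF assms] op_pow_apply funpow_swap1)

text \<open>\<open>intertwine_split\<close> at \<open>W\<^sup>\<dagger> \<cdot> h\<close>.
  Subtracting the instances for \<open>W\<close> and \<open>Wt\<close> gives the Stein equation for
  \<Lambda>.\<close>

lemma intertwine_stein:
  assumes "Z \<circ>\<^sub>C W = W \<circ>\<^sub>C shift_op"
  shows "W \<cdot> W\<^sup>\<dagger> \<cdot> h = (W \<circ>\<^sub>C embed_op) \<cdot> (W \<circ>\<^sub>C embed_op)\<^sup>\<dagger> \<cdot> h + Z \<cdot> W \<cdot> W\<^sup>\<dagger> \<cdot> Z\<^sup>\<dagger> \<cdot> h"
  using intertwine_split[OF assms, of "W\<^sup>\<dagger> \<cdot> h"]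
  by (simp add: ell2_nth_intertwine_adj[OF assms] intertwine_adj[OF assms])

text \<open>Powers of \<open>Z\<^sup>\<dagger>\<close> shift the output sequence of
  \<open>h\<close>, so the norms are tails of one convergent series. Stability and power boundedness
  both rest on this.\<close>

lemma norm_intertwine_adj_pow:
  assumes "Z \<circ>\<^sub>C W = W \<circ>\<^sub>C shift_op"
  shows "(norm (W\<^sup>\<dagger> \<cdot> op_pow (Z\<^sup>\<dagger>) n \<cdot> h))\<^sup>2 = (\<Sum>k. (norm (ell2_nth (W\<^sup>\<dagger> \<cdot> h) (k + n)))\<^sup>2)"
  unfolding norm_ell2_sq ell2_nth_intertwine_adj[OF assms]
  by (simp add: op_pow_apply funpow_add)

lemma inner_WW_adj: "inner (W \<cdot> W\<^sup>\<dagger> \<cdot> h) h = (norm (W\<^sup>\<dagger> \<cdot> h))\<^sup>2"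
  by (simp add: inner_adj_right power2_norm_eq_inner)

lemma self_adj_WW: "(W \<circ>\<^sub>C W\<^sup>\<dagger>)\<^sup>\<dagger> = W \<circ>\<^sub>C W\<^sup>\<dagger>"
proof (rule adj_eqI)
  show "inner ((W \<circ>\<^sub>C W\<^sup>\<dagger>) \<cdot> x) y = inner x ((W \<circ>\<^sub>C W\<^sup>\<dagger>) \<cdot> y)" for x y
    using inner_adj_right[of W "W\<^sup>\<dagger> \<cdot> x" y] inner_adj_left[of W x "W\<^sup>\<dagger> \<cdot> y"] by simp
qed

locale ltonp =
  fixes Z :: "'z::complex_hilbert \<Rightarrow>\<^sub>C\<^sub>L 'z"
    and W :: "'y::complex_hilbert ell2 \<Rightarrow>\<^sub>C\<^sub>L 'z"
    and Wt :: "'u::complex_hilbert ell2 \<Rightarrow>\<^sub>C\<^sub>L 'z"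
    and P \<Lambda> :: "'z \<Rightarrow>\<^sub>C\<^sub>L 'z"
    and B :: "'y \<Rightarrow>\<^sub>C\<^sub>L 'z" and Bt :: "'u \<Rightarrow>\<^sub>C\<^sub>L 'z"
  assumes ZW: "Z \<circ>\<^sub>C W = W \<circ>\<^sub>C shift_op" and ZWt: "Z \<circ>\<^sub>C Wt = Wt \<circ>\<^sub>C shift_op"
    and P_def: "P = W \<circ>\<^sub>C W\<^sup>\<dagger>"
    and Lambda_def: "\<Lambda> = W \<circ>\<^sub>C W\<^sup>\<dagger> - Wt \<circ>\<^sub>C Wt\<^sup>\<dagger>"
    and Lambda_pos: "strictly_positive \<Lambda>"
    and B_def: "B = W \<circ>\<^sub>C embed_op"
    and Bt_def: "Bt = Wt \<circ>\<^sub>C embed_op"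
begin

lemma Lambda_adj: "\<Lambda>\<^sup>\<dagger> = \<Lambda>"
  by (rule strictly_positive_adj[OF Lambda_pos])

lemma P_adj: "P\<^sup>\<dagger> = P"
  unfolding P_def by (rule self_adj_WW)

lemma inner_P: "inner (P \<cdot> h) h = inner (\<Lambda> \<cdot> h) h + (norm (Wt\<^sup>\<dagger> \<cdot> h))\<^sup>2"
  by (simp add: P_def Lambda_def cblinfun_simps inner_diff_left inner_WW_adj)

lemma P_pos: "strictly_positive P"
proof -
  obtain c where c: "c > 0" "\<And>h. c * (norm h)\<^sup>2 \<le> inner (\<Lambda> \<cdot> h) h"
    using strictly_positive_coercive[OF Lambda_pos] by blast
  have "c * (norm h)\<^sup>2 \<le> inner (P \<cdot> h) h" for h
    unfolding inner_P using c(2)[of h] by (simp add: add_increasing2)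
  then show ?thesis by (rule strictly_positiveI[OF P_adj c(1)])
qed

abbreviation "iL \<equiv> op_inv \<Lambda>"
abbreviation "iP \<equiv> op_inv P"

lemma Lambda_inv [simp]: "\<Lambda> \<cdot> iL \<cdot> x = x" "iL \<cdot> \<Lambda> \<cdot> x = x"
  using strictly_positive_inverse(1,2)[OF Lambda_pos]
  by (metis cblinfun_compose_apply id_cblinfun_apply)+

lemma P_inv [simp]: "P \<cdot> iP \<cdot> x = x" "iP \<cdot> P \<cdot> x = x"
  using strictly_positive_inverse(1,2)[OF P_pos]
  by (metis cblinfun_compose_apply id_cblinfun_apply)+

lemma Lambda_inv_adj: "iL\<^sup>\<dagger> = iL"
  by (rule strictly_positive_adj[OF strictly_positive_inverse(3)[OF Lambda_pos]])

lemma P_inv_adj: "iP\<^sup>\<dagger> = iP"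
  by (rule strictly_positive_adj[OF strictly_positive_inverse(3)[OF P_pos]])

text \<open>Expanding the form of \<Lambda> at \<open>d = iL \<cdot> h - iP \<cdot> h\<close> and
  replacing \<Lambda> by the larger P in the last term leaves exactly the form of
  \<open>iL - iP\<close> at \<open>h\<close>.\<close>

lemma nonneg_inv_diff: "nonneg_op (iL - iP)"
proof (rule nonneg_opI)
  show "(iL - iP)\<^sup>\<dagger> = iL - iP"
    by (rule adj_eqI)
      (simp add: cblinfun_simps inner_diff_left inner_diff_right inner_selfadj[OF Lambda_inv_adj]
        inner_selfadj[OF P_inv_adj])
  fix h
  define b where "b = iP \<cdot> h"
  define d where "d = iL \<cdot> h - b"
  have "0 \<le> inner (\<Lambda> \<cdot> d) d"
    using Lambda_pos by (simp add: strictly_positive_def nonneg_op_inner)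
  also have "\<Lambda> \<cdot> d = h - \<Lambda> \<cdot> b" by (simp add: d_def cblinfun_simps)
  also have "inner (h - \<Lambda> \<cdot> b) d = inner h (iL \<cdot> h) - 2 * inner h b + inner (\<Lambda> \<cdot> b) b"
    using inner_selfadj[OF Lambda_adj, of b "iL \<cdot> h"]
    by (simp add: d_def inner_diff_left inner_diff_right inner_commute[of b h])
  also have "inner (\<Lambda> \<cdot> b) b \<le> inner (P \<cdot> b) b" by (simp add: inner_P)
  also have "inner (P \<cdot> b) b = inner h b" by (simp add: b_def)
  finally have "0 \<le> inner h (iL \<cdot> h) - inner h b" by simp
  then show "0 \<le> inner ((iL - iP) \<cdot> h) h"
    unfolding inner_commute[of _ h] by (simp add: b_def cblinfun_simps inner_diff_right)
qed

lemma stein_Lambda: "Z \<cdot> \<Lambda> \<cdot> Z\<^sup>\<dagger> \<cdot> h = \<Lambda> \<cdot> h - B \<cdot> B\<^sup>\<dagger> \<cdot> h + Bt \<cdot> Bt\<^sup>\<dagger> \<cdot> h"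
  using intertwine_stein[OF ZW, of h] intertwine_stein[OF ZWt, of h]
  by (simp add: Lambda_def B_def Bt_def cblinfun_simps)

text \<open>The lower bound of P controls the norm of
  \<open>op_pow (Z\<^sup>\<dagger>) n \<cdot> h\<close> by its image under
  \<open>W\<^sup>\<dagger>\<close>, which is a vanishing tail.\<close>

lemma pow_stable: "(\<lambda>n. op_pow (Z\<^sup>\<dagger>) n \<cdot> h) \<longlonglongrightarrow> 0"
proof -
  obtain c where c: "c > 0" "\<And>h. c * (norm h)\<^sup>2 \<le> inner (P \<cdot> h) h"
    using strictly_positive_coercive[OF P_pos] by blast
  define t where "t n = (\<Sum>k. (norm (ell2_nth (W\<^sup>\<dagger> \<cdot> h) (k + n)))\<^sup>2)" for n
  have "(\<lambda>n. (norm (W\<^sup>\<dagger> \<cdot> h))\<^sup>2 - (\<Sum>k<n. (norm (ell2_nth (W\<^sup>\<dagger> \<cdot> h) k))\<^sup>2)) \<longlonglongrightarrow>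
      (norm (W\<^sup>\<dagger> \<cdot> h))\<^sup>2 - (norm (W\<^sup>\<dagger> \<cdot> h))\<^sup>2"
    unfolding norm_ell2_sq by (intro tendsto_diff tendsto_const summable_LIMSEQ summable_ell2)
  then have t0: "t \<longlonglongrightarrow> 0"
    unfolding t_def norm_ell2_sq by (simp add: suminf_minus_initial_segment[OF summable_ell2])
  have le: "(norm (op_pow (Z\<^sup>\<dagger>) n \<cdot> h))\<^sup>2 \<le> t n / c" for n
    using c(2)[of "op_pow (Z\<^sup>\<dagger>) n \<cdot> h"] c(1) norm_intertwine_adj_pow[OF ZW, of n h]
    by (simp add: P_def inner_WW_adj t_def field_simps)
  have lim: "(\<lambda>n. t n / c) \<longlonglongrightarrow> 0" using tendsto_divide[OF t0 tendsto_const[of c]] c(1) by simp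
  have "(\<lambda>n. (norm (op_pow (Z\<^sup>\<dagger>) n \<cdot> h))\<^sup>2) \<longlonglongrightarrow> 0"
    by (rule Lim_null_comparison[OF _ lim]) (simp add: le)
  then have "(\<lambda>n. sqrt ((norm (op_pow (Z\<^sup>\<dagger>) n \<cdot> h))\<^sup>2)) \<longlonglongrightarrow> sqrt 0" by (rule tendsto_real_sqrt)
  then show ?thesis by (simp add: tendsto_norm_zero_iff)
qed

text \<open>Makes the Neumann series of the resolvent of \<open>Z\<^sup>\<dagger>\<close> converge
  on the whole disc, and thereby bounds the spectral radius.\<close>

lemma pow_bounded: obtains K where "\<And>n. norm (op_pow (Z\<^sup>\<dagger>) n) \<le> K"
proof -
  obtain c where c: "c > 0" "\<And>h. c * (norm h)\<^sup>2 \<le> inner (P \<cdot> h) h"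
    using strictly_positive_coercive[OF P_pos] by blast
  have "norm (op_pow (Z\<^sup>\<dagger>) n) \<le> norm (W\<^sup>\<dagger>) / sqrt c" for n
  proof (rule norm_cblinfun_bound)
    fix h
    have "c * (norm (op_pow (Z\<^sup>\<dagger>) n \<cdot> h))\<^sup>2 \<le> (norm (W\<^sup>\<dagger> \<cdot> op_pow (Z\<^sup>\<dagger>) n \<cdot> h))\<^sup>2"
      using c(2)[of "op_pow (Z\<^sup>\<dagger>) n \<cdot> h"] by (simp add: P_def inner_WW_adj)
    also have "\<dots> \<le> (norm (W\<^sup>\<dagger> \<cdot> h))\<^sup>2"
      unfolding norm_intertwine_adj_pow[OF ZW] norm_ell2_sq[of "W\<^sup>\<dagger> \<cdot> h"]
      by (simp add: suminf_minus_initial_segment[OF summable_ell2] sum_nonneg)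
    also have "\<dots> \<le> (norm (W\<^sup>\<dagger>) * norm h)\<^sup>2" by (rule power_mono[OF norm_cblinfun_apply]) simp
    finally have "(sqrt c * norm (op_pow (Z\<^sup>\<dagger>) n \<cdot> h))\<^sup>2 \<le> (norm (W\<^sup>\<dagger>) * norm h)\<^sup>2"
      using c(1) by (simp add: power_mult_distrib)
    then have "sqrt c * norm (op_pow (Z\<^sup>\<dagger>) n \<cdot> h) \<le> norm (W\<^sup>\<dagger>) * norm h"
      by (rule power2_le_imp_le) simp
    then show "norm (op_pow (Z\<^sup>\<dagger>) n \<cdot> h) \<le> norm (W\<^sup>\<dagger>) / sqrt c * norm h"
      using c(1) by (simp add: field_simps)
  qed (use c(1) in simp)
  then show thesis by (rule that)
qed

lemma pow_disc_summable: "disc_summable (op_pow (Z\<^sup>\<dagger>))"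
proof -
  obtain K where "\<And>n. norm (op_pow (Z\<^sup>\<dagger>) n) \<le> K" using pow_bounded by blast
  then show ?thesis by (rule disc_summable_bounded)
qed

lemma resolvent_inverse:
  assumes z: "z \<in> \<DD>"
  defines "S \<equiv> disc_sum (op_pow (Z\<^sup>\<dagger>)) z"
  shows "S \<circ>\<^sub>C (id_cblinfun - z *\<^sub>C Z\<^sup>\<dagger>) = id_cblinfun" "(id_cblinfun - z *\<^sub>C Z\<^sup>\<dagger>) \<circ>\<^sub>C S = id_cblinfun"
proof -
  have Suc1: "(\<lambda>n. op_pow (Z\<^sup>\<dagger>) (Suc n)) = oconv (impulse (Z\<^sup>\<dagger>)) (op_pow (Z\<^sup>\<dagger>))" by simp
  have Suc2: "(\<lambda>n. op_pow (Z\<^sup>\<dagger>) (Suc n)) = oconv (op_pow (Z\<^sup>\<dagger>)) (impulse (Z\<^sup>\<dagger>))"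
    unfolding op_pow_Suc_right by (simp add: fun_eq_iff)
  have sm: "disc_summable (\<lambda>n. op_pow (Z\<^sup>\<dagger>) (Suc n))"
    unfolding Suc1 by (intro disc_summable_oconv disc_summable_impulse pow_disc_summable)
  have S1: "S = id_cblinfun + z *\<^sub>C (Z\<^sup>\<dagger> \<circ>\<^sub>C S)"
    using disc_sum_Suc[OF sm z] disc_sum_oconv[OF disc_summable_impulse[of "Z\<^sup>\<dagger>"] pow_disc_summable z]
    unfolding Suc1[symmetric] S_def by simp
  have S2: "S = id_cblinfun + z *\<^sub>C (S \<circ>\<^sub>C Z\<^sup>\<dagger>)"
    using disc_sum_Suc[OF sm z] disc_sum_oconv[OF pow_disc_summable disc_summable_impulse[of "Z\<^sup>\<dagger>"] z]
    unfolding Suc2[symmetric] S_def by simp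
  show "S \<circ>\<^sub>C (id_cblinfun - z *\<^sub>C Z\<^sup>\<dagger>) = id_cblinfun"
    using S2 by (simp add: cblinfun_compose.diff_right cblinfun_compose_scaleC algebra_simps)
  show "(id_cblinfun - z *\<^sub>C Z\<^sup>\<dagger>) \<circ>\<^sub>C S = id_cblinfun"
    using S1 by (simp add: cblinfun_compose.diff_left cblinfun_compose_scaleC algebra_simps)
qed

lemma spectral_radius_le: "op_spectral_radius (Z\<^sup>\<dagger>) \<le> 1"
  unfolding op_spectral_radius_def
proof (rule cSup_least)
  have "cmod \<mu> \<le> 1" if "\<mu> \<in> op_spectrum (Z\<^sup>\<dagger>)" for \<mu>
  proof (rule ccontr)
    assume "\<not> cmod \<mu> \<le> 1"
    then have \<mu>: "cmod \<mu> > 1" "\<mu> \<noteq> 0" by auto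
    define z where "z = inverse \<mu>"
    have z: "z \<in> \<DD>" using \<mu> by (simp add: z_def norm_inverse inverse_less_1_iff)
    define S where "S = disc_sum (op_pow (Z\<^sup>\<dagger>)) z"
    note inv = resolvent_inverse[OF z, folded S_def]
    have eq: "\<mu> *\<^sub>C id_cblinfun - Z\<^sup>\<dagger> = \<mu> *\<^sub>C (id_cblinfun - z *\<^sub>C Z\<^sup>\<dagger>)"
      using \<mu> by (simp add: z_def scaleC_diff_right scaleC_scaleC)
    have "op_invertible (\<mu> *\<^sub>C id_cblinfun - Z\<^sup>\<dagger>)"
    proof (rule op_invertibleI)
      show "(z *\<^sub>C S) \<circ>\<^sub>C (\<mu> *\<^sub>C id_cblinfun - Z\<^sup>\<dagger>) = id_cblinfun"
        "(\<mu> *\<^sub>C id_cblinfun - Z\<^sup>\<dagger>) \<circ>\<^sub>C (z *\<^sub>C S) = id_cblinfun"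
        unfolding eq cblinfun_compose_scaleC inv using \<mu> by (simp_all add: z_def scaleC_scaleC)
    qed
    then show False using that by (simp add: op_spectrum_def)
  qed
  then show "x \<le> 1" if "x \<in> insert 0 (cmod ` op_spectrum (Z\<^sup>\<dagger>))" for x using that by auto
qed simp

lemma telescope:
  assumes "\<And>n. \<Lambda> \<cdot> x n = Z \<cdot> \<Lambda> \<cdot> x (Suc n) + B \<cdot> y n - Bt \<cdot> u n"
  shows "(\<Sum>n<N. op_pow Z n \<cdot> (B \<cdot> y n - Bt \<cdot> u n)) = \<Lambda> \<cdot> x 0 - op_pow Z N \<cdot> \<Lambda> \<cdot> x N"
proof (induction N)
  case (Suc N)
  have "B \<cdot> y N - Bt \<cdot> u N = \<Lambda> \<cdot> x N - Z \<cdot> \<Lambda> \<cdot> x (Suc N)"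
    using assms[of N] by simp
  then have "op_pow Z N \<cdot> (B \<cdot> y N - Bt \<cdot> u N) = op_pow Z N \<cdot> \<Lambda> \<cdot> x N - op_pow Z (Suc N) \<cdot> \<Lambda> \<cdot> x (Suc N)"
    unfolding op_pow_Suc_right by (simp only: cblinfun.diff_right cblinfun_compose_apply)
  then show ?case using Suc by simp
qed simp

text \<open>Pointwise stability is available only for \<open>Z\<^sup>\<dagger>\<close>; moving the
  power to the other side of the inner product makes the convergence weak, but uniform in bounded
  \<open>x n\<close>.\<close>

lemma pow_weakly_null:
  assumes "\<And>n. norm (x n) \<le> K"
  shows "(\<lambda>n. cinner (op_pow Z n \<cdot> x n) h) \<longlonglongrightarrow> 0"
proof (rule Lim_null_comparison)
  have "(\<lambda>n. K * norm (op_pow (Z\<^sup>\<dagger>) n \<cdot> h)) \<longlonglongrightarrow> K * norm (0 :: 'z)"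
    by (intro tendsto_intros pow_stable)
  then show "(\<lambda>n. K * norm (op_pow (Z\<^sup>\<dagger>) n \<cdot> h)) \<longlonglongrightarrow> 0" by simp
  have "norm (cinner (op_pow Z n \<cdot> x n) h) \<le> K * norm (op_pow (Z\<^sup>\<dagger>) n \<cdot> h)" for n
    unfolding cinner_op_pow
    by (rule order_trans[OF norm_cinner_le]) (simp add: assms mult_right_mono)
  then show "\<forall>\<^sub>F n in sequentially. norm (cinner (op_pow Z n \<cdot> x n) h) \<le> K * norm (op_pow (Z\<^sup>\<dagger>) n \<cdot> h)"
    by simp
qed

end

section \<open>The transfer system\<close>

lemma block_op_apply:
  "block_op A B C D \<cdot> x = (A \<cdot> fst x + B \<cdot> snd x, C \<cdot> fst x + D \<cdot> snd x)"
  by (simp add: cblinfun_apply_def block_op.rep_eq bounded_linear_Blinfun_apply[OF bounded_linear_block])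

locale ltonp_system = ltonp Z W Wt P \<Lambda> B Bt
  for Z :: "'z::complex_hilbert \<Rightarrow>\<^sub>C\<^sub>L 'z" and W Wt P \<Lambda>
    and B :: "'y::complex_hilbert \<Rightarrow>\<^sub>C\<^sub>L 'z" and Bt :: "'u::complex_hilbert \<Rightarrow>\<^sub>C\<^sub>L 'z" +
  fixes C :: "'z \<Rightarrow>\<^sub>C\<^sub>L 'e::complex_hilbert" and D :: "'y \<Rightarrow>\<^sub>C\<^sub>L 'e"
    and Q :: "'e \<Rightarrow>\<^sub>C\<^sub>L 'e" and R :: "'u \<Rightarrow>\<^sub>C\<^sub>L 'u"
  assumes adm: "admissible_pair Z W C D"
    and Q_def: "Q = op_inv (op_sqrt
      (id_cblinfun + C \<circ>\<^sub>C P \<circ>\<^sub>C (op_inv \<Lambda> - op_inv P) \<circ>\<^sub>C P \<circ>\<^sub>C C\<^sup>\<dagger>))"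
    and R_def: "R = op_inv (op_sqrt (id_cblinfun + Bt\<^sup>\<dagger> \<circ>\<^sub>C op_inv \<Lambda> \<circ>\<^sub>C Bt))"
begin

text \<open>Entries of the two block identities: \<open>adm1\<close> to \<open>adm3\<close> come
  from the one with P, \<open>adm4\<close> to \<open>adm7\<close> from the one with its
  inverse.\<close>

lemma
  shows adm1: "D \<cdot> D\<^sup>\<dagger> \<cdot> e + C \<cdot> P \<cdot> C\<^sup>\<dagger> \<cdot> e = e"
    and adm2: "D \<cdot> B\<^sup>\<dagger> \<cdot> z + C \<cdot> P \<cdot> Z\<^sup>\<dagger> \<cdot> z = 0"
    and adm3: "B \<cdot> D\<^sup>\<dagger> \<cdot> e + Z \<cdot> P \<cdot> C\<^sup>\<dagger> \<cdot> e = 0"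
    and adm4: "D\<^sup>\<dagger> \<cdot> D \<cdot> y + B\<^sup>\<dagger> \<cdot> iP \<cdot> B \<cdot> y = y"
    and adm5: "D\<^sup>\<dagger> \<cdot> C \<cdot> z + B\<^sup>\<dagger> \<cdot> iP \<cdot> Z \<cdot> z = 0"
    and adm6: "C\<^sup>\<dagger> \<cdot> D \<cdot> y + Z\<^sup>\<dagger> \<cdot> iP \<cdot> B \<cdot> y = 0"
    and adm7: "C\<^sup>\<dagger> \<cdot> C \<cdot> z + Z\<^sup>\<dagger> \<cdot> iP \<cdot> Z \<cdot> z = iP \<cdot> z"
proof -
  have 1: "(block_op D C B Z \<circ>\<^sub>C block_op id_cblinfun 0 0 P \<circ>\<^sub>C block_op (D\<^sup>\<dagger>) (B\<^sup>\<dagger>) (C\<^sup>\<dagger>) (Z\<^sup>\<dagger>)) \<cdot> x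
      = block_op id_cblinfun 0 0 P \<cdot> x"
    and 2: "(block_op (D\<^sup>\<dagger>) (B\<^sup>\<dagger>) (C\<^sup>\<dagger>) (Z\<^sup>\<dagger>) \<circ>\<^sub>C block_op id_cblinfun 0 0 iP \<circ>\<^sub>C block_op D C B Z) \<cdot> x'
      = block_op id_cblinfun 0 0 iP \<cdot> x'" for x x'
    using adm unfolding admissible_pair_def Let_def P_def[symmetric] B_def[symmetric] by (simp_all only:)
  show "D \<cdot> D\<^sup>\<dagger> \<cdot> e + C \<cdot> P \<cdot> C\<^sup>\<dagger> \<cdot> e = e" "B \<cdot> D\<^sup>\<dagger> \<cdot> e + Z \<cdot> P \<cdot> C\<^sup>\<dagger> \<cdot> e = 0"
    using 1[of "(e, 0)"] by (simp_all add: block_op_apply)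
  show "D \<cdot> B\<^sup>\<dagger> \<cdot> z + C \<cdot> P \<cdot> Z\<^sup>\<dagger> \<cdot> z = 0"
    using 1[of "(0, z)"] by (simp add: block_op_apply)
  show "D\<^sup>\<dagger> \<cdot> D \<cdot> y + B\<^sup>\<dagger> \<cdot> iP \<cdot> B \<cdot> y = y" "C\<^sup>\<dagger> \<cdot> D \<cdot> y + Z\<^sup>\<dagger> \<cdot> iP \<cdot> B \<cdot> y = 0"
    using 2[of "(y, 0)"] by (simp_all add: block_op_apply)
  show "D\<^sup>\<dagger> \<cdot> C \<cdot> z + B\<^sup>\<dagger> \<cdot> iP \<cdot> Z \<cdot> z = 0" "C\<^sup>\<dagger> \<cdot> C \<cdot> z + Z\<^sup>\<dagger> \<cdot> iP \<cdot> Z \<cdot> z = iP \<cdot> z"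
    using 2[of "(0, z)"] by (simp_all add: block_op_apply)
qed

text \<open>\<open>TQ\<close> is \<open>Q\<^sup>-\<^sup>2\<close> and \<open>TR\<close> is
  \<open>R\<^sup>-\<^sup>2\<close>. By \<open>adm1\<close>, \<open>TQ\<close> also equals \<open>D
  D\<^sup>\<dagger> + C P \<Lambda>\<^sup>-\<^sup>1 P C\<^sup>\<dagger>\<close>, the form in which
  it enters the energy.\<close>

definition "TQ = id_cblinfun + C \<circ>\<^sub>C P \<circ>\<^sub>C (iL - iP) \<circ>\<^sub>C P \<circ>\<^sub>C C\<^sup>\<dagger>"
definition "TR = id_cblinfun + Bt\<^sup>\<dagger> \<circ>\<^sub>C iL \<circ>\<^sub>C Bt"

lemma TQ_apply: "TQ \<cdot> e = e + C \<cdot> P \<cdot> iL \<cdot> P \<cdot> C\<^sup>\<dagger> \<cdot> e - C \<cdot> P \<cdot> C\<^sup>\<dagger> \<cdot> e"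
  by (simp add: TQ_def cblinfun_simps)

lemma TR_apply: "TR \<cdot> v = v + Bt\<^sup>\<dagger> \<cdot> iL \<cdot> Bt \<cdot> v"
  by (simp add: TR_def cblinfun_simps)

lemma TQ_pos: "strictly_positive TQ"
proof (rule strictly_positiveI[where c = 1])
  have mv: "inner (C \<cdot> P \<cdot> a) b = inner a (P \<cdot> C\<^sup>\<dagger> \<cdot> b)" for a b
    using inner_adj_right[of C "P \<cdot> a" b] inner_selfadj[OF P_adj, of a "C\<^sup>\<dagger> \<cdot> b"] by simp
  have form: "inner (TQ \<cdot> e) f = inner e f + inner ((iL - iP) \<cdot> P \<cdot> C\<^sup>\<dagger> \<cdot> e) (P \<cdot> C\<^sup>\<dagger> \<cdot> f)" for e f
    by (simp add: TQ_def cblinfun.add_left inner_add_left mv)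
  show "TQ\<^sup>\<dagger> = TQ"
  proof (rule adj_eqI)
    fix e f
    have "inner ((iL - iP) \<cdot> P \<cdot> C\<^sup>\<dagger> \<cdot> e) (P \<cdot> C\<^sup>\<dagger> \<cdot> f) = inner ((iL - iP) \<cdot> P \<cdot> C\<^sup>\<dagger> \<cdot> f) (P \<cdot> C\<^sup>\<dagger> \<cdot> e)"
      by (metis inner_commute inner_selfadj nonneg_inv_diff nonneg_op_adj)
    then show "inner (TQ \<cdot> e) f = inner e (TQ \<cdot> f)"
      unfolding inner_commute[of e "TQ \<cdot> f"] form by (simp add: inner_commute)
  qed
  show "1 * (norm h)\<^sup>2 \<le> inner (TQ \<cdot> h) h" for h
    unfolding form power2_norm_eq_inner using nonneg_op_inner[OF nonneg_inv_diff] by simp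
qed simp

lemma TR_pos: "strictly_positive TR"
proof (rule strictly_positiveI[where c = 1])
  have form: "inner (TR \<cdot> e) f = inner e f + inner (iL \<cdot> Bt \<cdot> e) (Bt \<cdot> f)" for e f
    by (simp add: TR_def cblinfun.add_left inner_add_left inner_adj_left)
  show "TR\<^sup>\<dagger> = TR"
  proof (rule adj_eqI)
    fix e f
    have "inner (iL \<cdot> Bt \<cdot> e) (Bt \<cdot> f) = inner (iL \<cdot> Bt \<cdot> f) (Bt \<cdot> e)"
      by (metis inner_commute inner_selfadj Lambda_inv_adj)
    then show "inner (TR \<cdot> e) f = inner e (TR \<cdot> f)"
      unfolding inner_commute[of e "TR \<cdot> f"] form by (simp add: inner_commute)
  qed
  have "nonneg_op iL"
    using strictly_positive_inverse(3)[OF Lambda_pos] by (simp add: strictly_positive_def)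
  then show "1 * (norm h)\<^sup>2 \<le> inner (TR \<cdot> h) h" for h
    unfolding form power2_norm_eq_inner using nonneg_op_inner by simp
qed simp

lemma Q_pos: "strictly_positive Q"
  unfolding Q_def TQ_def[symmetric] by (rule op_inv_sqrt_strictly_positive(1)[OF TQ_pos])

lemma R_pos: "strictly_positive R"
  unfolding R_def TR_def[symmetric] by (rule op_inv_sqrt_strictly_positive(1)[OF TR_pos])

lemma QTQ [simp]: "Q \<cdot> TQ \<cdot> Q \<cdot> x = x" "TQ \<cdot> Q \<cdot> Q \<cdot> x = x"
  using op_inv_sqrt_strictly_positive(3,4)[OF TQ_pos, folded Q_def[folded TQ_def]]
  by (metis cblinfun_compose_apply id_cblinfun_apply)+

lemma RTR [simp]: "R \<cdot> TR \<cdot> R \<cdot> x = x" "R \<cdot> R \<cdot> TR \<cdot> x = x" "TR \<cdot> R \<cdot> R \<cdot> x = x"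
  using op_inv_sqrt_strictly_positive(2-4)[OF TR_pos, folded R_def[folded TR_def]]
  by (metis cblinfun_compose_apply id_cblinfun_apply)+

text \<open>One time step of the system with transfer function \<open>\<Upsilon>\<close>: state \<open>x\<close>, input \<open>(e, v)\<close>, next state
  \<open>x'\<close>, output \<open>(y, u)\<close>.  The lemmas below express that the system operator is unitary with respect to
  the indefinite forms \<open>\<langle>\<Lambda>x, x\<rangle> + \<parallel>e\<parallel>\<^sup>2 - \<parallel>v\<parallel>\<^sup>2\<close> and \<open>\<langle>\<Lambda>x', x'\<rangle> + \<parallel>y\<parallel>\<^sup>2 - \<parallel>u\<parallel>\<^sup>2\<close>.\<close>

definition step :: "'z \<Rightarrow> 'e \<Rightarrow> 'u \<Rightarrow> 'z \<Rightarrow> 'y \<Rightarrow> 'u \<Rightarrow> bool" where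
  "step x e v x' y u \<longleftrightarrow> (let t = x + iL \<cdot> Bt \<cdot> R \<cdot> v in
     x' = Z\<^sup>\<dagger> \<cdot> t + iL \<cdot> P \<cdot> C\<^sup>\<dagger> \<cdot> Q \<cdot> e \<and> y = B\<^sup>\<dagger> \<cdot> t + D\<^sup>\<dagger> \<cdot> Q \<cdot> e \<and> u = Bt\<^sup>\<dagger> \<cdot> t + R \<cdot> v)"

text \<open>The Stein equation and \<open>adm3\<close> remove \<open>t\<close> and \<open>e\<close>
  from the first formula, \<open>adm2\<close> removes \<open>t\<close> from the second, and the
  normalisations by Q and R isolate the inputs. The third formula uses the old state, which the
  first one supplies.\<close>

lemma step_backward:
  assumes "step x e v x' y u"
  shows "\<Lambda> \<cdot> x = Z \<cdot> \<Lambda> \<cdot> x' + B \<cdot> y - Bt \<cdot> u"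
    and "e = Q \<cdot> (D \<cdot> y + C \<cdot> P \<cdot> x')" and "v = R \<cdot> (u - Bt\<^sup>\<dagger> \<cdot> x)"
proof -
  define t where "t = x + iL \<cdot> Bt \<cdot> R \<cdot> v"
  have x': "x' = Z\<^sup>\<dagger> \<cdot> t + iL \<cdot> P \<cdot> C\<^sup>\<dagger> \<cdot> Q \<cdot> e" and y: "y = B\<^sup>\<dagger> \<cdot> t + D\<^sup>\<dagger> \<cdot> Q \<cdot> e"
    and u: "u = Bt\<^sup>\<dagger> \<cdot> t + R \<cdot> v"
    using assms by (simp_all add: step_def Let_def t_def)
  have "Z \<cdot> \<Lambda> \<cdot> x' + B \<cdot> y - Bt \<cdot> u =
      (Z \<cdot> \<Lambda> \<cdot> Z\<^sup>\<dagger> \<cdot> t + B \<cdot> B\<^sup>\<dagger> \<cdot> t - Bt \<cdot> Bt\<^sup>\<dagger> \<cdot> t) + (B \<cdot> D\<^sup>\<dagger> \<cdot> Q \<cdot> e + Z \<cdot> P \<cdot> C\<^sup>\<dagger> \<cdot> Q \<cdot> e) - Bt \<cdot> R \<cdot> v"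
    unfolding x' y u by (simp add: cblinfun_simps)
  also have "\<dots> = \<Lambda> \<cdot> t - Bt \<cdot> R \<cdot> v" by (simp add: stein_Lambda adm3)
  also have "\<dots> = \<Lambda> \<cdot> x" by (simp add: t_def cblinfun_simps)
  finally show "\<Lambda> \<cdot> x = Z \<cdot> \<Lambda> \<cdot> x' + B \<cdot> y - Bt \<cdot> u" by simp
  have "D \<cdot> y + C \<cdot> P \<cdot> x' = (D \<cdot> B\<^sup>\<dagger> \<cdot> t + C \<cdot> P \<cdot> Z\<^sup>\<dagger> \<cdot> t) +
      (D \<cdot> D\<^sup>\<dagger> \<cdot> Q \<cdot> e + C \<cdot> P \<cdot> iL \<cdot> P \<cdot> C\<^sup>\<dagger> \<cdot> Q \<cdot> e)"
    unfolding x' y by (simp add: cblinfun_simps)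
  also have "\<dots> = TQ \<cdot> Q \<cdot> e"
    using adm1[of "Q \<cdot> e"] by (simp add: adm2 TQ_apply algebra_simps)
  finally show "e = Q \<cdot> (D \<cdot> y + C \<cdot> P \<cdot> x')" by simp
  have "u - Bt\<^sup>\<dagger> \<cdot> x = TR \<cdot> R \<cdot> v" by (simp add: u t_def TR_apply cblinfun_simps)
  then show "v = R \<cdot> (u - Bt\<^sup>\<dagger> \<cdot> x)" by simp
qed

text \<open>Converse of \<open>step_backward\<close>; needed because the states attached to a
  solution are known only through the backward relations.\<close>

lemma stepI:
  assumes x: "\<Lambda> \<cdot> x = Z \<cdot> \<Lambda> \<cdot> x' + B \<cdot> y - Bt \<cdot> u"
    and e: "e = Q \<cdot> (D \<cdot> y + C \<cdot> P \<cdot> x')" and v: "v = R \<cdot> (u - Bt\<^sup>\<dagger> \<cdot> x)"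
  shows "step x e v x' y u"
proof -
  define q where "q = Q \<cdot> e"
  \<comment> \<open>\<open>\<xi>\<close> is what the next state would be if \<open>iL\<close> were
    \<open>iP\<close> in the term with \<open>q\<close>. Then \<open>(q, P t)\<close> is the image
    of \<open>(y, P \<xi>)\<close> under the block operator, and the second admissibility identity
    leads back to \<open>y\<close> and \<open>\<xi>\<close>.\<close>
  define \<xi> where "\<xi> = x' - iL \<cdot> P \<cdot> C\<^sup>\<dagger> \<cdot> q + C\<^sup>\<dagger> \<cdot> q"
  define t where "t = iP \<cdot> (B \<cdot> y + Z \<cdot> P \<cdot> \<xi>)"
  have Tq: "TQ \<cdot> q = D \<cdot> y + C \<cdot> P \<cdot> x'" by (simp add: q_def e)
  then have q: "q = D \<cdot> y + C \<cdot> P \<cdot> \<xi>" by (simp add: \<xi>_def TQ_apply cblinfun_simps algebra_simps)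
  have "D\<^sup>\<dagger> \<cdot> q + B\<^sup>\<dagger> \<cdot> t = (D\<^sup>\<dagger> \<cdot> D \<cdot> y + B\<^sup>\<dagger> \<cdot> iP \<cdot> B \<cdot> y) + (D\<^sup>\<dagger> \<cdot> C \<cdot> P \<cdot> \<xi> + B\<^sup>\<dagger> \<cdot> iP \<cdot> Z \<cdot> P \<cdot> \<xi>)"
    unfolding t_def by (subst q) (simp add: cblinfun_simps)
  then have y: "y = B\<^sup>\<dagger> \<cdot> t + D\<^sup>\<dagger> \<cdot> q" by (simp add: adm4 adm5 add.commute)
  have "C\<^sup>\<dagger> \<cdot> q + Z\<^sup>\<dagger> \<cdot> t = (C\<^sup>\<dagger> \<cdot> D \<cdot> y + Z\<^sup>\<dagger> \<cdot> iP \<cdot> B \<cdot> y) + (C\<^sup>\<dagger> \<cdot> C \<cdot> P \<cdot> \<xi> + Z\<^sup>\<dagger> \<cdot> iP \<cdot> Z \<cdot> P \<cdot> \<xi>)"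
    unfolding t_def by (subst q) (simp add: cblinfun_simps)
  then have "C\<^sup>\<dagger> \<cdot> q + Z\<^sup>\<dagger> \<cdot> t = \<xi>" by (simp add: adm6 adm7)
  then have x': "x' = Z\<^sup>\<dagger> \<cdot> t + iL \<cdot> P \<cdot> C\<^sup>\<dagger> \<cdot> q" by (simp add: \<xi>_def algebra_simps)
  define w where "w = u - Bt\<^sup>\<dagger> \<cdot> t"
  have "Z \<cdot> \<Lambda> \<cdot> x' + B \<cdot> y = (Z \<cdot> \<Lambda> \<cdot> Z\<^sup>\<dagger> \<cdot> t + B \<cdot> B\<^sup>\<dagger> \<cdot> t) + (B \<cdot> D\<^sup>\<dagger> \<cdot> q + Z \<cdot> P \<cdot> C\<^sup>\<dagger> \<cdot> q)"
    by (subst x', subst y) (simp add: cblinfun_simps)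
  then have "\<Lambda> \<cdot> x = \<Lambda> \<cdot> t - Bt \<cdot> w"
    unfolding x by (simp add: adm3 stein_Lambda w_def cblinfun_simps)
  then have "iL \<cdot> \<Lambda> \<cdot> x = iL \<cdot> (\<Lambda> \<cdot> t - Bt \<cdot> w)" by simp
  then have xt: "x = t - iL \<cdot> Bt \<cdot> w" by (simp add: cblinfun.diff_right)
  have "u - Bt\<^sup>\<dagger> \<cdot> x = TR \<cdot> w" by (simp add: w_def xt TR_apply cblinfun_simps)
  then have Rv: "R \<cdot> v = w" by (simp add: v)
  show ?thesis
    unfolding step_def Let_def q_def[symmetric] Rv using x' y xt by (simp add: w_def)
qed

text \<open>All squares are expanded in \<open>t\<close>, \<open>q\<close> and \<open>w\<close>: the
  pure \<open>t\<close> terms balance by the Stein equation, the mixed terms by \<open>adm3\<close>,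
  and the rest is |e|^2 and |v|^2 by the choice of Q and R.\<close>

lemma step_energy:
  assumes "step x e v x' y u"
  shows "inner (\<Lambda> \<cdot> x') x' + (norm y)\<^sup>2 - (norm u)\<^sup>2 = inner (\<Lambda> \<cdot> x) x + (norm e)\<^sup>2 - (norm v)\<^sup>2"
proof -
  define t where "t = x + iL \<cdot> Bt \<cdot> R \<cdot> v"
  define q where "q = Q \<cdot> e"
  define w where "w = R \<cdot> v"
  define p where "p = P \<cdot> C\<^sup>\<dagger> \<cdot> q"
  have x': "x' = Z\<^sup>\<dagger> \<cdot> t + iL \<cdot> p" and y: "y = B\<^sup>\<dagger> \<cdot> t + D\<^sup>\<dagger> \<cdot> q"
    and u: "u = Bt\<^sup>\<dagger> \<cdot> t + w" and x: "x = t - iL \<cdot> Bt \<cdot> w"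
    using assms by (simp_all add: step_def Let_def t_def q_def w_def p_def)
  have 1: "inner (\<Lambda> \<cdot> x') x' = inner (Z \<cdot> \<Lambda> \<cdot> Z\<^sup>\<dagger> \<cdot> t) t + 2 * inner (Z \<cdot> p) t + inner (iL \<cdot> p) p"
  proof -
    have "inner (\<Lambda> \<cdot> x') x' = inner (\<Lambda> \<cdot> Z\<^sup>\<dagger> \<cdot> t) (Z\<^sup>\<dagger> \<cdot> t) + inner (\<Lambda> \<cdot> Z\<^sup>\<dagger> \<cdot> t) (iL \<cdot> p)
        + inner p (Z\<^sup>\<dagger> \<cdot> t) + inner p (iL \<cdot> p)"
      by (simp add: x' cblinfun_simps inner_add_left inner_add_right)
    moreover have "inner (\<Lambda> \<cdot> Z\<^sup>\<dagger> \<cdot> t) (iL \<cdot> p) = inner (Z\<^sup>\<dagger> \<cdot> t) p"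
      using inner_selfadj[OF Lambda_adj, of "Z\<^sup>\<dagger> \<cdot> t" "iL \<cdot> p"] by simp
    ultimately show ?thesis
      using inner_adj_right[of Z "\<Lambda> \<cdot> Z\<^sup>\<dagger> \<cdot> t" t] inner_adj_right[of Z p t]
        inner_commute[of p "iL \<cdot> p"] inner_commute[of "Z\<^sup>\<dagger> \<cdot> t" p] by linarith
  qed
  have 2: "(norm y)\<^sup>2 = inner (B \<cdot> B\<^sup>\<dagger> \<cdot> t) t + 2 * inner (B \<cdot> D\<^sup>\<dagger> \<cdot> q) t + inner (D \<cdot> D\<^sup>\<dagger> \<cdot> q) q"
    unfolding power2_norm_eq_inner y inner_add_left inner_add_right
    using inner_adj_right[of B "B\<^sup>\<dagger> \<cdot> t" t] inner_adj_right[of B "D\<^sup>\<dagger> \<cdot> q" t]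
      inner_adj_right[of D "D\<^sup>\<dagger> \<cdot> q" q] inner_commute[of "B\<^sup>\<dagger> \<cdot> t" "D\<^sup>\<dagger> \<cdot> q"] by linarith
  have 3: "(norm u)\<^sup>2 = inner (Bt \<cdot> Bt\<^sup>\<dagger> \<cdot> t) t + 2 * inner (Bt \<cdot> w) t + inner w w"
    unfolding power2_norm_eq_inner u inner_add_left inner_add_right
    using inner_adj_right[of Bt "Bt\<^sup>\<dagger> \<cdot> t" t] inner_adj_right[of Bt w t]
      inner_commute[of "Bt\<^sup>\<dagger> \<cdot> t" w] by linarith
  have 4: "inner (\<Lambda> \<cdot> x) x = inner (\<Lambda> \<cdot> t) t - 2 * inner (Bt \<cdot> w) t + inner (Bt\<^sup>\<dagger> \<cdot> iL \<cdot> Bt \<cdot> w) w"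
  proof -
    have "inner (\<Lambda> \<cdot> x) x = inner (\<Lambda> \<cdot> t) t - inner (\<Lambda> \<cdot> t) (iL \<cdot> Bt \<cdot> w) - inner (Bt \<cdot> w) t
        + inner (Bt \<cdot> w) (iL \<cdot> Bt \<cdot> w)"
      by (simp add: x cblinfun_simps inner_diff_left inner_diff_right)
    moreover have "inner (\<Lambda> \<cdot> t) (iL \<cdot> Bt \<cdot> w) = inner (Bt \<cdot> w) t"
      using inner_selfadj[OF Lambda_adj, of t "iL \<cdot> Bt \<cdot> w"] by (simp add: inner_commute)
    ultimately show ?thesis
      using inner_adj_left[of Bt "iL \<cdot> Bt \<cdot> w" w] inner_commute[of "Bt \<cdot> w" "iL \<cdot> Bt \<cdot> w"] by linarith
  qed
  have 5: "(norm e)\<^sup>2 = inner (iL \<cdot> p) p + inner (D \<cdot> D\<^sup>\<dagger> \<cdot> q) q"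
  proof -
    have "(norm e)\<^sup>2 = inner (Q \<cdot> TQ \<cdot> Q \<cdot> e) e" by (simp add: power2_norm_eq_inner)
    also have "\<dots> = inner (TQ \<cdot> q) q"
      using inner_selfadj[OF strictly_positive_adj[OF Q_pos], of "TQ \<cdot> Q \<cdot> e" e] by (simp add: q_def)
    also have "TQ \<cdot> q = C \<cdot> P \<cdot> iL \<cdot> p + D \<cdot> D\<^sup>\<dagger> \<cdot> q"
      using adm1[of q] by (simp add: TQ_apply p_def algebra_simps)
    also have "inner \<dots> q = inner (C \<cdot> P \<cdot> iL \<cdot> p) q + inner (D \<cdot> D\<^sup>\<dagger> \<cdot> q) q"
      by (rule inner_add_left)
    also have "inner (C \<cdot> P \<cdot> iL \<cdot> p) q = inner (iL \<cdot> p) p"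
      using inner_adj_right[of C "P \<cdot> iL \<cdot> p" q] inner_selfadj[OF P_adj, of "iL \<cdot> p" "C\<^sup>\<dagger> \<cdot> q"]
      by (simp add: p_def)
    finally show ?thesis .
  qed
  have 6: "(norm v)\<^sup>2 = inner w w + inner (Bt\<^sup>\<dagger> \<cdot> iL \<cdot> Bt \<cdot> w) w"
  proof -
    have "(norm v)\<^sup>2 = inner (R \<cdot> TR \<cdot> R \<cdot> v) v" by (simp add: power2_norm_eq_inner)
    also have "\<dots> = inner (TR \<cdot> w) w"
      using inner_selfadj[OF strictly_positive_adj[OF R_pos], of "TR \<cdot> R \<cdot> v" v] by (simp add: w_def)
    finally show ?thesis by (simp add: TR_apply inner_add_left)
  qed
  have 7: "inner (Z \<cdot> \<Lambda> \<cdot> Z\<^sup>\<dagger> \<cdot> t) t + inner (B \<cdot> B\<^sup>\<dagger> \<cdot> t) t - inner (Bt \<cdot> Bt\<^sup>\<dagger> \<cdot> t) t = inner (\<Lambda> \<cdot> t) t"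
    by (simp add: stein_Lambda inner_add_left inner_diff_left)
  have 8: "inner (B \<cdot> D\<^sup>\<dagger> \<cdot> q) t + inner (Z \<cdot> p) t = 0"
    using adm3[of q] by (simp add: inner_add_left[symmetric] p_def)
  show ?thesis using 1 2 3 4 5 6 7 8 by linarith
qed

end

section \<open>Trajectories\<close>

context ltonp_system
begin

text \<open>Impulse responses from \<open>e\<close> and \<open>v\<close> to the shifted state
  \<open>t = x + iL \<cdot> Bt \<cdot> R \<cdot> v\<close> of \<open>step\<close>, whose transforms
  contain the resolvent; \<open>state\<close> subtracts the shift again. \<open>G1\<close> starts
  one step late because \<open>e\<close> acts only on the next state.\<close>

definition "G1 = (\<lambda>n. case n of 0 \<Rightarrow> 0 | Suc m \<Rightarrow> op_pow (Z\<^sup>\<dagger>) m \<circ>\<^sub>C (iL \<circ>\<^sub>C P \<circ>\<^sub>C C\<^sup>\<dagger> \<circ>\<^sub>C Q))"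
definition "G2 = (\<lambda>n. op_pow (Z\<^sup>\<dagger>) n \<circ>\<^sub>C (iL \<circ>\<^sub>C Bt \<circ>\<^sub>C R))"

definition "U11c = (\<lambda>n. impulse (D\<^sup>\<dagger> \<circ>\<^sub>C Q) n + B\<^sup>\<dagger> \<circ>\<^sub>C G1 n)"
definition "U12c = (\<lambda>n. B\<^sup>\<dagger> \<circ>\<^sub>C G2 n)"
definition "U21c = (\<lambda>n. Bt\<^sup>\<dagger> \<circ>\<^sub>C G1 n)"
definition "U22c = (\<lambda>n. impulse R n + Bt\<^sup>\<dagger> \<circ>\<^sub>C G2 n)"

definition "state e v n = conv G1 e n + conv G2 v n - iL \<cdot> Bt \<cdot> R \<cdot> v n"
definition "outy e v n = conv U11c e n + conv U12c v n"
definition "outu e v n = conv U21c e n + conv U22c v n"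

lemma state_0: "state e v 0 = 0"
  by (simp add: state_def conv_def G1_def G2_def)

lemma state_step: "step (state e v n) (e n) (v n) (state e v (Suc n)) (outy e v n) (outu e v n)"
proof -
  define t where "t = conv G1 e n + conv G2 v n"
  have t: "state e v n + iL \<cdot> Bt \<cdot> R \<cdot> v n = t" by (simp add: state_def t_def)
  have "conv G2 v (Suc n) = Z\<^sup>\<dagger> \<cdot> conv G2 v n + iL \<cdot> Bt \<cdot> R \<cdot> v (Suc n)"
  proof -
    have "(\<lambda>k. G2 (Suc k)) = (\<lambda>k. Z\<^sup>\<dagger> \<circ>\<^sub>C G2 k)" by (simp add: G2_def cblinfun_compose_assoc)
    then show ?thesis by (simp add: conv_Suc conv_compose_left) (simp add: G2_def)
  qed
  moreover have "conv G1 e (Suc n) = Z\<^sup>\<dagger> \<cdot> conv G1 e n + iL \<cdot> P \<cdot> C\<^sup>\<dagger> \<cdot> Q \<cdot> e n"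
  proof -
    have "(\<lambda>k. G1 (Suc k)) = (\<lambda>k. Z\<^sup>\<dagger> \<circ>\<^sub>C G1 k + impulse (iL \<circ>\<^sub>C P \<circ>\<^sub>C C\<^sup>\<dagger> \<circ>\<^sub>C Q) k)"
      by (rule ext) (simp add: G1_def impulse_def cblinfun_compose_assoc cblinfun_compose.zero_right split: nat.split)
    then show ?thesis by (simp add: conv_Suc conv_add_left conv_compose_left) (simp add: G1_def)
  qed
  ultimately have "state e v (Suc n) = Z\<^sup>\<dagger> \<cdot> t + iL \<cdot> P \<cdot> C\<^sup>\<dagger> \<cdot> Q \<cdot> e n"
    by (simp add: state_def t_def cblinfun_simps)
  moreover have "outy e v n = B\<^sup>\<dagger> \<cdot> t + D\<^sup>\<dagger> \<cdot> Q \<cdot> e n"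
    by (simp add: outy_def U11c_def U12c_def conv_add_left conv_compose_left t_def cblinfun_simps)
  moreover have "outu e v n = Bt\<^sup>\<dagger> \<cdot> t + R \<cdot> v n"
    by (simp add: outu_def U21c_def U22c_def conv_add_left conv_compose_left t_def cblinfun_simps)
  ultimately show ?thesis unfolding step_def Let_def t by simp
qed

lemma trajectory_unique:
  assumes x0: "x 0 = 0" and st: "\<And>n. step (x n) (e n) (v n) (x (Suc n)) (y n) (u n)"
  shows "x n = state e v n" "y n = outy e v n" "u n = outu e v n"
proof -
  show x: "x n = state e v n" for n
  proof (induction n)
    case (Suc n)
    then show ?case using st[of n] state_step[of e v n] by (simp add: step_def Let_def)
  qed (simp add: x0 state_0)
  show "y n = outy e v n" "u n = outu e v n"
    using st[of n] state_step[of e v n] x[of n] by (simp_all add: step_def Let_def)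
qed

lemma energy_sum:
  "inner (\<Lambda> \<cdot> state e v N) (state e v N) + (\<Sum>n<N. (norm (outy e v n))\<^sup>2) - (\<Sum>n<N. (norm (outu e v n))\<^sup>2)
    = (\<Sum>n<N. (norm (e n))\<^sup>2) - (\<Sum>n<N. (norm (v n))\<^sup>2)"
proof (induction N)
  case (Suc N)
  then show ?case using step_energy[OF state_step[of e v N]] by simp
qed (simp add: state_0)

definition "Num X = (\<lambda>n. oconv U11c X n + U12c n)"
definition "Den X = (\<lambda>n. oconv U21c X n + U22c n)"

lemma outy_feedback: "outy (conv X v) v = conv (Num X) v"
  by (rule ext) (simp add: outy_def Num_def conv_add_left conv_oconv)

lemma outu_feedback: "outu (conv X v) v = conv (Den X) v"
  by (rule ext) (simp add: outu_def Den_def conv_add_left conv_oconv)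

text \<open>The constant coefficient is \<open>TR \<circ>\<^sub>C R\<close>, the inverse of
  \<open>R\<close>, independently of \<open>X\<close>, since \<open>U21c\<close> starts with
  0.\<close>

lemma Den_inverse_exists:
  obtains V where "oconv (Den X) V = impulse id_cblinfun" "oconv V (Den X) = impulse id_cblinfun"
proof (rule oconv_inverse_exists[of "Den X" R])
  have "Den X 0 = TR \<circ>\<^sub>C R"
    by (simp add: Den_def oconv_def U21c_def U22c_def G1_def G2_def impulse_def TR_def
        cblinfun_compose.zero_left cblinfun_compose.zero_right cblinfun_compose.add_left cblinfun_compose_assoc)
  then show "Den X 0 \<circ>\<^sub>C R = id_cblinfun" "R \<circ>\<^sub>C Den X 0 = id_cblinfun"
    by (simp_all add: cblinfun_eqI)
qed (rule that)

end

text \<open>The closed loop under the feedback \<open>e = X v\<close>: here \<open>V\<close> is the impulse response from the external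
  input \<open>u\<close> to \<open>v\<close>, and \<open>F\<close> the one from \<open>u\<close> to the output \<open>y\<close>.\<close>

locale ltonp_feedback = ltonp_system Z W Wt P \<Lambda> B Bt C D Q R
  for Z W Wt P \<Lambda> B Bt and C :: "'z::complex_hilbert \<Rightarrow>\<^sub>C\<^sub>L 'e::complex_hilbert" and D Q
    and R :: "'u::complex_hilbert \<Rightarrow>\<^sub>C\<^sub>L 'u" +
  fixes X :: "nat \<Rightarrow> 'u \<Rightarrow>\<^sub>C\<^sub>L 'e" and V :: "nat \<Rightarrow> 'u \<Rightarrow>\<^sub>C\<^sub>L 'u"
  assumes X: "contr_seq X" and DV: "oconv (Den X) V = impulse id_cblinfun"
    and VD: "oconv V (Den X) = impulse id_cblinfun"
begin

definition "F = oconv (Num X) V"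
definition "vs u = conv V u"
definition "es u = conv X (vs u)"
definition "xs u = state (es u) (vs u)"

lemma outu_loop: "outu (es u) (vs u) n = u n"
  unfolding es_def outu_feedback by (simp add: vs_def conv_oconv[symmetric] DV)

lemma outy_loop: "outy (es u) (vs u) n = conv F u n"
  unfolding es_def outy_feedback by (simp add: vs_def F_def conv_oconv)

lemma loop_step: "step (xs u n) (es u n) (vs u n) (xs u (Suc n)) (conv F u n) (u n)"
  using state_step[of "es u" "vs u" n] by (simp add: outu_loop outy_loop xs_def)

lemma loop_energy:
  "inner (\<Lambda> \<cdot> xs u N) (xs u N) + (\<Sum>n<N. (norm (conv F u n))\<^sup>2) \<le> (\<Sum>n<N. (norm (u n))\<^sup>2)"
proof -
  have "(\<Sum>n<N. (norm (es u n))\<^sup>2) \<le> (\<Sum>n<N. (norm (vs u n))\<^sup>2)"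
    unfolding es_def using X by (simp add: contr_seq_def)
  then show ?thesis
    using energy_sum[of "es u" "vs u" N] unfolding outu_loop outy_loop xs_def by linarith
qed

lemma contr_F: "contr_seq F"
  unfolding contr_seq_def
proof (intro allI)
  fix u :: "nat \<Rightarrow> 'u" and N
  have "0 \<le> inner (\<Lambda> \<cdot> xs u N) (xs u N)"
    using Lambda_pos by (simp add: strictly_positive_def nonneg_op_inner)
  then show "(\<Sum>n<N. (norm (conv F u n))\<^sup>2) \<le> (\<Sum>n<N. (norm (u n))\<^sup>2)"
    using loop_energy[of u N] by linarith
qed

lemma state_bound:
  assumes c: "c > 0" "\<And>h. c * (norm h)\<^sup>2 \<le> inner (\<Lambda> \<cdot> h) h"
    and M: "0 \<le> M" "(\<Sum>n<N. (norm (u n))\<^sup>2) \<le> M\<^sup>2"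
  shows "norm (xs u N) \<le> M / sqrt c"
proof -
  have "0 \<le> (\<Sum>n<N. (norm (conv F u n))\<^sup>2)" by (simp add: sum_nonneg)
  then have "c * (norm (xs u N))\<^sup>2 \<le> M\<^sup>2"
    using c(2)[of "xs u N"] loop_energy[of u N] M(2) by linarith
  then have "(sqrt c * norm (xs u N))\<^sup>2 \<le> M\<^sup>2" using c(1) by (simp add: power_mult_distrib)
  then have "sqrt c * norm (xs u N) \<le> M" using M(1) by (rule power2_le_imp_le)
  then show ?thesis using c(1) by (simp add: field_simps)
qed

text \<open>Turns the formal inverse of the denominator into a convergent one: under an impulse
  input the states stay bounded, and \<open>v\<close> is read off from input and state by the
  backward formula.\<close>

lemma V_bounded: obtains K where "\<And>n. norm (V n) \<le> K"
proof -
  obtain c where c: "c > 0" "\<And>h. c * (norm h)\<^sup>2 \<le> inner (\<Lambda> \<cdot> h) h"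
    using strictly_positive_coercive[OF Lambda_pos] by blast
  define K where "K = 1 / sqrt c"
  have "norm (V n) \<le> norm R * (1 + norm (Bt\<^sup>\<dagger>) * K)" for n
  proof (rule norm_cblinfun_bound)
    show "0 \<le> norm R * (1 + norm (Bt\<^sup>\<dagger>) * K)" using c(1) by (simp add: K_def)
    fix w
    have x: "norm (xs (impulse w) n) \<le> K * norm w"
      using state_bound[OF c norm_ge_zero sum_impulse_le[of w n]] by (simp add: K_def)
    have "norm (Bt\<^sup>\<dagger> \<cdot> xs (impulse w) n) \<le> norm (Bt\<^sup>\<dagger>) * (K * norm w)"
      by (rule order_trans[OF norm_cblinfun_apply mult_left_mono[OF x]]) simp
    moreover have "norm (impulse w n) \<le> norm w" by (simp add: impulse_def)
    ultimately have le: "norm (impulse w n - Bt\<^sup>\<dagger> \<cdot> xs (impulse w) n) \<le> norm w + norm (Bt\<^sup>\<dagger>) * (K * norm w)"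
      using norm_triangle_ineq4[of "impulse w n" "Bt\<^sup>\<dagger> \<cdot> xs (impulse w) n"] by linarith
    have "V n \<cdot> w = R \<cdot> (impulse w n - Bt\<^sup>\<dagger> \<cdot> xs (impulse w) n)"
      using step_backward(3)[OF loop_step[of "impulse w" n]] by (simp add: vs_def)
    then have "norm (V n \<cdot> w) \<le> norm R * (norm w + norm (Bt\<^sup>\<dagger>) * (K * norm w))"
      using order_trans[OF norm_cblinfun_apply mult_left_mono[OF le]] by simp
    then show "norm (V n \<cdot> w) \<le> norm R * (1 + norm (Bt\<^sup>\<dagger>) * K) * norm w"
      by (simp add: algebra_simps)
  qed
  then show thesis by (rule that)
qed

text \<open>By telescoping, \<open>W y - Wt u\<close> is the weak limit of \<open>- Z\<^sup>N \<Lambda> x\<^sub>N\<close>, and the states \<open>x\<^sub>N\<close> are bounded.\<close>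

lemma interpolates: "W \<circ>\<^sub>C toep F = Wt"
proof (rule cblinfun_eqI, rule cinner_eqI)
  fix u h
  let ?x = "xs (ell2_nth u)"
  obtain c where c: "c > 0" "\<And>h. c * (norm h)\<^sup>2 \<le> inner (\<Lambda> \<cdot> h) h"
    using strictly_positive_coercive[OF Lambda_pos] by blast
  have "norm (?x n) \<le> norm u / sqrt c" for n
    by (rule state_bound[OF c norm_ge_zero sum_le_norm_ell2_sq[OF finite_lessThan]])
  then have xb: "norm (\<Lambda> \<cdot> ?x n) \<le> norm \<Lambda> * (norm u / sqrt c)" for n
    by (intro order_trans[OF norm_cblinfun_apply] mult_left_mono) auto
  have sum_eq: "(\<Sum>n<N. op_pow Z n \<cdot> (B \<cdot> conv F (ell2_nth u) n - Bt \<cdot> ell2_nth u n)) = - (op_pow Z N \<cdot> \<Lambda> \<cdot> ?x N)" for N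
    using telescope[where x = ?x and y = "conv F (ell2_nth u)" and u = "ell2_nth u" and N = N,
        OF step_backward(1)[OF loop_step]] by (simp add: xs_def state_0)
  have "(\<lambda>n. op_pow Z n \<cdot> (B \<cdot> conv F (ell2_nth u) n - Bt \<cdot> ell2_nth u n)) sums (W \<cdot> toep F \<cdot> u - Wt \<cdot> u)"
  proof -
    have "W \<cdot> embed_op \<cdot> a = B \<cdot> a" "Wt \<cdot> embed_op \<cdot> a' = Bt \<cdot> a'" for a a'
      by (simp_all add: B_def Bt_def)
    then show ?thesis
      using sums_diff[OF intertwine_sums[OF ZW, of "toep F \<cdot> u"] intertwine_sums[OF ZWt, of u]]
      by (simp add: ell2_nth_toep[OF contr_F] cblinfun.diff_right)
  qed
  then have "(\<lambda>N. cinner (- (op_pow Z N \<cdot> \<Lambda> \<cdot> ?x N)) h) \<longlonglongrightarrow> cinner (W \<cdot> toep F \<cdot> u - Wt \<cdot> u) h"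
    unfolding sums_def sum_eq by (rule bounded_linear.tendsto[OF bounded_linear_cinner_left])
  moreover have "(\<lambda>N. - cinner (op_pow Z N \<cdot> \<Lambda> \<cdot> ?x N) h) \<longlonglongrightarrow> - 0"
    by (intro tendsto_minus pow_weakly_null[OF xb])
  moreover have "cinner (- a) h = - cinner a h" for a :: 'z
    using cinner_diff_left[of 0 a h] by simp
  ultimately have "cinner (W \<cdot> toep F \<cdot> u - Wt \<cdot> u) h = 0"
    using LIMSEQ_unique by fastforce
  then show "cinner ((W \<circ>\<^sub>C toep F) \<cdot> u) h = cinner (Wt \<cdot> u) h" by (simp add: cinner_diff_left)
qed

lemma disc_summable_V: "disc_summable V"
proof -
  obtain K where "\<And>n. norm (V n) \<le> K" using V_bounded by blast
  then show ?thesis by (rule disc_summable_bounded)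
qed

end

section \<open>The correspondence between feedback parameters and solutions\<close>

context ltonp_system
begin

abbreviation "feedback \<equiv> ltonp_feedback Z W Wt P \<Lambda> B Bt C D Q R"

text \<open>Loops with equal input and output have bounded state differences with
  \<open>\<Lambda> d\<^sub>0 = Z\<^sup>N \<Lambda> d\<^sub>N\<close>, so the states agree. The
  backward formulas then give equal \<open>v\<close> and \<open>e\<close>, and \<open>V\<close> can
  be cancelled on the right.\<close>

lemma feedback_injective:
  assumes 1: "feedback X V" and 2: "feedback X' V'"
    and eq: "oconv (Num X) V = oconv (Num X') V'"
  shows "X = X'"
proof -
  interpret L1: ltonp_feedback Z W Wt P \<Lambda> B Bt C D Q R X V by (rule 1)
  interpret L2: ltonp_feedback Z W Wt P \<Lambda> B Bt C D Q R X' V' by (rule 2)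
  have F: "L1.F = L2.F" unfolding L1.F_def L2.F_def by (rule eq)
  obtain c where c: "c > 0" "\<And>h. c * (norm h)\<^sup>2 \<le> inner (\<Lambda> \<cdot> h) h"
    using strictly_positive_coercive[OF Lambda_pos] by blast
  have x_eq: "L1.xs (impulse w) n = L2.xs (impulse w) n" for w n
  proof -
    \<comment> \<open>Starting the difference at time \<open>n\<close> makes the telescoped identity
      speak about the states at that time.\<close>
    define d where "d k = L1.xs (impulse w) (n + k) - L2.xs (impulse w) (n + k)" for k
    have "norm (d k) \<le> norm w / sqrt c + norm w / sqrt c" for k
      unfolding d_def
      by (rule order_trans[OF norm_triangle_ineq4 add_mono])
        (rule L1.state_bound[OF c norm_ge_zero sum_impulse_le] L2.state_bound[OF c norm_ge_zero sum_impulse_le])+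
    then have db: "norm (\<Lambda> \<cdot> d k) \<le> norm \<Lambda> * (norm w / sqrt c + norm w / sqrt c)" for k
      by (intro order_trans[OF norm_cblinfun_apply] mult_left_mono) auto
    have "\<Lambda> \<cdot> d k = Z \<cdot> \<Lambda> \<cdot> d (Suc k) + B \<cdot> 0 - Bt \<cdot> 0" for k
      using step_backward(1)[OF L1.loop_step[of "impulse w" "n + k"]]
        step_backward(1)[OF L2.loop_step[of "impulse w" "n + k"]]
      by (simp add: d_def cblinfun.diff_right F)
    from telescope[of d "\<lambda>_. 0" "\<lambda>_. 0", OF this]
    have dN: "op_pow Z N \<cdot> \<Lambda> \<cdot> d N = \<Lambda> \<cdot> d 0" for N by simp
    have "(\<lambda>N. cinner (\<Lambda> \<cdot> d 0) h) \<longlonglongrightarrow> 0" for h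
      using pow_weakly_null[where h = h and x = "\<lambda>k. \<Lambda> \<cdot> d k", OF db] unfolding dN .
    then have "cinner (\<Lambda> \<cdot> d 0) h = 0" for h by (simp add: LIMSEQ_const_iff)
    then have "\<Lambda> \<cdot> d 0 = 0" using cinner_eqI[of "\<Lambda> \<cdot> d 0" 0] by simp
    then have "iL \<cdot> \<Lambda> \<cdot> d 0 = 0" by (simp del: Lambda_inv)
    then show ?thesis by (simp add: d_def)
  qed
  have "V n \<cdot> w = V' n \<cdot> w" for n w
    using step_backward(3)[OF L1.loop_step[of "impulse w" n]] step_backward(3)[OF L2.loop_step[of "impulse w" n]]
    by (simp add: L1.vs_def L2.vs_def x_eq)
  then have V: "V = V'" by (intro ext cblinfun_eqI)
  have e_eq: "L1.es (impulse w) n = L2.es (impulse w) n" for w n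
    using step_backward(2)[OF L1.loop_step[of "impulse w" n]] step_backward(2)[OF L2.loop_step[of "impulse w" n]]
    by (simp add: x_eq F)
  have "oconv X V n = oconv X' V' n" for n
  proof (rule cblinfun_eqI)
    have vs: "conv V (impulse w) = (\<lambda>k. V k \<cdot> w)" "conv V' (impulse w) = (\<lambda>k. V' k \<cdot> w)" for w by auto
    show "oconv X V n \<cdot> w = oconv X' V' n \<cdot> w" for w
      using e_eq[of w n] by (simp add: oconv_apply L1.es_def L2.es_def L1.vs_def L2.vs_def vs)
  qed
  then have "oconv X V = oconv X' V" by (auto simp: V)
  then have "oconv (oconv X V) (Den X) = oconv (oconv X' V) (Den X)" by simp
  then show "X = X'" by (simp add: oconv_assoc L1.VD fun_eq_iff)
qed

text \<open>For a solution \<open>F\<close>, the state after \<open>N\<close> steps is \<open>\<Lambda>\<^sup>-\<^sup>1 W\<close> applied to the tail of the output, and the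
  energy bound comes from continuing the input by \<open>Wt\<^sup>\<dagger> x\<close> after time \<open>N\<close>.\<close>

lemma solution_energy:
  assumes F: "contr_seq F" and sol: "W \<circ>\<^sub>C toep F = Wt"
    and x: "\<Lambda> \<cdot> x = W \<cdot> op_pow (shift_op\<^sup>\<dagger>) N \<cdot> toep F \<cdot> uN"
    and uN: "\<And>k. ell2_nth uN k = (if k < N then u k else 0)"
  shows "inner (\<Lambda> \<cdot> x) x + (\<Sum>n<N. (norm (conv F u n))\<^sup>2) \<le> (\<Sum>n<N. (norm (u n))\<^sup>2)"
proof -
  define T where "T = toep F"
  define S where "S = op_pow (shift_op\<^sup>\<dagger> :: 'y ell2 \<Rightarrow>\<^sub>C\<^sub>L 'y ell2) N"
  define u' where "u' = Wt\<^sup>\<dagger> \<cdot> x"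
  define b where "b = W\<^sup>\<dagger> \<cdot> x"
  define U where "U = uN + ((\<cdot>) shift_op ^^ N) u'"
  have nthU: "ell2_nth U k = (if k < N then u k else ell2_nth u' (k - N))" for k
    by (simp add: U_def uN ell2_nth_shift_pow)
  have U_norm: "(norm U)\<^sup>2 = (\<Sum>n<N. (norm (u n))\<^sup>2) + (norm u')\<^sup>2"
  proof -
    have "op_pow (shift_op\<^sup>\<dagger>) N \<cdot> U = u'"
      by (rule ell2_eqI) (simp add: op_pow_apply ell2_nth_adj_shift_pow nthU)
    then show ?thesis using norm_ell2_split[of U N] by (simp add: nthU)
  qed
  have SU: "S \<cdot> T \<cdot> U = S \<cdot> T \<cdot> uN + T \<cdot> u'"
  proof -
    have "S \<cdot> ((\<cdot>) shift_op ^^ N) a = a" for a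
      by (rule ell2_eqI) (simp add: S_def op_pow_apply ell2_nth_adj_shift_pow ell2_nth_shift_pow)
    then show ?thesis by (simp add: U_def T_def cblinfun.add_right toep_shift_pow[OF F])
  qed
  have "(norm (T \<cdot> U))\<^sup>2 \<le> (norm U)\<^sup>2" unfolding T_def by (intro power_mono norm_toep_le[OF F]) simp
  moreover have "(norm (T \<cdot> U))\<^sup>2 = (\<Sum>n<N. (norm (conv F u n))\<^sup>2) + (norm (S \<cdot> T \<cdot> U))\<^sup>2"
  proof -
    have "ell2_nth (T \<cdot> U) n = conv F u n" if "n < N" for n
      unfolding T_def ell2_nth_toep[OF F] using that by (intro conv_cong) (simp add: nthU)
    then show ?thesis using norm_ell2_split[of "T \<cdot> U" N] by (simp add: S_def)
  qed
  ultimately have 1: "(\<Sum>n<N. (norm (conv F u n))\<^sup>2) + (norm (S \<cdot> T \<cdot> uN + T \<cdot> u'))\<^sup>2 \<le> (\<Sum>n<N. (norm (u n))\<^sup>2) + (norm u')\<^sup>2"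
    by (simp add: U_norm SU)
  \<comment> \<open>With \<open>a\<close> the tail of the output, |a|^2 \<ge> 2
    \<open>inner a b\<close> - |b|^2. Both \<open>inner a b\<close> and |b|^2 turn out to be
    \<open>inner (\<Lambda> \<cdot> x) x\<close> + |u'|^2, the first by the interpolation condition,
    the second by the definition of \<Lambda>.\<close>
  have "0 \<le> (norm (S \<cdot> T \<cdot> uN + T \<cdot> u' - b))\<^sup>2" by simp
  also have "\<dots> = (norm (S \<cdot> T \<cdot> uN + T \<cdot> u'))\<^sup>2 - 2 * inner (S \<cdot> T \<cdot> uN + T \<cdot> u') b + (norm b)\<^sup>2"
    unfolding power2_norm_eq_inner by (simp add: inner_diff_left inner_diff_right inner_commute[of b "S \<cdot> T \<cdot> uN + T \<cdot> u'"])
  finally have 2: "2 * inner (S \<cdot> T \<cdot> uN + T \<cdot> u') b - (norm b)\<^sup>2 \<le> (norm (S \<cdot> T \<cdot> uN + T \<cdot> u'))\<^sup>2" by linarith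
  have "inner (S \<cdot> T \<cdot> uN) b = inner (\<Lambda> \<cdot> x) x"
    unfolding b_def inner_adj_right[of W, symmetric] x by (simp add: S_def T_def)
  moreover have "inner (T \<cdot> u') b = (norm u')\<^sup>2"
  proof -
    have "W \<cdot> T \<cdot> u' = Wt \<cdot> u'" using sol unfolding T_def by (metis cblinfun_compose_apply)
    then show ?thesis
      unfolding b_def inner_adj_right[of W, symmetric] by (simp add: u'_def inner_WW_adj)
  qed
  ultimately have 3: "inner (S \<cdot> T \<cdot> uN + T \<cdot> u') b = inner (\<Lambda> \<cdot> x) x + (norm u')\<^sup>2" by (simp add: inner_add_left)
  have 4: "(norm b)\<^sup>2 = inner (\<Lambda> \<cdot> x) x + (norm u')\<^sup>2"
    using inner_P[of x] by (simp add: P_def inner_WW_adj b_def u'_def)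
  show ?thesis using 1 2 3 4 by linarith
qed

text \<open>\<open>Xi\<close>, \<open>V\<close> and \<open>E\<close> are the responses of state,
  \<open>v\<close> and \<open>e\<close> to an impulse in \<open>u\<close>. The parameter is the
  formal quotient of \<open>E\<close> by \<open>V\<close>, whose inverse \<open>G\<close> turns out
  to be the denominator; contractivity comes from \<open>solution_energy\<close>.\<close>

lemma solution_feedback_exists:
  assumes F: "contr_seq F" and sol: "W \<circ>\<^sub>C toep F = Wt"
  obtains X V where "feedback X V" "F = oconv (Num X) V"
proof -
  define Sy where "Sy = (shift_op\<^sup>\<dagger> :: 'y ell2 \<Rightarrow>\<^sub>C\<^sub>L 'y ell2)"
  define Su where "Su = (shift_op\<^sup>\<dagger> :: 'u ell2 \<Rightarrow>\<^sub>C\<^sub>L 'u ell2)"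
  define Xi where "Xi n = iL \<circ>\<^sub>C (W \<circ>\<^sub>C op_pow Sy n \<circ>\<^sub>C toep F - Wt \<circ>\<^sub>C op_pow Su n) \<circ>\<^sub>C embed_op" for n
  define V where "V n = R \<circ>\<^sub>C (impulse id_cblinfun n - Bt\<^sup>\<dagger> \<circ>\<^sub>C Xi n)" for n
  define E where "E n = Q \<circ>\<^sub>C (D \<circ>\<^sub>C F n + C \<circ>\<^sub>C P \<circ>\<^sub>C Xi (Suc n))" for n
  have LXi: "\<Lambda> \<cdot> Xi n \<cdot> w = W \<cdot> op_pow Sy n \<cdot> toep F \<cdot> embed_op \<cdot> w - Wt \<cdot> op_pow Su n \<cdot> embed_op \<cdot> w" for n w
    by (simp add: Xi_def cblinfun.diff_left)
  have imp: "impulse id_cblinfun n \<cdot> w = impulse w n" for n and w :: 'u by (simp add: impulse_def)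
  \<comment> \<open>The interpolation condition enters as the vanishing of the initial
    state.\<close>
  have Xi0: "Xi 0 = 0"
  proof (rule cblinfun_eqI)
    have "W \<cdot> toep F \<cdot> a = Wt \<cdot> a" for a using sol by (metis cblinfun_compose_apply)
    then show "Xi 0 \<cdot> w = 0 \<cdot> w" for w by (simp add: Xi_def cblinfun.diff_left)
  qed
  have st: "step (Xi n \<cdot> w) (E n \<cdot> w) (V n \<cdot> w) (Xi (Suc n) \<cdot> w) (F n \<cdot> w) (impulse w n)" for n w
  proof (rule stepI)
    have "ell2_nth (op_pow Sy n \<cdot> toep F \<cdot> embed_op \<cdot> w) 0 = F n \<cdot> w"
      by (simp add: Sy_def op_pow_apply ell2_nth_adj_shift_pow ell2_nth_toep_embed[OF F])
    moreover have "ell2_nth (op_pow Su n \<cdot> embed_op \<cdot> w) 0 = impulse w n"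
      by (simp add: Su_def op_pow_apply ell2_nth_adj_shift_pow ell2_nth_embed impulse_def)
    ultimately show "\<Lambda> \<cdot> Xi n \<cdot> w = Z \<cdot> \<Lambda> \<cdot> Xi (Suc n) \<cdot> w + B \<cdot> F n \<cdot> w - Bt \<cdot> impulse w n"
      using intertwine_split[OF ZW, of "op_pow Sy n \<cdot> toep F \<cdot> embed_op \<cdot> w"]
        intertwine_split[OF ZWt, of "op_pow Su n \<cdot> embed_op \<cdot> w"]
      unfolding LXi by (simp add: Sy_def Su_def B_def Bt_def cblinfun.diff_right)
    show "E n \<cdot> w = Q \<cdot> (D \<cdot> F n \<cdot> w + C \<cdot> P \<cdot> Xi (Suc n) \<cdot> w)" by (simp add: E_def cblinfun.add_left)
    show "V n \<cdot> w = R \<cdot> (impulse w n - Bt\<^sup>\<dagger> \<cdot> Xi n \<cdot> w)" by (simp add: V_def imp cblinfun.diff_left)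
  qed
  note traj = trajectory_unique[of "\<lambda>n. Xi n \<cdot> w" "\<lambda>n. E n \<cdot> w" "\<lambda>n. V n \<cdot> w" "\<lambda>n. F n \<cdot> w" "impulse w" for w,
      OF _ st, unfolded Xi0 cblinfun.zero_left, OF refl]
  have Xi_eq: "Xi = (\<lambda>n. oconv G1 E n + oconv G2 V n - (iL \<circ>\<^sub>C Bt \<circ>\<^sub>C R) \<circ>\<^sub>C V n)"
    by (intro ext cblinfun_eqI) (simp add: traj(1) state_def cblinfun_simps oconv_apply)
  have F_eq: "F = (\<lambda>n. oconv U11c E n + oconv U12c V n)"
    by (intro ext cblinfun_eqI) (simp add: traj(2) outy_def cblinfun_simps oconv_apply)
  have id_eq: "impulse id_cblinfun = (\<lambda>n. oconv U21c E n + oconv U22c V n)"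
    by (intro ext cblinfun_eqI) (simp add: imp traj(3) outu_def cblinfun_simps oconv_apply)
  have "V 0 = R" by (simp add: V_def Xi0 impulse_def cblinfun_compose.zero_right)
  moreover have "R \<circ>\<^sub>C (TR \<circ>\<^sub>C R) = id_cblinfun" "(TR \<circ>\<^sub>C R) \<circ>\<^sub>C R = id_cblinfun" by (simp_all add: cblinfun_eqI)
  ultimately obtain G where G: "oconv V G = impulse id_cblinfun" "oconv G V = impulse id_cblinfun"
    using oconv_inverse_exists[of V "TR \<circ>\<^sub>C R"] by metis
  define X where "X = oconv E G"
  have XV: "oconv X V = E" by (simp add: X_def oconv_assoc G fun_eq_iff)
  have DV: "oconv (Den X) V = impulse id_cblinfun"
    by (rule ext) (simp add: Den_def oconv_add_left oconv_assoc XV id_eq)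
  have "Den X = oconv (Den X) (oconv V G)" by (simp add: G fun_eq_iff)
  also have "\<dots> = G" by (simp add: oconv_assoc[symmetric] DV)
  finally have VD: "oconv V (Den X) = impulse id_cblinfun" using G by simp
  have FN: "F = oconv (Num X) V"
    by (rule ext) (simp add: Num_def oconv_add_left oconv_assoc XV F_eq)
  have "contr_seq X"
    unfolding contr_seq_def
  proof (intro allI)
    fix v :: "nat \<Rightarrow> 'u" and N :: nat
    \<comment> \<open>Every \<open>v\<close> occurs in the loop: the external input
      \<open>G v\<close> produces it.\<close>
    define u where "u = conv G v"
    define e where "e = conv X v"
    have v: "v = conv V u" by (simp add: u_def conv_oconv[symmetric] G fun_eq_iff)
    have e: "e = conv E u" by (simp add: e_def u_def X_def conv_oconv)
    have y: "outy e v n = conv F u n" and uu: "outu e v n = u n" and xx: "state e v n = conv Xi u n" for n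
    proof -
      show "outy e v n = conv F u n"
        unfolding F_eq conv_add_left conv_oconv outy_def e v by (rule refl)
      have "outu e v n = conv (\<lambda>n. oconv U21c E n + oconv U22c V n) u n"
        unfolding conv_add_left conv_oconv outu_def e v by (rule refl)
      then show "outu e v n = u n" by (simp add: id_eq[symmetric])
      have "conv Xi u n = conv (\<lambda>n. oconv G1 E n + oconv G2 V n) u n - conv (\<lambda>n. (iL \<circ>\<^sub>C Bt \<circ>\<^sub>C R) \<circ>\<^sub>C V n) u n"
        unfolding Xi_eq by (simp add: conv_def cblinfun.diff_left sum_subtractf)
      then show "state e v n = conv Xi u n"
        unfolding conv_add_left conv_oconv conv_compose_left state_def e v by simp
    qed
    define uN where "uN = (\<Sum>k<N. ((\<cdot>) shift_op ^^ k) (embed_op \<cdot> u k))"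
    have nth: "ell2_nth uN k = (if k < N then u k else 0)" for k
      by (simp add: uN_def ell2_nth_sum ell2_nth_single)
    have "\<Lambda> \<cdot> state e v N = W \<cdot> op_pow Sy N \<cdot> toep F \<cdot> uN"
    proof -
      have "\<Lambda> \<cdot> state e v N = (\<Sum>k\<le>N. \<Lambda> \<cdot> Xi (N - k) \<cdot> u k)"
        by (simp add: xx conv_def cblinfun.sum_right)
      \<comment> \<open>The term \<open>k = N\<close> drops out because \<open>Xi 0 = 0\<close>. For
        \<open>k < N\<close> the \<open>Wt\<close> part vanishes, since a positive power of the
        backward shift annihilates the range of \<open>embed_op\<close>.\<close>
      also have "\<dots> = (\<Sum>k<N. \<Lambda> \<cdot> Xi (N - k) \<cdot> u k)"
        by (simp add: lessThan_Suc_atMost[symmetric] Xi0)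
      also have "\<dots> = (\<Sum>k<N. W \<cdot> op_pow Sy N \<cdot> toep F \<cdot> ((\<cdot>) shift_op ^^ k) (embed_op \<cdot> u k))"
      proof (rule sum.cong)
        fix k assume k: "k \<in> {..<N}"
        have "op_pow Su (N - k) \<cdot> embed_op \<cdot> u k = 0"
          using k by (intro ell2_eqI) (simp add: Su_def op_pow_apply ell2_nth_adj_shift_pow ell2_nth_embed)
        moreover have "op_pow Sy (N - k) \<cdot> a = op_pow Sy N \<cdot> ((\<cdot>) shift_op ^^ k) a" for a
          using k by (intro ell2_eqI) (simp add: Sy_def op_pow_apply ell2_nth_adj_shift_pow ell2_nth_shift_pow)
        ultimately show "\<Lambda> \<cdot> Xi (N - k) \<cdot> u k = W \<cdot> op_pow Sy N \<cdot> toep F \<cdot> ((\<cdot>) shift_op ^^ k) (embed_op \<cdot> u k)"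
          by (simp add: LXi toep_shift_pow[OF F])
      qed simp
      finally show ?thesis by (simp add: uN_def cblinfun.sum_right)
    qed
    from solution_energy[OF F sol this[unfolded Sy_def] nth] energy_sum[of e v N]
    have "(\<Sum>n<N. (norm (e n))\<^sup>2) \<le> (\<Sum>n<N. (norm (v n))\<^sup>2)" unfolding y uu by linarith
    then show "(\<Sum>n<N. (norm (conv X v n))\<^sup>2) \<le> (\<Sum>n<N. (norm (v n))\<^sup>2)" by (simp add: e_def)
  qed
  then have "feedback X V"
    by unfold_locales (use DV VD in auto)
  then show thesis using FN by (rule that)
qed

end

section \<open>From formal power series to functions on the disc\<close>

context ltonp_system
begin

abbreviation "res z \<equiv> op_inv (id_cblinfun - z *\<^sub>C Z\<^sup>\<dagger>)"

lemma res_eq: "z \<in> \<DD> \<Longrightarrow> res z = disc_sum (op_pow (Z\<^sup>\<dagger>)) z"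
  by (intro op_inv_eqI resolvent_inverse)

lemma disc_summable_G2: "disc_summable G2"
  unfolding G2_def by (rule disc_summable_compose_right[OF pow_disc_summable])

lemma disc_sum_G2:
  assumes z: "z \<in> \<DD>"
  shows "disc_sum G2 z = res z \<circ>\<^sub>C (iL \<circ>\<^sub>C Bt \<circ>\<^sub>C R)"
  unfolding G2_def res_eq[OF z] by (rule disc_sum_compose_right[OF pow_disc_summable z])

lemma G1_Suc: "(\<lambda>n. G1 (Suc n)) = (\<lambda>n. op_pow (Z\<^sup>\<dagger>) n \<circ>\<^sub>C (iL \<circ>\<^sub>C P \<circ>\<^sub>C C\<^sup>\<dagger> \<circ>\<^sub>C Q))"
  by (simp add: G1_def)

lemma G1_Suc_summable: "disc_summable (\<lambda>n. G1 (Suc n))"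
  unfolding G1_Suc by (rule disc_summable_compose_right[OF pow_disc_summable])

lemma disc_summable_G1: "disc_summable G1"
  unfolding disc_summable_def
proof (intro allI impI)
  fix r :: real assume r: "0 \<le> r \<and> r < 1"
  have "summable (\<lambda>n. r * (r ^ n * norm (G1 (Suc n))))"
    using G1_Suc_summable r by (intro summable_mult) (simp add: disc_summable_def)
  then have "summable (\<lambda>n. r ^ Suc n * norm (G1 (Suc n)))" by (simp add: mult.assoc)
  then show "summable (\<lambda>n. r ^ n * norm (G1 n))" by (rule iffD1[OF summable_Suc_iff])
qed

lemma disc_sum_G1:
  assumes z: "z \<in> \<DD>"
  shows "disc_sum G1 z = z *\<^sub>C (res z \<circ>\<^sub>C (iL \<circ>\<^sub>C P \<circ>\<^sub>C C\<^sup>\<dagger> \<circ>\<^sub>C Q))"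
proof -
  have "disc_sum G1 z = G1 0 + z *\<^sub>C disc_sum (\<lambda>n. G1 (Suc n)) z"
    by (rule disc_sum_Suc[OF G1_Suc_summable z])
  also have "G1 0 = 0" by (simp add: G1_def)
  finally show ?thesis
    unfolding G1_Suc disc_sum_compose_right[OF pow_disc_summable z] res_eq[OF z] by simp
qed

lemma disc_summable_U:
  "disc_summable U11c" "disc_summable U12c" "disc_summable U21c" "disc_summable U22c"
  unfolding U11c_def U12c_def U21c_def U22c_def
  by (intro disc_summable_add disc_summable_impulse disc_summable_compose_left disc_summable_G1 disc_summable_G2)+

lemma disc_sum_U:
  assumes z: "z \<in> \<DD>"
  shows "disc_sum U11c z = D\<^sup>\<dagger> \<circ>\<^sub>C Q + z *\<^sub>C (B\<^sup>\<dagger> \<circ>\<^sub>C res z \<circ>\<^sub>C iL \<circ>\<^sub>C P \<circ>\<^sub>C C\<^sup>\<dagger> \<circ>\<^sub>C Q)"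
    and "disc_sum U12c z = B\<^sup>\<dagger> \<circ>\<^sub>C res z \<circ>\<^sub>C iL \<circ>\<^sub>C Bt \<circ>\<^sub>C R"
    and "disc_sum U21c z = z *\<^sub>C (Bt\<^sup>\<dagger> \<circ>\<^sub>C res z \<circ>\<^sub>C iL \<circ>\<^sub>C P \<circ>\<^sub>C C\<^sup>\<dagger> \<circ>\<^sub>C Q)"
    and "disc_sum U22c z = R + Bt\<^sup>\<dagger> \<circ>\<^sub>C res z \<circ>\<^sub>C iL \<circ>\<^sub>C Bt \<circ>\<^sub>C R"
  unfolding U11c_def U12c_def U21c_def U22c_def
  by (simp_all add: disc_sum_add[OF disc_summable_impulse disc_summable_compose_left[OF disc_summable_G1] z]
      disc_sum_add[OF disc_summable_impulse disc_summable_compose_left[OF disc_summable_G2] z]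
      disc_sum_compose_left[OF disc_summable_G1 z] disc_sum_compose_left[OF disc_summable_G2 z]
      disc_sum_G1[OF z] disc_sum_G2[OF z] cblinfun_compose_scaleC cblinfun_compose_assoc)

lemma feedbackE:
  assumes "contr_seq X"
  obtains V where "feedback X V"
proof -
  obtain V where "oconv (Den X) V = impulse id_cblinfun" "oconv V (Den X) = impulse id_cblinfun"
    using Den_inverse_exists by blast
  with assms have "feedback X V" by unfold_locales auto
  then show thesis by (rule that)
qed

end

context ltonp_feedback
begin

text \<open>Evaluation at a point of the disc is multiplicative, so the two formal identities
  between \<open>Den X\<close> and \<open>V\<close> become an operator inverse at
  \<open>z\<close>.\<close>

lemma param_eq:
  assumes z: "z \<in> \<DD>" and Xz: "Xz = disc_sum X z"
  shows "op_invertible (disc_sum U21c z \<circ>\<^sub>C Xz + disc_sum U22c z)"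
    and "(disc_sum U11c z \<circ>\<^sub>C Xz + disc_sum U12c z) \<circ>\<^sub>C op_inv (disc_sum U21c z \<circ>\<^sub>C Xz + disc_sum U22c z)
      = disc_sum F z"
proof -
  note sX = contr_seq_disc_summable[OF X]
  have sD: "disc_summable (Den X)" and sN: "disc_summable (Num X)"
    unfolding Den_def Num_def by (intro disc_summable_add disc_summable_oconv disc_summable_U sX)+
  have den: "disc_sum U21c z \<circ>\<^sub>C Xz + disc_sum U22c z = disc_sum (Den X) z"
    unfolding Den_def Xz
    by (simp only: disc_sum_add[OF disc_summable_oconv[OF _ sX] _ z] disc_sum_oconv[OF _ sX z] disc_summable_U)
  have num: "disc_sum U11c z \<circ>\<^sub>C Xz + disc_sum U12c z = disc_sum (Num X) z"
    unfolding Num_def Xz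
    by (simp only: disc_sum_add[OF disc_summable_oconv[OF _ sX] _ z] disc_sum_oconv[OF _ sX z] disc_summable_U)
  have inv: "disc_sum V z \<circ>\<^sub>C disc_sum (Den X) z = id_cblinfun" "disc_sum (Den X) z \<circ>\<^sub>C disc_sum V z = id_cblinfun"
    using disc_sum_oconv[OF disc_summable_V sD z] disc_sum_oconv[OF sD disc_summable_V z] by (simp_all add: DV VD)
  show "op_invertible (disc_sum U21c z \<circ>\<^sub>C Xz + disc_sum U22c z)"
    unfolding den by (rule op_invertibleI[OF inv])
  show "(disc_sum U11c z \<circ>\<^sub>C Xz + disc_sum U12c z) \<circ>\<^sub>C op_inv (disc_sum U21c z \<circ>\<^sub>C Xz + disc_sum U22c z)
      = disc_sum F z"
    unfolding den num op_inv_eqI[OF inv] F_def by (rule disc_sum_oconv[OF sN disc_summable_V z, symmetric])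
qed

end

context ltonp_system
begin

text \<open>The four functions are tied to the coefficient series only on the disc, so that closed
  resolvent formulas can be inserted. Uniqueness of Taylor coefficients links
  \<open>toeplitz_op\<close> of a function to \<open>toep\<close> of the loop coefficients.\<close>

lemma all_solutions:
  assumes U: "\<And>z. z \<in> \<DD> \<Longrightarrow> U11 z = disc_sum U11c z" "\<And>z. z \<in> \<DD> \<Longrightarrow> U12 z = disc_sum U12c z"
    "\<And>z. z \<in> \<DD> \<Longrightarrow> U21 z = disc_sum U21c z" "\<And>z. z \<in> \<DD> \<Longrightarrow> U22 z = disc_sum U22c z"
  defines "param \<equiv> \<lambda>X z. (U11 z \<circ>\<^sub>C X z + U12 z) \<circ>\<^sub>C op_inv (U21 z \<circ>\<^sub>C X z + U22 z)"
  shows "\<forall>X\<in>schur_class. \<forall>z\<in>\<DD>. op_invertible (U21 z \<circ>\<^sub>C X z + U22 z)"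
    and "ltonp_solution W Wt F \<longleftrightarrow> (\<exists>X\<in>schur_class. \<forall>z\<in>\<DD>. F z = param X z)"
    and "\<forall>X\<in>schur_class. \<forall>X'\<in>schur_class. (\<forall>z\<in>\<DD>. param X z = param X' z) \<longrightarrow> (\<forall>z\<in>\<DD>. X z = X' z)"
proof -
  have coeffs: "\<exists>A V. feedback A V \<and> (\<forall>z\<in>\<DD>. X z = disc_sum A z)"
    if "X \<in> schur_class" for X
    using that feedbackE unfolding schur_class_iff_contr_seq by metis
  have param: "param X z = disc_sum (ltonp_feedback.F Z P \<Lambda> B Bt C D Q R A V) z"
    and inv: "op_invertible (U21 z \<circ>\<^sub>C X z + U22 z)"
    if L: "feedback A V" and X: "\<forall>z\<in>\<DD>. X z = disc_sum A z" and z: "z \<in> \<DD>" for A V X z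
    unfolding param_def U[OF z]
    using ltonp_feedback.param_eq[OF L z bspec[OF X z]] by simp_all
  show "\<forall>X\<in>schur_class. \<forall>z\<in>\<DD>. op_invertible (U21 z \<circ>\<^sub>C X z + U22 z)"
    using coeffs inv by blast
  show "ltonp_solution W Wt F \<longleftrightarrow> (\<exists>X\<in>schur_class. \<forall>z\<in>\<DD>. F z = param X z)"
  proof
    assume F: "ltonp_solution W Wt F"
    then obtain Fc where Fc: "contr_seq Fc" "\<forall>z\<in>\<DD>. F z = disc_sum Fc z"
      unfolding ltonp_solution_def schur_class_iff_contr_seq by blast
    have "taylor_coeffs F = Fc"
      using Fc by (intro taylor_coeffs_eqI contr_seq_disc_summable) auto
    then have sol: "W \<circ>\<^sub>C toep Fc = Wt" using F by (simp add: ltonp_solution_def toeplitz_op_eq_toep)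
    obtain A V where L: "feedback A V" and eq: "Fc = oconv (Num A) V"
      using solution_feedback_exists[OF Fc(1) sol] by blast
    interpret L: ltonp_feedback Z W Wt P \<Lambda> B Bt C D Q R A V by (rule L)
    have "F z = param (disc_sum A) z" if "z \<in> \<DD>" for z
      using param[OF L _ that, of "disc_sum A"] Fc(2) that by (simp add: eq L.F_def)
    then show "\<exists>X\<in>schur_class. \<forall>z\<in>\<DD>. F z = param X z" using contr_seq_schur[OF L.X] by blast
  next
    assume "\<exists>X\<in>schur_class. \<forall>z\<in>\<DD>. F z = param X z"
    then obtain X A V where L: "feedback A V"
      and X: "\<forall>z\<in>\<DD>. X z = disc_sum A z" and F: "\<forall>z\<in>\<DD>. F z = param X z"
      using coeffs by metis
    interpret L: ltonp_feedback Z W Wt P \<Lambda> B Bt C D Q R A V by (rule L)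
    have Fc: "F z = disc_sum L.F z" if "z \<in> \<DD>" for z using F param[OF L X that] that by simp
    have "taylor_coeffs F = L.F"
      by (rule taylor_coeffs_eqI[OF contr_seq_disc_summable[OF L.contr_F] Fc])
    moreover have "F \<in> schur_class" unfolding schur_class_iff_contr_seq using L.contr_F Fc by blast
    ultimately show "ltonp_solution W Wt F"
      using L.interpolates by (simp add: ltonp_solution_def toeplitz_op_eq_toep)
  qed
  show "\<forall>X\<in>schur_class. \<forall>X'\<in>schur_class. (\<forall>z\<in>\<DD>. param X z = param X' z) \<longrightarrow> (\<forall>z\<in>\<DD>. X z = X' z)"
  proof (intro ballI impI)
    fix X X' z assume XX: "X \<in> schur_class" "X' \<in> schur_class" and eq: "\<forall>z\<in>\<DD>. param X z = param X' z"
      and z: "z \<in> \<DD>"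
    obtain A V where L: "feedback A V" and X: "\<forall>z\<in>\<DD>. X z = disc_sum A z"
      using coeffs[OF XX(1)] by blast
    obtain A' V' where L': "feedback A' V'" and X': "\<forall>z\<in>\<DD>. X' z = disc_sum A' z"
      using coeffs[OF XX(2)] by blast
    interpret L: ltonp_feedback Z W Wt P \<Lambda> B Bt C D Q R A V by (rule L)
    interpret L': ltonp_feedback Z W Wt P \<Lambda> B Bt C D Q R A' V' by (rule L')
    have "taylor_coeffs (param X) = L.F"
      by (rule taylor_coeffs_eqI[OF contr_seq_disc_summable[OF L.contr_F] param[OF L X]])
    moreover have "taylor_coeffs (param X) = L'.F"
      by (rule taylor_coeffs_eqI[OF contr_seq_disc_summable[OF L'.contr_F]])
        (simp only: eq param[OF L' X'])
    ultimately have "oconv (Num A) V = oconv (Num A') V'" unfolding L.F_def L'.F_def by simp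
    then have "A = A'" by (rule feedback_injective[OF L L'])
    then show "X z = X' z" using X X' z by simp
  qed
qed

lemma analytic_U:
  "analytic_on_disc (disc_sum U11c)" "analytic_on_disc (disc_sum U12c)"
  "analytic_on_disc (disc_sum U21c)" "analytic_on_disc (disc_sum U22c)"
  by (intro analytic_disc_sum disc_summable_U)+

end

theorem theorem1p1:
  fixes Z :: "'z::complex_hilbert \<Rightarrow>\<^sub>C\<^sub>L 'z"
    and W :: "'y::complex_hilbert ell2 \<Rightarrow>\<^sub>C\<^sub>L 'z"
    and Wt :: "'u::complex_hilbert ell2 \<Rightarrow>\<^sub>C\<^sub>L 'z"
    and P \<Lambda> :: "'z \<Rightarrow>\<^sub>C\<^sub>L 'z"
    and B :: "'y \<Rightarrow>\<^sub>C\<^sub>L 'z" and Bt :: "'u \<Rightarrow>\<^sub>C\<^sub>L 'z"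
  assumes data: "ltonp_data Z W Wt"
    and P_def: "P = W \<circ>\<^sub>C W\<^sup>\<dagger>"
    and Lambda_def: "\<Lambda> = W \<circ>\<^sub>C W\<^sup>\<dagger> - Wt \<circ>\<^sub>C Wt\<^sup>\<dagger>"
    and Lambda_pos: "strictly_positive \<Lambda>"
    and B_def: "B = W \<circ>\<^sub>C embed_op"
    and Bt_def: "Bt = Wt \<circ>\<^sub>C embed_op"
  shows "strictly_positive P \<and>
    nonneg_op (op_inv \<Lambda> - op_inv P) \<and>
    pointwise_stable (Z\<^sup>\<dagger>) \<and>
    op_spectral_radius (Z\<^sup>\<dagger>) \<le> 1 \<and>
    (\<forall>(C :: 'z \<Rightarrow>\<^sub>C\<^sub>L 'e::complex_hilbert) (D :: 'y \<Rightarrow>\<^sub>C\<^sub>L 'e). admissible_pair Z W C D \<longrightarrow>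
      (let Q = op_inv (op_sqrt
                 (id_cblinfun + C \<circ>\<^sub>C P \<circ>\<^sub>C (op_inv \<Lambda> - op_inv P) \<circ>\<^sub>C P \<circ>\<^sub>C C\<^sup>\<dagger>));
           R = op_inv (op_sqrt (id_cblinfun + Bt\<^sup>\<dagger> \<circ>\<^sub>C op_inv \<Lambda> \<circ>\<^sub>C Bt));
           res = (\<lambda>z. op_inv (id_cblinfun - z *\<^sub>C Z\<^sup>\<dagger>));
           U11 = (\<lambda>z. D\<^sup>\<dagger> \<circ>\<^sub>C Q + z *\<^sub>C (B\<^sup>\<dagger> \<circ>\<^sub>C res z \<circ>\<^sub>C op_inv \<Lambda> \<circ>\<^sub>C P \<circ>\<^sub>C C\<^sup>\<dagger> \<circ>\<^sub>C Q));
           U12 = (\<lambda>z. B\<^sup>\<dagger> \<circ>\<^sub>C res z \<circ>\<^sub>C op_inv \<Lambda> \<circ>\<^sub>C Bt \<circ>\<^sub>C R);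
           U21 = (\<lambda>z. z *\<^sub>C (Bt\<^sup>\<dagger> \<circ>\<^sub>C res z \<circ>\<^sub>C op_inv \<Lambda> \<circ>\<^sub>C P \<circ>\<^sub>C C\<^sup>\<dagger> \<circ>\<^sub>C Q));
           U22 = (\<lambda>z. R + Bt\<^sup>\<dagger> \<circ>\<^sub>C res z \<circ>\<^sub>C op_inv \<Lambda> \<circ>\<^sub>C Bt \<circ>\<^sub>C R);
           param = (\<lambda>X z. (U11 z \<circ>\<^sub>C X z + U12 z) \<circ>\<^sub>C op_inv (U21 z \<circ>\<^sub>C X z + U22 z))
       in strictly_positive Q \<and> strictly_positive R \<and>
          analytic_on_disc U11 \<and> analytic_on_disc U12 \<and>
          analytic_on_disc U21 \<and> analytic_on_disc U22 \<and>
          (\<forall>X\<in>schur_class. \<forall>z\<in>\<DD>. op_invertible (U21 z \<circ>\<^sub>C X z + U22 z)) \<and>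
          (\<forall>F. ltonp_solution W Wt F \<longleftrightarrow> (\<exists>X\<in>schur_class. \<forall>z\<in>\<DD>. F z = param X z)) \<and>
          (\<forall>X\<in>schur_class. \<forall>X'\<in>schur_class.
             (\<forall>z\<in>\<DD>. param X z = param X' z) \<longrightarrow> (\<forall>z\<in>\<DD>. X z = X' z))))"
proof -
  interpret ltonp Z W Wt P \<Lambda> B Bt
    using assms by unfold_locales (simp_all add: ltonp_data_def)
  show ?thesis
  proof (intro conjI allI impI, goal_cases)
    case 1
    show ?case by (rule P_pos)
  next
    case 2
    show ?case by (rule nonneg_inv_diff)
  next
    case 3
    show ?case using pow_stable by (simp add: pointwise_stable_def op_pow_apply)
  next
    case 4
    show ?case by (rule spectral_radius_le)
  next
    case (5 C D)
    define Q where "Q = op_inv (op_sqrt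
      (id_cblinfun + C \<circ>\<^sub>C P \<circ>\<^sub>C (op_inv \<Lambda> - op_inv P) \<circ>\<^sub>C P \<circ>\<^sub>C C\<^sup>\<dagger>))"
    define R where "R = op_inv (op_sqrt (id_cblinfun + Bt\<^sup>\<dagger> \<circ>\<^sub>C op_inv \<Lambda> \<circ>\<^sub>C Bt))"
    interpret ltonp_system Z W Wt P \<Lambda> B Bt C D Q R
      by unfold_locales (simp_all only: 5 Q_def R_def)
    note U = disc_sum_U[symmetric]
    note analytic = analytic_on_disc_cong[OF disc_sum_U(1) analytic_U(1)]
      analytic_on_disc_cong[OF disc_sum_U(2) analytic_U(2)]
      analytic_on_disc_cong[OF disc_sum_U(3) analytic_U(3)]
      analytic_on_disc_cong[OF disc_sum_U(4) analytic_U(4)]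
    show ?case
      unfolding Let_def Q_def[symmetric] R_def[symmetric]
      by (intro conjI allI Q_pos R_pos analytic all_solutions[OF U])
  qed
qed

end
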